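(* Consider the block Gibbs sampler defined in the context in the balanced case, i.e. $m_i=m\ge2$ for all $i=1,\ldots,K$, with $K\ge3$. Let $P^n((\lambda_0,\xi_0),\cdot)$ denote its $n$-step Markov transition kernel started at $(\lambda_0,\xi_0)$, $\xi_0=(\theta_0,\mu_0)$, and let $\pi_h(\cdot)$ be the posterior distribution. Let $$\delta_1=\frac{1}{2a_1+K-2},\quad \delta_2=\frac{1}{2a_2+M-2},\quad \delta_3=(K+1)\delta_2,\quad \delta_5=K\delta_2,\quad \delta=\max\{\delta_1,\delta_3\},$$ $c_1=2b_1\delta_1$ and $c_2=(2b_2+\mathrm{SSE})\delta_2$. Choose $\gamma\in(\delta,1)$ and $\phi>0$ such that $\phi\delta_5+\delta<\gamma$, let $$b=\phi c_1+\frac{\phi K+K+1}{m}\,c_2+\max\{\phi,1\}\sum_{i=1}^K\max\{(\bar y-\bar y_i)^2,(m_0-\bar y_i)^2\},$$ and choose $d_{\mathrm R}>2b/(1-\gamma)$. Let $\varepsilon_{\mathrm B}=\left[\int_{\mathbb{R}_+}h_1(\lambda_\theta)\,d\lambda_\theta\right]\left[\int_{\mathbb{R}_+}h_2(\lambda_e)\,d\lambda_e\right]$, where $$h_1(\lambda_\theta)=\begin{cases}\mathrm{Gamma}\left(\frac K2+a_1,b_1;\lambda_\theta\right),&\lambda_\theta<\lambda_\theta^*,\\ \mathrm{Gamma}\left(\frac K2+a_1,\frac{d_{\mathrm R}}{2\phi}+b_1;\lambda_\theta\right),&\lambda_\theta\ge\lambda_\theta^*,\end{cases}\qquad\lambda_\theta^*=\frac{\phi(K+2a_1)}{d_{\mathrm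 R}}\log\left(1+\frac{d_{\mathrm R}}{2b_1\phi}\right),$$ $$h_2(\lambda_e)=\begin{cases}\mathrm{Gamma}\left(\frac M2+a_2,\frac{\mathrm{SSE}}2+b_2;\lambda_e\right),&\lambda_e<\lambda_e^*,\\ \mathrm{Gamma}\left(\frac M2+a_2,\frac{\mathrm{SSE}+md_{\mathrm R}}2+b_2;\lambda_e\right),&\lambda_e\ge\lambda_e^*,\end{cases}\qquad\lambda_e^*=\frac{M+2a_2}{md_{\mathrm R}}\log\left(1+\frac{md_{\mathrm R}}{2b_2+\mathrm{SSE}}\right).$$ Let $$\alpha=\frac{1+d_{\mathrm R}}{1+2b+\gamma d_{\mathrm R}},\qquad U=1+2(\gamma d_{\mathrm R}+b).$$ Then for any $0<r<1$ and any $n\in\{1,2,3,\ldots\}$, $$\|P^n((\lambda_0,\xi_0),\cdot)-\pi_h(\cdot)\|\le(1-\varepsilon_{\mathrm B})^{rn}+\left(\frac{U^r}{\alpha^{1-r}}\right)^n\left(1+\frac{b}{1-\gamma}+\phi v_1(\theta_0,\mu_0)+m^{-1}v_2(\theta_0)\right).$$ Moreover, when $\xi_0=\xi_0^{\mathrm{opt}}$ is the minimizer of $\phi v_1(\theta,\mu)+m^{-1}v_2(\theta)$ over $(\theta,\mu)\in\mathbb{R}^K\times\mathbb{R}$, this becomes $$\|P^n((\lambda_0,\xi_0^{\mathrm{opt}}),\cdot)-\pi_h(\cdot)\|\le(1-\varepsilon_{\mathrm B})^{rn}+\left(\frac{U^r}{\alpha^{1-r}}\right)^n\left(1+\frac{b}{1-\gamma}+\frac{\phi}{1+\phi}\sum_{i=1}^K(\bar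 y_i-\bar y)^2\right).$$
   Context: Model. $K$ and $m_1,\ldots,m_K$ are positive integers, $M=\sum_{i=1}^K m_i$, and $y=(y_{ij})$, $1\le i\le K$, $1\le j\le m_i$, is fixed real data. $a_1,b_1,a_2,b_2,s_0$ are known positive constants and $m_0\in\mathbb{R}$ is known. $\mathrm{Gamma}(\alpha,\beta)$ has density proportional to $w^{\alpha-1}e^{-w\beta}I(w>0)$, and $\mathrm{Gamma}(\alpha,\beta;x)$ denotes the value of the $\mathrm{Gamma}(\alpha,\beta)$ density at the point $x>0$. Hierarchical model: given $\theta=(\theta_1,\ldots,\theta_K)^T$ and $\lambda_e$, the $Y_{ij}$ are independent with $Y_{ij}\sim\mathrm{N}(\theta_i,\lambda_e^{-1})$; given $\mu,\lambda_\theta$, the variables $\theta_1,\ldots,\theta_K,\lambda_e$ are independent with $\theta_i\sim\mathrm{N}(\mu,\lambda_\theta^{-1})$ and $\lambda_e\sim\mathrm{Gamma}(a_2,b_2)$; $\mu\sim\mathrm{N}(m_0,s_0^{-1})$ and $\lambda_\theta\sim\mathrm{Gamma}(a_1,b_1)$ are independent. Write $\lambda=(\lambda_\theta,\lambda_e)^T$ and $\xi=(\theta_1,\ldots,\theta_K,\mu)^T$. The posterior $\pi_h$ is the conditional distribution of $(\theta,\mu,\lambda)$ given $Y=y$, with density proportional to $f(y\mid\theta,\lambda_e)f(\theta\mid\mu,\lambda_\theta)f(\lambda_e)f(\mu)f(\lambda_\theta)$. Notation: $\bar y_i=m_i^{-1}\sum_{j}y_{ij}$, $\bar y=K^{-1}\sum_{i=1}^K\bar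 y_i$, $\mathrm{SSE}=\sum_{i,j}(y_{ij}-\bar y_i)^2$, $v_1(\theta,\mu)=\sum_{i=1}^K(\theta_i-\mu)^2$, $v_2(\theta)=\sum_{i=1}^K m_i(\theta_i-\bar y_i)^2$. Total variation distance: $\|P-Q\|=\sup_A|P(A)-Q(A)|$ over Borel sets $A$. Block Gibbs sampler. The Markov chain on $(\lambda,\xi)\in\mathbb{R}_+^2\times\mathbb{R}^{K+1}$ whose transition $(\lambda',\xi')\to(\lambda,\xi)$ has density $k(\lambda,\xi\mid\lambda',\xi')=f(\lambda_\theta\mid\xi',y)f(\lambda_e\mid\xi',y)f(\xi\mid\lambda,y)$, where the $f$'s are the posterior conditional densities: $\lambda_\theta\mid\xi,y\sim\mathrm{Gamma}\left(\frac K2+a_1,\frac{v_1(\theta,\mu)}2+b_1\right)$, $\lambda_e\mid\xi,y\sim\mathrm{Gamma}\left(\frac M2+a_2,\frac{v_2(\theta)+\mathrm{SSE}}2+b_2\right)$, and $\xi\mid\lambda,y$ is multivariate normal with, for $t=\sum_{i=1}^K\frac{m_i\lambda_\theta\lambda_e}{\lambda_\theta+m_i\lambda_e}$, $E(\mu\mid\lambda)=\frac1{s_0+t}\left[\sum_{i=1}^K\frac{m_i\lambda_\theta\lambda_e\bar y_i}{\lambda_\theta+m_i\lambda_e}+m_0s_0\right]$, $E(\theta_i\mid\lambda)=\frac{\lambda_\theta E(\mu\mid\lambda)+m_i\lambda_e\bar y_i}{\lambda_\theta+m_i\lambda_e}$, $\mathrm{Var}(\mu\mid\lambda)=\frac1{s_0+t}$,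 $\mathrm{Var}(\theta_i\mid\lambda)=\frac1{\lambda_\theta+m_i\lambda_e}\left[1+\frac{\lambda_\theta^2}{(\lambda_\theta+m_i\lambda_e)(s_0+t)}\right]$, $\mathrm{Cov}(\theta_i,\mu\mid\lambda)=\frac{\lambda_\theta}{(\lambda_\theta+m_i\lambda_e)(s_0+t)}$, $\mathrm{Cov}(\theta_i,\theta_j\mid\lambda)=\frac{\lambda_\theta^2}{(\lambda_\theta+m_i\lambda_e)(\lambda_\theta+m_j\lambda_e)(s_0+t)}$ for $i\ne j$. *)

theory Defs
  imports "HOL-Probability.Probability"
begin

definition gamma_density :: "real \<Rightarrow> real \<Rightarrow> real \<Rightarrow> real" where
  "gamma_density \<alpha> \<beta> w =
     (if w > 0 then \<beta> powr \<alpha> / Gamma \<alpha> * w powr (\<alpha> - 1) * exp (- w * \<beta>) else 0)"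

text \<open>Density of the nondegenerate multivariate normal law with mean vector \<open>e\<close> and
  (positive definite) covariance matrix \<open>S\<close>.\<close>

definition mvn_density :: "real^'n \<Rightarrow> real^'n^'n \<Rightarrow> real^'n \<Rightarrow> real" where
  "mvn_density e S x =
     exp (- ((x - e) \<bullet> (matrix_inv S *v (x - e))) / 2) / sqrt ((2 * pi) ^ CARD('n) * det S)"

definition tv_dist :: "'a measure \<Rightarrow> 'a measure \<Rightarrow> real" where
  "tv_dist P Q = (SUP A\<in>sets P. \<bar>measure P A - measure Q A\<bar>)"

text \<open>The groups are indexed by a finite type \<open>'k\<close>, so \<open>K = CARD('k)\<close>; the observations in
  group \<open>i\<close> are \<open>y i j\<close> for \<open>j \<in> {1..ms i}\<close>.  The vector
  \<open>\<xi> = (\<theta>\<^sub>1, \<dots>, \<theta>\<^sub>K, \<mu>)\<close> lives in \<open>real^'k option\<close>: its component \<open>Some i\<close> is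
  \<open>\<theta>\<^sub>i\<close> and its component \<open>None\<close> is \<open>\<mu>\<close>.\<close>

type_synonym 'k state = "(real \<times> real) \<times> (real ^ 'k option)"

definition theta_of :: "real ^ 'k::finite option \<Rightarrow> real ^ 'k" where
  "theta_of \<xi> = (\<chi> i. \<xi> $ Some i)"

definition mu_of :: "real ^ 'k::finite option \<Rightarrow> real" where
  "mu_of \<xi> = \<xi> $ None"

definition base :: "'k::finite state measure" where
  "base = restrict_space lborel (({0<..} \<times> {0<..}) \<times> UNIV)"

definition obs_total :: "('k::finite \<Rightarrow> nat) \<Rightarrow> nat" where
  "obs_total ms = (\<Sum>i\<in>UNIV. ms i)"

definition group_mean :: "('k::finite \<Rightarrow> nat) \<Rightarrow> ('k \<Rightarrow> nat \<Rightarrow> real) \<Rightarrow> 'k \<Rightarrow> real" where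
  "group_mean ms y i = (\<Sum>j\<in>{1..ms i}. y i j) / real (ms i)"

definition grand_mean :: "('k::finite \<Rightarrow> nat) \<Rightarrow> ('k \<Rightarrow> nat \<Rightarrow> real) \<Rightarrow> real" where
  "grand_mean ms y = (\<Sum>i\<in>UNIV. group_mean ms y i) / real CARD('k)"

definition SSE :: "('k::finite \<Rightarrow> nat) \<Rightarrow> ('k \<Rightarrow> nat \<Rightarrow> real) \<Rightarrow> real" where
  "SSE ms y = (\<Sum>i\<in>UNIV. \<Sum>j\<in>{1..ms i}. (y i j - group_mean ms y i)\<^sup>2)"

definition v1 :: "real ^ 'k::finite \<Rightarrow> real \<Rightarrow> real" where
  "v1 \<theta> \<mu> = (\<Sum>i\<in>UNIV. (\<theta> $ i - \<mu>)\<^sup>2)"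

definition v2 :: "('k::finite \<Rightarrow> nat) \<Rightarrow> ('k \<Rightarrow> nat \<Rightarrow> real) \<Rightarrow> real ^ 'k \<Rightarrow> real" where
  "v2 ms y \<theta> = (\<Sum>i\<in>UNIV. real (ms i) * (\<theta> $ i - group_mean ms y i)\<^sup>2)"

text \<open>\<open>normal_density\<close> takes the standard deviation as its second argument.\<close>

definition joint_density ::
  "real \<Rightarrow> real \<Rightarrow> real \<Rightarrow> real \<Rightarrow> real \<Rightarrow> real \<Rightarrow> ('k::finite \<Rightarrow> nat) \<Rightarrow> ('k \<Rightarrow> nat \<Rightarrow> real)
     \<Rightarrow> 'k state \<Rightarrow> real" where
  "joint_density a1 b1 a2 b2 s0 m0 ms y = (\<lambda>((l\<theta>, le), \<xi>).
     (\<Prod>i\<in>UNIV. \<Prod>j\<in>{1..ms i}. normal_density (theta_of \<xi> $ i) (1 / sqrt le) (y i j))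
     * (\<Prod>i\<in>UNIV. normal_density (mu_of \<xi>) (1 / sqrt l\<theta>) (theta_of \<xi> $ i))
     * gamma_density a2 b2 le
     * normal_density m0 (1 / sqrt s0) (mu_of \<xi>)
     * gamma_density a1 b1 l\<theta>)"

definition posterior ::
  "real \<Rightarrow> real \<Rightarrow> real \<Rightarrow> real \<Rightarrow> real \<Rightarrow> real \<Rightarrow> ('k::finite \<Rightarrow> nat) \<Rightarrow> ('k \<Rightarrow> nat \<Rightarrow> real)
     \<Rightarrow> 'k state measure" where
  "posterior a1 b1 a2 b2 s0 m0 ms y =
     density base (\<lambda>z. ennreal (joint_density a1 b1 a2 b2 s0 m0 ms y z /
       (\<integral>w. joint_density a1 b1 a2 b2 s0 m0 ms y w \<partial>base)))"

definition tsum :: "('k::finite \<Rightarrow> nat) \<Rightarrow> real \<Rightarrow> real \<Rightarrow> real" where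
  "tsum ms l\<theta> le = (\<Sum>i\<in>UNIV. real (ms i) * l\<theta> * le / (l\<theta> + real (ms i) * le))"

definition cond_mean_mu ::
  "real \<Rightarrow> real \<Rightarrow> ('k::finite \<Rightarrow> nat) \<Rightarrow> ('k \<Rightarrow> nat \<Rightarrow> real) \<Rightarrow> real \<Rightarrow> real \<Rightarrow> real" where
  "cond_mean_mu s0 m0 ms y l\<theta> le =
     1 / (s0 + tsum ms l\<theta> le) *
     ((\<Sum>i\<in>UNIV. real (ms i) * l\<theta> * le * group_mean ms y i / (l\<theta> + real (ms i) * le)) + m0 * s0)"

definition cond_mean ::
  "real \<Rightarrow> real \<Rightarrow> ('k::finite \<Rightarrow> nat) \<Rightarrow> ('k \<Rightarrow> nat \<Rightarrow> real) \<Rightarrow> real \<Rightarrow> real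
     \<Rightarrow> real ^ 'k option" where
  "cond_mean s0 m0 ms y l\<theta> le = (\<chi> p. case p of
       None \<Rightarrow> cond_mean_mu s0 m0 ms y l\<theta> le
     | Some i \<Rightarrow> (l\<theta> * cond_mean_mu s0 m0 ms y l\<theta> le + real (ms i) * le * group_mean ms y i)
                 / (l\<theta> + real (ms i) * le))"

definition cond_cov ::
  "real \<Rightarrow> ('k::finite \<Rightarrow> nat) \<Rightarrow> real \<Rightarrow> real \<Rightarrow> real ^ 'k option ^ 'k option" where
  "cond_cov s0 ms l\<theta> le = (\<chi> p q. case (p, q) of
       (None, None) \<Rightarrow> 1 / (s0 + tsum ms l\<theta> le)
     | (Some i, None) \<Rightarrow> l\<theta> / ((l\<theta> + real (ms i) * le) * (s0 + tsum ms l\<theta> le))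
     | (None, Some j) \<Rightarrow> l\<theta> / ((l\<theta> + real (ms j) * le) * (s0 + tsum ms l\<theta> le))
     | (Some i, Some j) \<Rightarrow>
         (if i = j
          then 1 / (l\<theta> + real (ms i) * le) *
               (1 + l\<theta>\<^sup>2 / ((l\<theta> + real (ms i) * le) * (s0 + tsum ms l\<theta> le)))
          else l\<theta>\<^sup>2 / ((l\<theta> + real (ms i) * le) * (l\<theta> + real (ms j) * le)
                       * (s0 + tsum ms l\<theta> le))))"

text \<open>First argument after the data: the current state; second: the new state.\<close>

definition gibbs_density ::
  "real \<Rightarrow> real \<Rightarrow> real \<Rightarrow> real \<Rightarrow> real \<Rightarrow> real \<Rightarrow> ('k::finite \<Rightarrow> nat) \<Rightarrow> ('k \<Rightarrow> nat \<Rightarrow> real)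
     \<Rightarrow> 'k state \<Rightarrow> 'k state \<Rightarrow> real" where
  "gibbs_density a1 b1 a2 b2 s0 m0 ms y = (\<lambda>(l', \<xi>') ((l\<theta>, le), \<xi>).
     gamma_density (real CARD('k) / 2 + a1) (v1 (theta_of \<xi>') (mu_of \<xi>') / 2 + b1) l\<theta>
     * gamma_density (real (obs_total ms) / 2 + a2)
         ((v2 ms y (theta_of \<xi>') + SSE ms y) / 2 + b2) le
     * mvn_density (cond_mean s0 m0 ms y l\<theta> le) (cond_cov s0 ms l\<theta> le) \<xi>)"

definition gibbs_kernel ::
  "real \<Rightarrow> real \<Rightarrow> real \<Rightarrow> real \<Rightarrow> real \<Rightarrow> real \<Rightarrow> ('k::finite \<Rightarrow> nat) \<Rightarrow> ('k \<Rightarrow> nat \<Rightarrow> real)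
     \<Rightarrow> 'k state \<Rightarrow> 'k state measure" where
  "gibbs_kernel a1 b1 a2 b2 s0 m0 ms y z =
     density base (\<lambda>z'. ennreal (gibbs_density a1 b1 a2 b2 s0 m0 ms y z z'))"

primrec gibbs_nstep ::
  "real \<Rightarrow> real \<Rightarrow> real \<Rightarrow> real \<Rightarrow> real \<Rightarrow> real \<Rightarrow> ('k::finite \<Rightarrow> nat) \<Rightarrow> ('k \<Rightarrow> nat \<Rightarrow> real)
     \<Rightarrow> nat \<Rightarrow> 'k state \<Rightarrow> 'k state measure" where
  "gibbs_nstep a1 b1 a2 b2 s0 m0 ms y 0 z = return base z"
| "gibbs_nstep a1 b1 a2 b2 s0 m0 ms y (Suc n) z =
     gibbs_nstep a1 b1 a2 b2 s0 m0 ms y n z \<bind> gibbs_kernel a1 b1 a2 b2 s0 m0 ms y"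

end

theory Submission
  imports Defs
begin

text \<open>
  Convergence comes from a drift condition for \<open>V = \<phi> v1 + v2 / m\<close> and a minorization on
  \<open>{V \<le> dR}\<close>.  Instead of coupling two copies of the chain, one bounds
  \<open>|P\<^sup>n f x - P\<^sup>n f y|\<close> for measurable \<open>0 \<le> f \<le> 1\<close> by induction on \<open>n\<close>, simultaneously for
  all numbers \<open>j\<close> of joint visits to the small set: a visit turns \<open>j - 1\<close> into \<open>j\<close> and gains a factor
  \<open>1 - \<epsilon>\<close>, every other step gains a factor \<open>1 / \<alpha>\<close> on \<open>1 + V x + V y\<close>.  Taking \<open>j\<close> to be
  \<open>r n\<close> rounded up and integrating \<open>y\<close> against the posterior gives the bound.

  For the Gibbs sampler, the normal full conditional of \<open>\<xi>\<close> is the law of a two-level regression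
  (\<open>\<mu>\<close>, then independent \<open>\<theta>\<^sub>i\<close> given \<open>\<mu>\<close>), so all its integrals reduce to one-dimensional ones.
\<close>

section \<open>Drift and minorization without coupling\<close>

text \<open>A coupling proof would need a measurable joint kernel on pairs of states and a count of
  its visits. The gap bound \<open>A + C * (1 + V x + V y)\<close> avoids both: it is a function of
  \<open>x\<close> plus a function of \<open>y\<close>, so each part can be integrated against its
  own kernel. The constants come from one step applied to \<open>1 + V x + V y\<close>, whose mean
  is at most \<open>1 + 2 * b + \<gamma> * (V x + V y)\<close>. Where \<open>V x + V y\<close>
  exceeds \<open>d\<close> this is a contraction by \<alpha>, and \<alpha> > 1 is the condition on
  \<open>d\<close>. At a visit \<open>V x\<close> and \<open>V y\<close> are at most
  \<open>d\<close>, so it is at most \<open>U\<close>. With \<open>j - 1\<close> visits in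
  \<open>n\<close> steps the weight is \<open>(\<alpha> * U) ^ (j - 1) / \<alpha> ^ n\<close>; if
  \<open>j - 1\<close> is at most \<open>r * n\<close>, this is at most the second rate of the
  theorem, since \<open>\<alpha> * U\<close> is at least 1. No moment of the invariant law is
  assumed: its \<open>V\<close>-mean is bounded by \<open>b / (1 - \<gamma>)\<close> from the drift
  alone.\<close>

locale drift_minorization =
  fixes B :: "'a measure" and K :: "'a \<Rightarrow> 'a measure" and V :: "'a \<Rightarrow> real"
    and \<nu> :: "'a measure" and \<gamma> b d \<epsilon> :: real
  assumes kernel [measurable]: "K \<in> B \<rightarrow>\<^sub>M prob_algebra B"
    and V_measurable [measurable]: "V \<in> borel_measurable B"
    and V_nonneg: "\<And>x. x \<in> space B \<Longrightarrow> 0 \<le> V x"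
    and drift: "\<And>x. x \<in> space B \<Longrightarrow> (\<integral>\<^sup>+z. ennreal (V z) \<partial>K x) \<le> ennreal (\<gamma> * V x + b)"
    and sets_minor [measurable_cong]: "sets \<nu> = sets B"
    and minor: "\<And>x. x \<in> space B \<Longrightarrow> V x \<le> d \<Longrightarrow> \<nu> \<le> K x"
    and minor_mass: "emeasure \<nu> (space B) = ennreal \<epsilon>"
    and eps: "0 \<le> \<epsilon>" "\<epsilon> \<le> 1"
    and gamma: "0 \<le> \<gamma>" "\<gamma> < 1" and b_nonneg: "0 \<le> b" and d_large: "2 * b / (1 - \<gamma>) < d"
begin

definition trans :: "('a \<Rightarrow> real) \<Rightarrow> 'a \<Rightarrow> real" where
  "trans f x = (\<integral>z. f z \<partial>K x)"

lemma sets_K: "x \<in> space B \<Longrightarrow> sets (K x) = sets B"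
  and prob_K: "x \<in> space B \<Longrightarrow> prob_space (K x)"
  using measurable_space[OF kernel] by (auto simp: space_prob_algebra)

lemma space_K: "x \<in> space B \<Longrightarrow> space (K x) = space B"
  using sets_K sets_eq_imp_space_eq by blast

lemma measurable_K: "x \<in> space B \<Longrightarrow> f \<in> borel_measurable B \<Longrightarrow> f \<in> borel_measurable (K x)"
  using measurable_cong_sets[OF sets_K refl] by blast

lemma kernel_subprob: "K \<in> B \<rightarrow>\<^sub>M subprob_algebra B"
  using kernel by (rule measurable_prob_algebraD)

lemma integrable_bounded:
  assumes "sets M = sets B" "prob_space M" "f \<in> borel_measurable B"
    "\<And>x. x \<in> space B \<Longrightarrow> 0 \<le> f x \<and> f x \<le> (c::real)"
  shows "integrable M f"
proof -
  interpret prob_space M by fact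
  have "space M = space B" using assms(1) sets_eq_imp_space_eq by blast
  then show ?thesis
    using assms by (intro integrable_const_bound[where B=c] AE_I2) (auto cong: measurable_cong_sets)
qed

lemma integrable_V: "x \<in> space B \<Longrightarrow> integrable (K x) V"
  using drift[of x] V_nonneg space_K[of x]
  by (intro integrableI_nonneg measurable_K AE_I2) (auto simp: top.not_eq_extremum intro: le_less_trans)

lemma integral_V: assumes "x \<in> space B" shows "(\<integral>z. V z \<partial>K x) \<le> \<gamma> * V x + b"
proof -
  have "ennreal (\<integral>z. V z \<partial>K x) = (\<integral>\<^sup>+z. ennreal (V z) \<partial>K x)"
    using assms V_nonneg space_K by (intro nn_integral_eq_integral[symmetric] integrable_V AE_I2) auto
  also have "\<dots> \<le> ennreal (\<gamma> * V x + b)" by (rule drift[OF assms])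
  finally show ?thesis
    using V_nonneg[OF assms] gamma b_nonneg by (subst (asm) ennreal_le_iff) auto
qed

lemma trans_measurable [measurable]:
  assumes [measurable]: "f \<in> borel_measurable B" shows "trans f \<in> borel_measurable B"
  unfolding trans_def
  by (rule measurable_compose[OF kernel_subprob integral_measurable_subprob_algebra[OF assms]])

lemma trans_bounds:
  assumes f: "f \<in> borel_measurable B" "\<And>x. x \<in> space B \<Longrightarrow> 0 \<le> f x \<and> f x \<le> c" and x: "x \<in> space B"
  shows "0 \<le> trans f x \<and> trans f x \<le> c"
proof -
  interpret prob_space "K x" using x by (rule prob_K)
  have "integrable (K x) f" using sets_K[OF x] prob_K[OF x] f by (rule integrable_bounded)
  then have "trans f x \<le> c" unfolding trans_def using f space_K[OF x] by (intro integral_le_const AE_I2) auto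
  moreover have "0 \<le> trans f x" unfolding trans_def using f space_K[OF x] by (intro integral_nonneg_AE AE_I2) auto
  ultimately show ?thesis by simp
qed

lemma iterate_measurable:
  "f \<in> borel_measurable B \<Longrightarrow> (trans ^^ n) f \<in> borel_measurable B"
  by (induction n) auto

lemma iterate_bounds:
  assumes f: "f \<in> borel_measurable B" "\<And>x. x \<in> space B \<Longrightarrow> 0 \<le> f x \<and> f x \<le> c" and x: "x \<in> space B"
  shows "0 \<le> (trans ^^ n) f x \<and> (trans ^^ n) f x \<le> c"
  using x
proof (induction n arbitrary: x)
  case (Suc n)
  show ?case
    using trans_bounds[OF iterate_measurable[OF f(1)] Suc.IH Suc.prems] by simp
qed (use f in simp)

text \<open>A gap bound \<open>f u - f v \<le> a u + a v\<close> yields a constant \<open>t\<close> with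
  \<open>f - a \<le> t \<le> f + a\<close>; so \<open>t - f + a\<close> and \<open>f + a - t\<close> are nonnegative and can be integrated
  against different measures, which replaces the coupling of two chains.\<close>

lemma trans_gap:
  assumes f: "f \<in> borel_measurable B" "\<And>x. x \<in> space B \<Longrightarrow> 0 \<le> f x \<and> f x \<le> c"
    and nonneg: "0 \<le> A" "0 \<le> C" "0 \<le> e"
    and gap: "\<And>u v. u \<in> space B \<Longrightarrow> v \<in> space B \<Longrightarrow> f u - f v \<le> A + C * (1 + V u + V v)"
    and x: "x \<in> space B" and y: "y \<in> space B"
    and minorant: "sets N = sets B" "N \<le> K x" "N \<le> K y" "emeasure N (space B) = ennreal e"
  shows "trans f x - trans f y \<le> (1 - e) * A + C * (1 + 2 * b + \<gamma> * (V x + V y))"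
proof -
  interpret x: prob_space "K x" using x by (rule prob_K)
  interpret y: prob_space "K y" using y by (rule prob_K)
  \<comment> \<open>The symmetric split of the gap bound:
    \<open>a u + a v = A + C * (1 + V u + V v)\<close>.\<close>
  define a where "a u = A / 2 + C / 2 + C * V u" for u
  define t where "t = (SUP u\<in>space B. f u - a u)"
  have a0: "0 \<le> a u" if "u \<in> space B" for u using that nonneg V_nonneg by (auto simp: a_def)
  have lower: "f u - a u \<le> t" if "u \<in> space B" for u
    unfolding t_def
  proof (rule cSUP_upper[OF that])
    show "bdd_above ((\<lambda>u. f u - a u) ` space B)"
      using f(2) a0 by (intro bdd_aboveI[where M=c]) (auto, smt (verit))
  qed
  have upper: "t \<le> f v + a v" if "v \<in> space B" for v
    unfolding t_def
  proof (rule cSUP_least)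
    show "f u - a u \<le> f v + a v" if "u \<in> space B" for u
      using gap[OF that \<open>v \<in> space B\<close>] by (simp add: a_def algebra_simps) 
  qed (use x in auto)
  define p where "p u = t - f u + a u" for u
  define q where "q u = f u + a u - t" for u
  have p0: "0 \<le> p u" and q0: "0 \<le> q u" if "u \<in> space B" for u
    using lower[OF that] upper[OF that] by (auto simp: p_def q_def)
  have [measurable]: "f \<in> borel_measurable B" by fact
  have pm: "p \<in> borel_measurable B" and qm: "q \<in> borel_measurable B"
    unfolding p_def q_def a_def by measurable
  have spN: "space N = space B" using minorant(1) sets_eq_imp_space_eq by blast
  have fx: "integrable (K x) f" using sets_K[OF x] prob_K[OF x] f by (rule integrable_bounded)
  have fy: "integrable (K y) f" using sets_K[OF y] prob_K[OF y] f by (rule integrable_bounded)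
  note Vx = integrable_V[OF x] and Vy = integrable_V[OF y]
  have ip: "integrable (K x) p" and iq: "integrable (K y) q"
    unfolding p_def q_def a_def using fx fy Vx Vy by auto
  have ep: "(\<integral>u. p u \<partial>K x) = t - trans f x + A / 2 + C / 2 + C * (\<integral>u. V u \<partial>K x)"
    unfolding p_def a_def trans_def using fx Vx by (simp add: x.prob_space)
  have eq: "(\<integral>u. q u \<partial>K y) = trans f y + A / 2 + C / 2 + C * (\<integral>u. V u \<partial>K y) - t"
    unfolding q_def a_def trans_def using fy Vy by (simp add: y.prob_space)
  have ip0: "0 \<le> (\<integral>u. p u \<partial>K x)" and iq0: "0 \<le> (\<integral>u. q u \<partial>K y)"
    using p0 q0 space_K x y by (auto intro!: integral_nonneg_AE AE_I2)
  \<comment> \<open>\<open>p + q = 2 * a\<close> does not involve \<open>f\<close> and is at least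
    \<open>A\<close>. Since \<open>K x\<close> and \<open>K y\<close> both dominate
    \<open>N\<close>, integrating \<open>p\<close> against the first and \<open>q\<close> against
    the second yields at least \<open>A * e\<close>. This is the gain a coupling would draw from the
    shared mass.\<close>
  have "ennreal (A * e) = (\<integral>\<^sup>+u. ennreal A \<partial>N)"
    using nonneg minorant(4) spN by (simp add: ennreal_mult)
  also have "\<dots> \<le> (\<integral>\<^sup>+u. ennreal (p u) + ennreal (q u) \<partial>N)"
  proof (rule nn_integral_mono)
    fix u assume "u \<in> space N"
    then have u: "u \<in> space B" by (simp add: spN)
    have "A \<le> p u + q u" using V_nonneg[OF u] nonneg by (simp add: p_def q_def a_def field_simps)
    then show "ennreal A \<le> ennreal (p u) + ennreal (q u)"
      using p0[OF u] q0[OF u] by (simp flip: ennreal_plus add: ennreal_leI)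
  qed
  also have "\<dots> = (\<integral>\<^sup>+u. p u \<partial>N) + (\<integral>\<^sup>+u. q u \<partial>N)"
    using pm qm minorant(1) by (intro nn_integral_add) (auto cong: measurable_cong_sets)
  also have "\<dots> \<le> (\<integral>\<^sup>+u. p u \<partial>K x) + (\<integral>\<^sup>+u. q u \<partial>K y)"
    using minorant sets_K x y by (intro add_mono nn_integral_mono_measure) auto
  also have "\<dots> = ennreal ((\<integral>u. p u \<partial>K x) + (\<integral>u. q u \<partial>K y))"
  proof -
    have "(\<integral>\<^sup>+u. p u \<partial>K x) = ennreal (\<integral>u. p u \<partial>K x)"
      using ip p0 space_K[OF x] by (intro nn_integral_eq_integral AE_I2) auto
    moreover have "(\<integral>\<^sup>+u. q u \<partial>K y) = ennreal (\<integral>u. q u \<partial>K y)"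
      using iq q0 space_K[OF y] by (intro nn_integral_eq_integral AE_I2) auto
    ultimately show ?thesis using ip0 iq0 by (simp add: ennreal_plus)
  qed
  finally have "A * e \<le> (\<integral>u. p u \<partial>K x) + (\<integral>u. q u \<partial>K y)"
    using ip0 iq0 by (subst (asm) ennreal_le_iff) auto
  then have "trans f x - trans f y \<le> (1 - e) * A + C * (1 + (\<integral>u. V u \<partial>K x) + (\<integral>u. V u \<partial>K y))"
    unfolding ep eq by (simp add: algebra_simps)
  also have "\<dots> \<le> (1 - e) * A + C * (1 + (\<gamma> * V x + b) + (\<gamma> * V y + b))"
    using nonneg integral_V x y by (intro add_left_mono mult_left_mono add_mono) auto
  finally show ?thesis by (simp add: algebra_simps)
qed

section \<open>Contraction rate, growth factor and induction over the steps\<close>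

definition rate :: real where "rate = (1 + d) / (1 + 2 * b + \<gamma> * d)"
definition growth :: real where "growth = 1 + 2 * (\<gamma> * d + b)"

lemma d_nonneg: "0 \<le> d"
proof -
  have "0 \<le> 2 * b / (1 - \<gamma>)" using b_nonneg gamma by simp
  then show ?thesis using d_large by simp
qed

text \<open>After clearing denominators the claim is \<open>2 * b < (1 - \<gamma>) * d\<close>, the
  assumed lower bound on \<open>d\<close>.\<close>

lemma rate_gt_1: "1 < rate"
proof -
  have "0 < 1 + 2 * b + \<gamma> * d" using b_nonneg gamma d_nonneg
    by (metis add_nonneg_nonneg add_pos_nonneg mult_nonneg_nonneg zero_less_one mult_2)
  moreover have "2 * b < (1 - \<gamma>) * d" using d_large gamma by (simp add: field_simps)
  ultimately show ?thesis unfolding rate_def by (simp add: field_simps)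
qed

lemma growth_ge_1: "1 \<le> growth"
  unfolding growth_def using b_nonneg gamma d_nonneg by simp

lemma rate_growth_ge_1: "1 \<le> rate * growth"
  using mult_mono[of 1 rate 1 growth] rate_gt_1 growth_ge_1 by simp

text \<open>The quotient \<open>(1 + 2 * b + \<gamma> * s) / (1 + s)\<close> decreases in
  \<open>s\<close> because \<open>\<gamma> < 1 + 2 * b\<close>, and it equals
  \<open>1 / rate\<close> at \<open>s = d\<close>.\<close>

lemma outside_contraction:
  assumes "d < s" shows "1 + 2 * b + \<gamma> * s \<le> (1 + s) / rate"
proof -
  have "0 \<le> (s - d) * (1 + 2 * b - \<gamma>)" using assms gamma b_nonneg by simp
  then have "(1 + 2 * b + \<gamma> * s) * (1 + d) \<le> (1 + s) * (1 + 2 * b + \<gamma> * d)"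
    by (simp add: algebra_simps)
  then show ?thesis unfolding rate_def using d_nonneg by (simp add: field_simps)
qed

text \<open>Weight of \<open>1 + V x + V y\<close> after \<open>n\<close> steps with
  \<open>j - 1\<close> visits: \<open>growth\<close> for each visit, \<open>1 / rate\<close> for
  each other step. For \<open>j = 0\<close> it can be zero, since the other summand
  \<open>(1 - \<epsilon>) ^ 0 = 1\<close> already covers any gap.\<close>

definition coeff :: "nat \<Rightarrow> nat \<Rightarrow> real" where
  "coeff n j = (if j = 0 then 0 else (rate * growth) ^ (j - 1) / rate ^ n)"

text \<open>\<open>j\<close> counts visits of both chains to the small set.\<close>

lemma iterate_gap:
  assumes f: "f \<in> borel_measurable B" "\<And>x. x \<in> space B \<Longrightarrow> 0 \<le> f x \<and> f x \<le> 1"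
  shows "x \<in> space B \<Longrightarrow> y \<in> space B \<Longrightarrow>
    (trans ^^ n) f x - (trans ^^ n) f y \<le> (1 - \<epsilon>) ^ j + coeff n j * (1 + V x + V y)"
proof (induction n arbitrary: j x y)
  case 0
  have h: "1 \<le> 1 + V x + V y" using 0 V_nonneg by (simp add: add_nonneg_nonneg)
  have "f x - f y \<le> 1" using f(2)[OF 0(1)] f(2)[OF 0(2)] by linarith
  \<comment> \<open>For \<open>j = 0\<close> the power is 1; otherwise the coefficient is
    \<open>(rate * growth) ^ (j - 1)\<close>, at least 1. Either way one summand suffices.\<close>
  also have "1 \<le> (1 - \<epsilon>) ^ j + coeff 0 j * (1 + V x + V y)"
  proof (cases j)
    case (Suc i)
    have "1 \<le> (rate * growth) ^ i"
      using rate_growth_ge_1 by (rule one_le_power)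
    then have "1 \<le> (rate * growth) ^ i * (1 + V x + V y)" using h
      by (metis mult_mono' mult_1 zero_le_one)
    then show ?thesis using eps by (simp add: coeff_def Suc add_increasing)
  qed (simp add: coeff_def)
  finally show ?case by simp
next
  case (Suc n)
  let ?f = "(trans ^^ n) f"
  have f': "?f \<in> borel_measurable B" "\<And>x. x \<in> space B \<Longrightarrow> 0 \<le> ?f x \<and> ?f x \<le> 1"
    using iterate_measurable iterate_bounds f by blast+
  have h: "1 \<le> 1 + V x + V y" using Suc.prems V_nonneg by (simp add: add_nonneg_nonneg)
  have coeff0: "0 \<le> coeff n j" for n j
    unfolding coeff_def using rate_gt_1 growth_ge_1 by auto
  show ?case
  proof (cases "j = 0 \<or> d < V x + V y")
    case True
    \<comment> \<open>No visit is counted in this case: the zero measure, with \<open>e = 0\<close>,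
      serves as common minorant. \<open>j = 0\<close> belongs here because it has no
      predecessor.\<close>
    have null: "null_measure B \<le> K z" if "z \<in> space B" for z
      using sets_K[OF that] by (simp add: le_measure)
    have "trans ?f x - trans ?f y \<le> (1 - 0) * (1 - \<epsilon>) ^ j + coeff n j * (1 + 2 * b + \<gamma> * (V x + V y))"
      using Suc.prems f' coeff0 eps Suc.IH
      by (intro trans_gap[where N="null_measure B"] null) auto
    moreover have "coeff n j * (1 + 2 * b + \<gamma> * (V x + V y)) \<le> coeff (Suc n) j * (1 + V x + V y)"
    proof (cases "j = 0")
      case False
      then have "coeff n j * (1 + 2 * b + \<gamma> * (V x + V y)) \<le> coeff n j * ((1 + (V x + V y)) / rate)"
        using True by (intro mult_left_mono outside_contraction coeff0) auto
      also have "\<dots> = coeff (Suc n) j * (1 + V x + V y)" by (simp add: coeff_def add.assoc)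
      finally show ?thesis .
    qed (simp add: coeff_def)
    ultimately show ?thesis by simp
  next
    case False
    then obtain i where i: "j = Suc i" by (cases j) auto
    have Vd: "V x \<le> d" "V y \<le> d" using False V_nonneg[OF Suc.prems(1)] V_nonneg[OF Suc.prems(2)] by auto
    \<comment> \<open>A visit: the induction hypothesis is taken at \<open>i = j - 1\<close>, and
      the minorization supplies the missing factor \<open>1 - \<epsilon>\<close>.\<close>
    have "trans ?f x - trans ?f y \<le> (1 - \<epsilon>) * (1 - \<epsilon>) ^ i + coeff n i * (1 + 2 * b + \<gamma> * (V x + V y))"
      using Suc.prems f' coeff0 eps Suc.IH Vd sets_minor minor_mass
      by (intro trans_gap[where N=\<nu>] minor) auto
    also have "coeff n i * (1 + 2 * b + \<gamma> * (V x + V y)) \<le> coeff n i * growth"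
    proof -
      have "\<gamma> * (V x + V y) \<le> \<gamma> * (2 * d)" using Vd gamma by (intro mult_left_mono) auto
      then show ?thesis using coeff0 by (intro mult_left_mono) (auto simp: growth_def)
    qed
    \<comment> \<open>An equality for \<open>i > 0\<close>; for \<open>i = 0\<close> the left side
      is zero.\<close>
    also have "coeff n i * growth \<le> coeff (Suc n) j * 1"
      using rate_gt_1 growth_ge_1 by (cases i) (auto simp: coeff_def i mult_ac)
    also have "\<dots> \<le> coeff (Suc n) j * (1 + V x + V y)"
      using h coeff0 by (intro mult_left_mono) auto
    finally show ?thesis by (simp add: i)
  qed
qed

text \<open>With \<open>j\<close> equal to \<open>r * n\<close> rounded up,
  \<open>r * n \<le> j\<close> controls the power of \<open>1 - \<epsilon>\<close>, and
  \<open>j - 1 \<le> r * n\<close> controls the power of \<open>rate * growth\<close>, which is at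
  least 1. The exponent \<open>j - 1\<close> in \<open>coeff\<close> is what makes the rounding cost
  nothing.\<close>

lemma iterate_gap_powr:
  assumes f: "f \<in> borel_measurable B" "\<And>x. x \<in> space B \<Longrightarrow> 0 \<le> f x \<and> f x \<le> 1"
    and x: "x \<in> space B" and y: "y \<in> space B" and r: "0 < r" and n: "1 \<le> n"
  shows "(trans ^^ n) f x - (trans ^^ n) f y
    \<le> (1 - \<epsilon>) powr (r * real n) + (growth powr r / rate powr (1 - r)) ^ n * (1 + V x + V y)"
proof -
  define j where "j = nat \<lceil>r * real n\<rceil>"
  have rn: "0 < r * real n" using r n by simp
  have j1: "1 \<le> j" using rn unfolding j_def by linarith
  have j2: "r * real n \<le> real j" "real j - 1 \<le> r * real n" using rn unfolding j_def by linarith+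
  have h: "0 \<le> 1 + V x + V y" using x y V_nonneg by (simp add: add_nonneg_nonneg)
  have "(1 - \<epsilon>) ^ j \<le> (1 - \<epsilon>) powr (r * real n)"
  \<comment> \<open>At \<open>\<epsilon> = 1\<close> both sides are 0: the left because
    \<open>j\<close> is at least 1, the right because \<open>0 powr _\<close> is 0.\<close>
  proof (cases "\<epsilon> = 1")
    case False
    then have "(1 - \<epsilon>) ^ j = (1 - \<epsilon>) powr real j" using eps by (simp add: powr_realpow)
    also have "\<dots> \<le> (1 - \<epsilon>) powr (r * real n)" using j2 eps by (intro powr_mono') auto
    finally show ?thesis .
  qed (use j1 in \<open>simp add: power_0_left\<close>)
  moreover have "coeff n j \<le> (growth powr r / rate powr (1 - r)) ^ n"
  proof -
    note rg = rate_growth_ge_1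
    have "coeff n j = (rate * growth) powr (real j - 1) / rate powr real n"
      using j1 rg rate_gt_1 by (simp add: coeff_def of_nat_diff flip: powr_realpow)
    also have "\<dots> \<le> (rate * growth) powr (r * real n) / rate powr real n"
      using rg j2 rate_gt_1 by (intro divide_right_mono powr_mono) auto
    also have "\<dots> = ((rate * growth) powr r / rate) powr real n"
      using rate_gt_1 growth_ge_1 by (simp add: powr_divide powr_powr)
    also have "(rate * growth) powr r / rate = growth powr r / rate powr (1 - r)"
      using rate_gt_1 growth_ge_1 by (simp add: powr_mult powr_diff)
    also have "(growth powr r / rate powr (1 - r)) powr real n = (growth powr r / rate powr (1 - r)) ^ n"
      using rate_gt_1 growth_ge_1 by (intro powr_realpow) auto
    finally show ?thesis .
  qed
  ultimately show ?thesis
    using iterate_gap[OF f x y, of n j] mult_right_mono[OF _ h] by (smt (verit))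
qed

text \<open>Boundedness of \<open>f\<close> makes every iterate integrable, so the drift can be
  iterated inside the integral. The last term is the geometric sum of the drift constants.\<close>

lemma iterate_drift:
  assumes f: "f \<in> borel_measurable B" "\<And>x. x \<in> space B \<Longrightarrow> 0 \<le> f x \<and> f x \<le> c"
    and fV: "\<And>x. x \<in> space B \<Longrightarrow> f x \<le> V x"
  shows "x \<in> space B \<Longrightarrow> (trans ^^ n) f x \<le> \<gamma> ^ n * V x + b * (1 - \<gamma> ^ n) / (1 - \<gamma>)"
proof (induction n arbitrary: x)
  case (Suc n)
  interpret prob_space "K x" using Suc.prems by (rule prob_K)
  let ?f = "(trans ^^ n) f"
  have "integrable (K x) ?f"
    using sets_K[OF Suc.prems] prob_K[OF Suc.prems] iterate_measurable[OF f(1)] iterate_bounds[OF f]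
    by (rule integrable_bounded)
  then have "trans ?f x \<le> (\<integral>z. \<gamma> ^ n * V z + b * (1 - \<gamma> ^ n) / (1 - \<gamma>) \<partial>K x)"
    unfolding trans_def[of ?f] using Suc integrable_V space_K by (intro integral_mono) auto
  also have "\<dots> = \<gamma> ^ n * (\<integral>z. V z \<partial>K x) + b * (1 - \<gamma> ^ n) / (1 - \<gamma>)"
    using integrable_V[OF Suc.prems] by (simp add: prob_space)
  also have "\<dots> \<le> \<gamma> ^ n * (\<gamma> * V x + b) + b * (1 - \<gamma> ^ n) / (1 - \<gamma>)"
    using integral_V[OF Suc.prems] gamma by (intro add_right_mono mult_left_mono) auto
  also have "\<dots> = \<gamma> ^ Suc n * V x + b * (1 - \<gamma> ^ Suc n) / (1 - \<gamma>)"
    using gamma by (simp add: divide_simps) (simp add: algebra_simps)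
  finally show ?case by simp
qed (use fV gamma in simp)


lemma integral_bind_kernel:
  assumes M: "sets M = sets B" "prob_space M"
    and f: "f \<in> borel_measurable B" "\<And>x. x \<in> space B \<Longrightarrow> 0 \<le> f x \<and> f x \<le> c"
  shows "(\<integral>z. f z \<partial>(M \<bind> K)) = (\<integral>z. trans f z \<partial>M)"
proof -
  interpret prob_space M by fact
  have sp: "space M = space B" using M(1) sets_eq_imp_space_eq by blast
  have K: "K \<in> M \<rightarrow>\<^sub>M subprob_algebra B"
    using kernel_subprob measurable_cong_sets[OF M(1) refl] by blast
  show ?thesis unfolding trans_def
  proof (rule integral_bind[where B'=1 and B=c, OF f(1) _ K])
    show "\<bar>f x\<bar> \<le> c" if "x \<in> space B" for x
      using f(2)[OF that] by simp
    show "AE x in M. emeasure (K x) (space (K x)) \<le> ennreal 1"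
      using prob_K sp by (intro AE_I2) (auto simp: prob_space.emeasure_space_1)
  qed unfold_locales
qed

end

section \<open>Stationary law and total variation distance\<close>

locale stationary_drift_minorization = drift_minorization +
  fixes \<pi> :: "'a measure"
  assumes stat_prob: "prob_space \<pi>" and sets_stat [measurable_cong]: "sets \<pi> = sets B"
    and stationary: "\<pi> \<bind> K = \<pi>"
begin

lemma space_stat: "space \<pi> = space B"
  using sets_stat sets_eq_imp_space_eq by blast

lemma integral_iterate_stat:
  assumes f: "f \<in> borel_measurable B" "\<And>x. x \<in> space B \<Longrightarrow> 0 \<le> f x \<and> f x \<le> c"
  shows "(\<integral>z. (trans ^^ n) f z \<partial>\<pi>) = (\<integral>z. f z \<partial>\<pi>)"
proof (induction n)
  case (Suc n)
  have "(\<integral>z. (trans ^^ Suc n) f z \<partial>\<pi>) = (\<integral>z. (trans ^^ n) f z \<partial>(\<pi> \<bind> K))"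
    using integral_bind_kernel[OF sets_stat stat_prob iterate_measurable[OF f(1)] iterate_bounds[OF f]]
    by simp
  then show ?case using Suc by (simp add: stationary)
qed simp

text \<open>Integrating the drift inequality against \<pi> directly would presuppose a finite mean
  of \<open>V\<close>. Truncations at \<open>N\<close> are bounded, so stationarity equates their
  mean with that of each of their iterates; \<open>n\<close> tends to infinity first,
  \<open>N\<close> afterwards.\<close>

lemma nn_integral_V_stat: "(\<integral>\<^sup>+z. ennreal (V z) \<partial>\<pi>) \<le> ennreal (b / (1 - \<gamma>))"
proof -
  interpret prob_space \<pi> by (rule stat_prob)
  have V': "V \<in> borel_measurable \<pi>" by measurable
  have trunc: "(\<integral>z. min (V z) (real N) \<partial>\<pi>) \<le> b / (1 - \<gamma>)" for N
  proof -
    define f where "f z = min (V z) (real N)" for z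
    have f: "f \<in> borel_measurable B" "\<And>x. x \<in> space B \<Longrightarrow> 0 \<le> f x \<and> f x \<le> real N"
      unfolding f_def using V_nonneg by auto
    have fV: "f x \<le> V x" for x by (simp add: f_def)
    \<comment> \<open>The cap \<open>N\<close> is the dominating constant for the limit in
      \<open>n\<close>; the mean of \<open>\<gamma> ^ n * V z\<close> is not yet known to be
      finite.\<close>
    define g where "g n z = min (real N) (\<gamma> ^ n * V z + b * (1 - \<gamma> ^ n) / (1 - \<gamma>))" for n z
    have g0: "0 \<le> g n z" "g n z \<le> real N" if "z \<in> space B" for n z
      using V_nonneg[OF that] b_nonneg gamma power_le_one[of \<gamma> n] by (auto simp: g_def)
    have gm: "g n \<in> borel_measurable \<pi>" for n unfolding g_def using V' by measurable
    have "(\<integral>z. f z \<partial>\<pi>) \<le> (\<integral>z. g n z \<partial>\<pi>)" for n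
    proof -
      have "(\<integral>z. f z \<partial>\<pi>) = (\<integral>z. (trans ^^ n) f z \<partial>\<pi>)" using integral_iterate_stat[OF f] by simp
      also have "\<dots> \<le> (\<integral>z. g n z \<partial>\<pi>)"
      proof (rule integral_mono)
        show "integrable \<pi> ((trans ^^ n) f)"
          using sets_stat stat_prob iterate_measurable[OF f(1)] iterate_bounds[OF f]
          by (rule integrable_bounded)
        show "integrable \<pi> (g n)"
          using g0 gm space_stat by (intro integrable_const_bound[where B="real N"] AE_I2) auto
        show "(trans ^^ n) f z \<le> g n z" if "z \<in> space \<pi>" for z
          using that iterate_bounds[OF f, of z n] iterate_drift[OF f fV, of z n]
          by (auto simp: g_def space_stat)
      qed
      finally show ?thesis .
    qed
    moreover have "(\<lambda>n. \<integral>z. g n z \<partial>\<pi>) \<longlonglongrightarrow> (\<integral>z. min (real N) (0 * V z + b * (1 - 0) / (1 - \<gamma>)) \<partial>\<pi>)"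
    proof (rule integral_dominated_convergence[where w="\<lambda>_. real N"])
      show "AE z in \<pi>. (\<lambda>n. g n z) \<longlonglongrightarrow> min (real N) (0 * V z + b * (1 - 0) / (1 - \<gamma>))"
        unfolding g_def using gamma by (intro AE_I2 tendsto_intros) auto
      show "AE z in \<pi>. norm (g n z) \<le> real N" for n
        using g0 space_stat by (intro AE_I2) auto
    qed (use gm in auto)
    ultimately have "(\<integral>z. f z \<partial>\<pi>) \<le> (\<integral>z. min (real N) (0 * V z + b * (1 - 0) / (1 - \<gamma>)) \<partial>\<pi>)"
      by (intro LIMSEQ_le_const) auto
    also have "\<dots> \<le> b / (1 - \<gamma>)" by (simp add: prob_space)
    finally show ?thesis unfolding f_def .
  qed
  have sup: "ennreal (V z) = (SUP N. ennreal (min (V z) (real N)))" if "z \<in> space \<pi>" for z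
  proof (rule antisym)
    obtain N where "V z \<le> real N" using real_arch_simple by blast
    then show "ennreal (V z) \<le> (SUP N. ennreal (min (V z) (real N)))"
      by (intro SUP_upper2[of N]) auto
  qed (auto intro!: SUP_least ennreal_leI)
  have "(\<integral>\<^sup>+z. ennreal (V z) \<partial>\<pi>) = (\<integral>\<^sup>+z. (SUP N. ennreal (min (V z) (real N))) \<partial>\<pi>)"
    using sup by (intro nn_integral_cong) auto
  also have "\<dots> = (SUP N. \<integral>\<^sup>+z. ennreal (min (V z) (real N)) \<partial>\<pi>)"
    using V' by (intro nn_integral_monotone_convergence_SUP) (auto simp: incseq_def le_fun_def intro!: ennreal_leI)
  also have "\<dots> \<le> ennreal (b / (1 - \<gamma>))"
  proof (rule SUP_least)
    fix N
    have "(\<integral>\<^sup>+z. ennreal (min (V z) (real N)) \<partial>\<pi>) = ennreal (\<integral>z. min (V z) (real N) \<partial>\<pi>)"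
      using V' V_nonneg space_stat
      by (intro nn_integral_eq_integral integrable_const_bound[where B="real N"] AE_I2) auto
    also have "\<dots> \<le> ennreal (b / (1 - \<gamma>))" by (rule ennreal_leI[OF trunc])
    finally show "(\<integral>\<^sup>+z. ennreal (min (V z) (real N)) \<partial>\<pi>) \<le> ennreal (b / (1 - \<gamma>))" .
  qed
  finally show ?thesis .
qed

text \<open>The gap bound is averaged over a second starting point drawn from \<pi>: stationarity
  turns the mean of the iterate into that of \<open>f\<close>, and the mean of \<open>V\<close> is
  at most \<open>b / (1 - \<gamma>)\<close>. Swapping the two starting points gives the absolute
  value.\<close>

lemma convergence_rate:
  assumes f: "f \<in> borel_measurable B" "\<And>x. x \<in> space B \<Longrightarrow> 0 \<le> f x \<and> f x \<le> 1"
    and x: "x \<in> space B" and r: "0 < r" and n: "1 \<le> n"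
  shows "\<bar>(trans ^^ n) f x - (\<integral>z. f z \<partial>\<pi>)\<bar>
    \<le> (1 - \<epsilon>) powr (r * real n) + (growth powr r / rate powr (1 - r)) ^ n * (1 + b / (1 - \<gamma>) + V x)"
proof -
  interpret prob_space \<pi> by (rule stat_prob)
  define p where "p = (1 - \<epsilon>) powr (r * real n)"
  define q where "q = (growth powr r / rate powr (1 - r)) ^ n"
  have q0: "0 \<le> q" unfolding q_def by simp
  let ?f = "(trans ^^ n) f"
  have V: "integrable \<pi> V"
    using nn_integral_V_stat V_nonneg space_stat
    by (intro integrableI_nonneg AE_I2) (auto simp: top.not_eq_extremum intro: le_less_trans)
  have "ennreal (\<integral>z. V z \<partial>\<pi>) \<le> ennreal (b / (1 - \<gamma>))"
    using nn_integral_V_stat V V_nonneg space_stat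
    by (subst nn_integral_eq_integral[symmetric]) (auto intro: AE_I2)
  then have EV: "(\<integral>z. V z \<partial>\<pi>) \<le> b / (1 - \<gamma>)" using b_nonneg gamma by (subst (asm) ennreal_le_iff) auto
  have fi: "integrable \<pi> ?f"
    using sets_stat stat_prob iterate_measurable[OF f(1)] iterate_bounds[OF f] by (rule integrable_bounded)
  have bound: "q * (1 + V x + (\<integral>z. V z \<partial>\<pi>)) \<le> q * (1 + b / (1 - \<gamma>) + V x)"
    using q0 EV by (intro mult_left_mono) auto
  have "?f x = (\<integral>z. ?f x \<partial>\<pi>)" by (simp add: prob_space)
  also have "\<dots> \<le> (\<integral>z. ?f z + (p + q * (1 + V x + V z)) \<partial>\<pi>)"
    using fi V iterate_gap_powr[OF f x _ r n] space_stat
    by (intro integral_mono) (auto simp: p_def q_def algebra_simps)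
  also have "\<dots> = (\<integral>z. f z \<partial>\<pi>) + p + q * (1 + V x + (\<integral>z. V z \<partial>\<pi>))"
    using fi V integral_iterate_stat[OF f] by (simp add: prob_space)
  finally have 1: "?f x - (\<integral>z. f z \<partial>\<pi>) \<le> p + q * (1 + b / (1 - \<gamma>) + V x)" using bound by simp
  have "(\<integral>z. f z \<partial>\<pi>) = (\<integral>z. ?f z \<partial>\<pi>)" using integral_iterate_stat[OF f] by simp
  also have "\<dots> \<le> (\<integral>z. ?f x + (p + q * (1 + V x + V z)) \<partial>\<pi>)"
    using fi V iterate_gap_powr[OF f _ x r n] space_stat
    by (intro integral_mono) (auto simp: p_def q_def algebra_simps)
  also have "\<dots> = ?f x + p + q * (1 + V x + (\<integral>z. V z \<partial>\<pi>))"
    using V by (simp add: prob_space)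
  finally have 2: "(\<integral>z. f z \<partial>\<pi>) - ?f x \<le> p + q * (1 + b / (1 - \<gamma>) + V x)" using bound by simp
  show ?thesis using 1 2 unfolding p_def q_def by (simp add: abs_le_iff)
qed

lemma tv_convergence:
  assumes N: "\<And>z. N 0 z = return B z" "\<And>n z. N (Suc n) z = N n z \<bind> K"
    and x: "x \<in> space B" and r: "0 < r" and n: "1 \<le> n"
  shows "tv_dist (N n x) \<pi>
    \<le> (1 - \<epsilon>) powr (r * real n) + (growth powr r / rate powr (1 - r)) ^ n * (1 + b / (1 - \<gamma>) + V x)"
proof -
  have Nsp: "N n x \<in> space (prob_algebra B)" for n
  proof (induction n)
    case 0
    then show ?case using x by (simp add: N space_prob_algebra prob_space_return)
  next
    case (Suc n)
    \<comment> \<open>For a constant map from a discrete space, measurability into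
      \<open>prob_algebra B\<close> just says that this one measure is a probability measure on
      \<open>B\<close>.\<close>
    have "(\<lambda>_. N n x \<bind> K) \<in> count_space UNIV \<rightarrow>\<^sub>M prob_algebra B"
      by (rule measurable_bind_prob_space[where N=B, OF _ kernel]) (use Suc in auto)
    then show ?case by (auto simp: N dest: measurable_space)
  qed
  have Ns: "sets (N n x) = sets B" "prob_space (N n x)" for n
    using Nsp by (auto simp: space_prob_algebra)
  have iter: "(\<integral>z. f z \<partial>N n x) = (trans ^^ n) f x"
    if "f \<in> borel_measurable B" "\<And>x. x \<in> space B \<Longrightarrow> 0 \<le> f x \<and> f x \<le> (1::real)" for f n
    using that
  proof (induction n arbitrary: f)
    case 0
    then show ?case using x by (simp add: N integral_return)
  next
    case (Suc n)
    \<comment> \<open>The last transition is peeled off, so the hypothesis is applied to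
      \<open>trans f\<close>; this is why \<open>f\<close> is generalized.\<close>
    have "(\<integral>z. f z \<partial>N (Suc n) x) = (\<integral>z. trans f z \<partial>N n x)"
      unfolding N using Ns Suc.prems by (intro integral_bind_kernel)
    also have "\<dots> = (trans ^^ n) (trans f) x"
      using Suc.prems trans_bounds by (intro Suc.IH) auto
    finally show ?case by (simp add: funpow_swap1)
  qed
  show ?thesis unfolding tv_dist_def
  proof (rule cSUP_least)
    fix A assume "A \<in> sets (N n x)"
    then have A: "A \<in> sets B" using Ns by simp
    have f: "(indicator A :: 'a \<Rightarrow> real) \<in> borel_measurable B" using A by simp
    have "measure (N n x) A = (\<integral>z. indicator A z \<partial>N n x)" using A Ns by simp
    also have "\<dots> = (trans ^^ n) (indicator A) x" by (rule iter[OF f]) (auto simp: indicator_def)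
    finally have "measure (N n x) A = (trans ^^ n) (indicator A) x" .
    moreover have "measure \<pi> A = (\<integral>z. indicator A z \<partial>\<pi>)" using A sets_stat by simp
    ultimately show "\<bar>measure (N n x) A - measure \<pi> A\<bar>
      \<le> (1 - \<epsilon>) powr (r * real n) + (growth powr r / rate powr (1 - r)) ^ n * (1 + b / (1 - \<gamma>) + V x)"
      using convergence_rate[OF f _ x r n] by (auto simp: indicator_def)
  qed (use Ns in auto)
qed

end

section \<open>Gamma densities\<close>

lemma gamma_density_nonneg: "0 < \<alpha> \<Longrightarrow> 0 \<le> gamma_density \<alpha> \<beta> x"
  by (simp add: gamma_density_def Gamma_real_pos less_imp_le)

lemma gamma_density_measurable [measurable]:
  assumes [measurable]: "f \<in> borel_measurable M" "g \<in> borel_measurable M"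
  shows "(\<lambda>x. gamma_density \<alpha> (f x) (g x)) \<in> borel_measurable M"
  unfolding gamma_density_def by measurable

text \<open>Rescaling by the rate reduces this to Euler's integral for the Gamma function.\<close>

lemma nn_integral_gamma_density:
  assumes "0 < \<alpha>" "0 < \<beta>"
  shows "(\<integral>\<^sup>+x. ennreal (gamma_density \<alpha> \<beta> x) \<partial>lborel) = 1"
proof -
  have G: "0 < Gamma \<alpha>" using assms by (simp add: Gamma_real_pos)
  have "(\<integral>\<^sup>+x. ennreal (gamma_density \<alpha> \<beta> x) \<partial>lborel)
      = ennreal \<bar>1 / \<beta>\<bar> * (\<integral>\<^sup>+x. ennreal (gamma_density \<alpha> \<beta> (0 + 1 / \<beta> * x)) \<partial>lborel)"
    using assms by (intro nn_integral_real_affine) auto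
  also have "(\<integral>\<^sup>+x. ennreal (gamma_density \<alpha> \<beta> (0 + 1 / \<beta> * x)) \<partial>lborel)
      = (\<integral>\<^sup>+x. ennreal (\<beta> / Gamma \<alpha>) * ennreal (indicator {0..} x * x powr (\<alpha> - 1) / exp x) \<partial>lborel)"
  proof (rule nn_integral_cong_AE, rule AE_mp[OF AE_lborel_singleton[of 0]], rule AE_I2, rule impI)
    fix x :: real assume "x \<noteq> 0"
    then show "ennreal (gamma_density \<alpha> \<beta> (0 + 1 / \<beta> * x))
        = ennreal (\<beta> / Gamma \<alpha>) * ennreal (indicator {0..} x * x powr (\<alpha> - 1) / exp x)"
      using assms G
      by (auto simp: gamma_density_def powr_divide powr_diff exp_minus field_simps zero_less_divide_iff
          indicator_def simp flip: ennreal_mult)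
  qed
  also have "\<dots> = ennreal (\<beta> / Gamma \<alpha>) * ennreal (Gamma \<alpha>)"
    using assms by (subst nn_integral_cmult) (auto simp: Gamma_conv_nn_integral_real)
  finally show ?thesis using assms G by (simp flip: ennreal_mult)
qed

text \<open>Dividing by \<open>x\<close> lowers the shape by one, and the functional equation of
  Gamma gives the factor. These inverse moments are the source of \<open>\<delta>1\<close> and
  \<open>\<delta>2\<close>.\<close>

lemma nn_integral_gamma_density_inverse:
  assumes "1 < \<alpha>" "0 < \<beta>"
  shows "(\<integral>\<^sup>+x. ennreal (gamma_density \<alpha> \<beta> x * (1 / x)) \<partial>lborel) = ennreal (\<beta> / (\<alpha> - 1))"
proof -
  have "\<alpha> - 1 \<notin> \<int>\<^sub>\<le>\<^sub>0" using assms nonpos_Ints_nonpos[of "\<alpha> - 1"] by auto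
  then have G: "Gamma \<alpha> = (\<alpha> - 1) * Gamma (\<alpha> - 1)" "0 < Gamma (\<alpha> - 1)"
    using Gamma_plus1[of "\<alpha> - 1"] assms by (auto simp: Gamma_real_pos)
  have "gamma_density \<alpha> \<beta> x * (1 / x) = \<beta> / (\<alpha> - 1) * gamma_density (\<alpha> - 1) \<beta> x" for x
  proof -
    obtain k where k: "\<alpha> = k + 1" "0 < k" using assms by (metis add.commute diff_add_cancel diff_gt_0_iff_gt)
    then show ?thesis
      using assms G(2) unfolding gamma_density_def G(1) by (auto simp: powr_diff powr_add divide_simps)
  qed
  then have "(\<integral>\<^sup>+x. ennreal (gamma_density \<alpha> \<beta> x * (1 / x)) \<partial>lborel)
     = (\<integral>\<^sup>+x. ennreal (\<beta> / (\<alpha> - 1)) * ennreal (gamma_density (\<alpha> - 1) \<beta> x) \<partial>lborel)"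
    using assms by (simp only: ennreal_mult gamma_density_nonneg divide_nonneg_pos diff_gt_0_iff_gt less_imp_le)
  also have "\<dots> = ennreal (\<beta> / (\<alpha> - 1))"
    using assms by (subst nn_integral_cmult) (auto simp: nn_integral_gamma_density)
  finally show ?thesis .
qed

text \<open>A factor \<open>x powr c\<close> raises the shape by \<open>c\<close>. With
  \<open>c\<close> half the number of observations this integrates the precision factor of the
  likelihood, as normalizing the posterior requires.\<close>

lemma nn_integral_gamma_density_powr:
  assumes "0 < \<alpha>" "0 < \<beta>" "0 \<le> c"
  shows "(\<integral>\<^sup>+x. ennreal (x powr c * gamma_density \<alpha> \<beta> x) \<partial>lborel)
    = ennreal (Gamma (\<alpha> + c) / (Gamma \<alpha> * \<beta> powr c))"
proof -
  have G: "0 < Gamma \<alpha>" "0 < Gamma (\<alpha> + c)" using assms by (auto simp: Gamma_real_pos add_pos_nonneg)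
  have k0: "0 \<le> Gamma (\<alpha> + c) / (Gamma \<alpha> * \<beta> powr c)" using G by (intro divide_nonneg_nonneg mult_nonneg_nonneg) auto
  have nz: "Gamma (\<alpha> + c) \<noteq> 0" using G by simp
  have "x powr c * gamma_density \<alpha> \<beta> x
      = Gamma (\<alpha> + c) / (Gamma \<alpha> * \<beta> powr c) * gamma_density (\<alpha> + c) \<beta> x" for x
    using assms G unfolding gamma_density_def
    by (auto simp: powr_diff powr_add divide_simps nz)
  then have "(\<integral>\<^sup>+x. ennreal (x powr c * gamma_density \<alpha> \<beta> x) \<partial>lborel)
     = (\<integral>\<^sup>+x. ennreal (Gamma (\<alpha> + c) / (Gamma \<alpha> * \<beta> powr c)) * ennreal (gamma_density (\<alpha> + c) \<beta> x) \<partial>lborel)"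
    using assms G by (simp only: ennreal_mult[OF k0 gamma_density_nonneg[OF add_pos_nonneg]])
  also have "\<dots> = ennreal (Gamma (\<alpha> + c) / (Gamma \<alpha> * \<beta> powr c))"
    using assms by (subst nn_integral_cmult) (auto simp: nn_integral_gamma_density)
  finally show ?thesis .
qed

text \<open>The logarithm of the density is concave in the rate parameter, so its minimum over an
  interval of rates is attained at an endpoint.\<close>

lemma gamma_density_endpoint_le:
  assumes "0 < \<alpha>" "0 < \<beta>" "0 \<le> v" "v \<le> D" "0 < D"
  shows "(if x < \<alpha> / D * ln (1 + D / \<beta>) then gamma_density \<alpha> \<beta> x else gamma_density \<alpha> (\<beta> + D) x)
    \<le> gamma_density \<alpha> (\<beta> + v) x"
proof (cases "0 < x")
  case True
  \<comment> \<open>The point where the densities with rates \<beta> and \<open>\<beta> + D\<close>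
    cross: there \<open>\<alpha> * ln \<beta> - \<beta> * x\<close> equals
    \<open>\<alpha> * ln (\<beta> + D) - (\<beta> + D) * x\<close>.\<close>
  define s where "s = \<alpha> / D * ln (1 + D / \<beta>)"
  define t where "t = v / D"
  have t: "0 \<le> t" "t \<le> 1" "v = t * D" using assms by (auto simp: t_def)
  have rep: "gamma_density \<alpha> c x = exp (\<alpha> * ln c - c * x) * (x powr (\<alpha> - 1) / Gamma \<alpha>)"
    if "0 < c" for c
    using True that by (simp add: gamma_density_def powr_def exp_diff exp_minus field_simps)
  have G: "0 \<le> x powr (\<alpha> - 1) / Gamma \<alpha>" using assms by (simp add: Gamma_real_pos less_imp_le)
  have "ln ((1 - t) * \<beta> + t * (\<beta> + D)) \<ge> (1 - t) * ln \<beta> + t * ln (\<beta> + D)"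
    using concave_onD[OF ln_concave t(1,2), of \<beta> "\<beta> + D"] assms by simp
  then have conc: "ln (\<beta> + v) \<ge> (1 - t) * ln \<beta> + t * ln (\<beta> + D)"
    by (simp add: t algebra_simps)
  have s: "s * D = \<alpha> * (ln (\<beta> + D) - ln \<beta>)"
  proof -
    have "1 + D / \<beta> = (\<beta> + D) / \<beta>" using assms by (simp add: field_simps)
    then show ?thesis using assms by (simp add: s_def ln_div)
  qed
  have "\<alpha> * ln (\<beta> + v) \<ge> \<alpha> * ((1 - t) * ln \<beta> + t * ln (\<beta> + D))"
    using conc assms by (intro mult_left_mono) auto
  also have "\<alpha> * ((1 - t) * ln \<beta> + t * ln (\<beta> + D)) = \<alpha> * ln \<beta> + t * (s * D)"
    unfolding s by (simp add: algebra_simps)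
  finally have key: "\<alpha> * ln \<beta> + t * (s * D) \<le> \<alpha> * ln (\<beta> + v)" .
  show ?thesis
  proof (cases "x < s")
    case True
    have "t * D * x \<le> t * D * s" using True t assms by (intro mult_left_mono) auto
    then have "\<alpha> * ln \<beta> - \<beta> * x \<le> \<alpha> * ln (\<beta> + v) - (\<beta> + v) * x"
      using key by (simp add: t(3) algebra_simps)
    then show ?thesis
      using True G assms by (auto simp: rep s_def intro!: mult_right_mono divide_right_mono)
  next
    case False
    have "(1 - t) * D * s \<le> (1 - t) * D * x" using False t assms by (intro mult_left_mono) auto
    then have "\<alpha> * ln (\<beta> + D) - (\<beta> + D) * x \<le> \<alpha> * ln (\<beta> + v) - (\<beta> + v) * x"
      using key s by (simp add: t(3) algebra_simps)
    then show ?thesis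
      using False G assms by (auto simp: rep s_def intro!: mult_right_mono divide_right_mono)
  qed
qed (simp add: gamma_density_def)

section \<open>Hierarchical normal densities\<close>

lemma normal_density_measurable_mean [measurable]:
  assumes [measurable]: "f \<in> borel_measurable M" "h \<in> borel_measurable M" "g \<in> borel_measurable M"
  shows "(\<lambda>x. normal_density (f x) (h x) (g x)) \<in> borel_measurable M"
  unfolding normal_density_def by measurable

lemma nn_integral_normal_density: "0 < \<sigma> \<Longrightarrow> (\<integral>\<^sup>+x. ennreal (normal_density \<mu> \<sigma> x) \<partial>lborel) = 1"
  by (subst nn_integral_eq_integral) auto

lemma nn_integral_normal_density_affine_square:
  assumes "0 < \<sigma>"
  shows "(\<integral>\<^sup>+x. ennreal (normal_density \<mu> \<sigma> x * (c + v * x)\<^sup>2) \<partial>lborel)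
    = ennreal ((c + v * \<mu>)\<^sup>2 + v\<^sup>2 * \<sigma>\<^sup>2)"
proof -
  let ?N = "normal_density \<mu> \<sigma>"
  \<comment> \<open>Expansion about the mean: the first central moment drops out and the second is
    \<open>\<sigma>\<^sup>2\<close>.\<close>
  have "has_bochner_integral lborel (\<lambda>x. (c + v * \<mu>)\<^sup>2 * ?N x + 2 * (c + v * \<mu>) * v * (?N x * (x - \<mu>) ^ (2 * 0 + 1))
      + v\<^sup>2 * (?N x * (x - \<mu>) ^ (2 * 1)))
    ((c + v * \<mu>)\<^sup>2 * 1 + 2 * (c + v * \<mu>) * v * 0 + v\<^sup>2 * (fact (2 * 1) / ((2 / \<sigma>\<^sup>2) ^ 1 * fact 1)))"
    using normal_moment_odd[OF assms, of \<mu> 0] normal_moment_even[OF assms, of \<mu> 1]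
    by (intro has_bochner_integral_add has_bochner_integral_mult_right)
      (use assms in \<open>auto simp: has_bochner_integral_iff\<close>)
  also have "(\<lambda>x. (c + v * \<mu>)\<^sup>2 * ?N x + 2 * (c + v * \<mu>) * v * (?N x * (x - \<mu>) ^ (2 * 0 + 1))
      + v\<^sup>2 * (?N x * (x - \<mu>) ^ (2 * 1))) = (\<lambda>x. ?N x * (c + v * x)\<^sup>2)"
    by (simp add: fun_eq_iff power2_eq_square algebra_simps)
  also have "(c + v * \<mu>)\<^sup>2 * 1 + 2 * (c + v * \<mu>) * v * 0 + v\<^sup>2 * (fact (2 * 1) / ((2 / \<sigma>\<^sup>2) ^ 1 * fact 1))
      = (c + v * \<mu>)\<^sup>2 + v\<^sup>2 * \<sigma>\<^sup>2"
    by simp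
  finally show ?thesis
    by (subst nn_integral_eq_integral) (auto simp: has_bochner_integral_iff)
qed

text \<open>Fubini with coordinate \<open>None\<close> outermost: for fixed \<open>u\<close> the
  integrand is a product over the remaining coordinates, so the inner integral splits into
  one-dimensional ones. Lebesgue measure here is the image of a product over basis vectors, and
  \<open>e\<close> translates indices into these.\<close>

lemma nn_integral_vec_option:
  fixes f :: "'k::finite \<Rightarrow> real \<Rightarrow> real \<Rightarrow> ennreal"
  assumes g [measurable]: "g \<in> borel_measurable borel"
    and f [measurable]: "\<And>i. case_prod (f i) \<in> borel_measurable (borel \<Otimes>\<^sub>M borel)"
  shows "(\<integral>\<^sup>+\<xi>. g (\<xi> $ None) * (\<Prod>i\<in>UNIV. f i (\<xi> $ None) (\<xi> $ Some i)) \<partial>lborel)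
    = (\<integral>\<^sup>+u. g u * (\<Prod>i\<in>UNIV. \<integral>\<^sup>+t. f i u t \<partial>lborel) \<partial>lborel)"
proof -
  interpret product_sigma_finite "\<lambda>_::real^'k option. lborel :: real measure" ..
  define e where "e p = (axis p 1 :: real^'k option)" for p
  define I where "I = range (\<lambda>i. e (Some i))"
  have inj: "inj e" by (auto simp: inj_def e_def axis_eq_axis)
  then have injS: "inj (\<lambda>i. e (Some i))" by (auto simp: inj_def)
  have B: "Basis = insert (e None) I" "e None \<notin> I" "finite I"
    using inj by (auto simp: I_def Basis_vec_def UNIV_option_conv e_def inj_def axis_eq_axis)
  have coord: "(\<Sum>b\<in>Basis. x b *\<^sub>R b) $ p = x (e p)" for x p
  proof -
    have "(\<Sum>b\<in>Basis. x b *\<^sub>R b) $ p = (\<Sum>b\<in>Basis. x b *\<^sub>R b) \<bullet> e p" by (simp add: e_def inner_axis)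
    also have "\<dots> = x (e p)" by (intro inner_sum_left_Basis) (auto simp: e_def)
    finally show ?thesis .
  qed
  let ?F = "\<lambda>x. g (x (e None)) * (\<Prod>i\<in>UNIV. f i (x (e None)) (x (e (Some i))))"
  have mem: "e p \<in> insert (e None) I" for p by (cases p) (auto simp: I_def)
  have Fm: "?F \<in> borel_measurable (PiM (insert (e None) I) (\<lambda>_. lborel))"
    using mem by measurable
  have fu [measurable]: "f i u \<in> borel_measurable borel" for i u
    using measurable_compose[OF measurable_Pair1'[of u borel borel] f[of i]] by simp
  have "(\<integral>\<^sup>+\<xi>. g (\<xi> $ None) * (\<Prod>i\<in>UNIV. f i (\<xi> $ None) (\<xi> $ Some i)) \<partial>lborel)
    = (\<integral>\<^sup>+x. ?F x \<partial>PiM Basis (\<lambda>_. lborel))"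
    unfolding lborel_def[where 'a="real^'k option"]
    by (subst nn_integral_distr) (auto simp: coord[simplified] lborel_eq_real)
  also have "\<dots> = (\<integral>\<^sup>+u. \<integral>\<^sup>+x. ?F (x(e None := u)) \<partial>PiM I (\<lambda>_. lborel) \<partial>lborel)"
    unfolding B(1) using B Fm by (intro product_nn_integral_insert_rev) auto
  also have "\<dots> = (\<integral>\<^sup>+u. g u * (\<Prod>i\<in>UNIV. \<integral>\<^sup>+t. f i u t \<partial>lborel) \<partial>lborel)"
  proof (rule nn_integral_cong)
    fix u
    have "(\<integral>\<^sup>+x. ?F (x(e None := u)) \<partial>PiM I (\<lambda>_. lborel))
      = (\<integral>\<^sup>+x. g u * (\<Prod>b\<in>I. f (inv (\<lambda>i. e (Some i)) b) u (x b)) \<partial>PiM I (\<lambda>_. lborel))"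
      using inj unfolding I_def
      by (simp add: prod.reindex[OF injS] inv_f_f[OF injS] inj_eq)
    also have "\<dots> = g u * (\<integral>\<^sup>+x. (\<Prod>b\<in>I. f (inv (\<lambda>i. e (Some i)) b) u (x b)) \<partial>PiM I (\<lambda>_. lborel))"
      by (rule nn_integral_cmult) measurable
    also have "(\<integral>\<^sup>+x. (\<Prod>b\<in>I. f (inv (\<lambda>i. e (Some i)) b) u (x b)) \<partial>PiM I (\<lambda>_. lborel))
      = (\<Prod>b\<in>I. \<integral>\<^sup>+t. f (inv (\<lambda>i. e (Some i)) b) u t \<partial>lborel)"
      by (rule product_nn_integral_prod) (use B in auto)
    also have "\<dots> = (\<Prod>i\<in>UNIV. \<integral>\<^sup>+t. f i u t \<partial>lborel)"
      unfolding I_def by (simp add: prod.reindex[OF injS] inv_f_f[OF injS])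
    finally show "(\<integral>\<^sup>+x. ?F (x(e None := u)) \<partial>PiM I (\<lambda>_. lborel))
      = g u * (\<Prod>i\<in>UNIV. \<integral>\<^sup>+t. f i u t \<partial>lborel)" .
  qed
  finally show ?thesis .
qed

text \<open>A normal root and leaves that are independent normals given the root. The leaf means are
  arbitrary functions of the root, so that both the full conditional of \<xi> (affine means) and its
  prior given the precisions (identity) are instances.\<close>

definition hier_density ::
  "real \<Rightarrow> real \<Rightarrow> ('k::finite \<Rightarrow> real \<Rightarrow> real) \<Rightarrow> ('k \<Rightarrow> real) \<Rightarrow> real^'k option \<Rightarrow> real" where
  "hier_density e0 \<tau> m \<sigma> \<xi> = normal_density e0 \<tau> (\<xi> $ None)
     * (\<Prod>i\<in>UNIV. normal_density (m i (\<xi> $ None)) (\<sigma> i) (\<xi> $ Some i))"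

lemma hier_density_nonneg: "0 \<le> hier_density e0 \<tau> m \<sigma> \<xi>"
  unfolding hier_density_def by (intro mult_nonneg_nonneg prod_nonneg) auto

lemma nn_integral_hier_density_coord:
  fixes \<sigma> :: "'k::finite \<Rightarrow> real"
  assumes pos: "0 < \<tau>" "\<And>i. 0 < \<sigma> i"
    and [measurable]: "\<And>i. m i \<in> borel_measurable borel"
  shows "(\<integral>\<^sup>+\<xi>. ennreal (hier_density e0 \<tau> m \<sigma> \<xi> * (c + v * (\<xi> $ None) + w * (\<xi> $ Some i))\<^sup>2) \<partial>lborel)
    = (\<integral>\<^sup>+u. ennreal (normal_density e0 \<tau> u * ((c + v * u + w * m i u)\<^sup>2 + w\<^sup>2 * (\<sigma> i)\<^sup>2)) \<partial>lborel)"
proof -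
  \<comment> \<open>The square is attached to factor \<open>i\<close>, which keeps the product form;
    every other leaf integrates to one.\<close>
  define f where "f j u t = ennreal (normal_density (m j u) (\<sigma> j) t * (if j = i then (c + v * u + w * t)\<^sup>2 else 1))"
    for j u t
  have fm: "case_prod (f j) \<in> borel_measurable (borel \<Otimes>\<^sub>M borel)" for j
    unfolding f_def case_prod_beta by measurable
  have inner: "(\<Prod>j\<in>UNIV. \<integral>\<^sup>+t. f j u t \<partial>lborel) = ennreal ((c + v * u + w * m i u)\<^sup>2 + w\<^sup>2 * (\<sigma> i)\<^sup>2)" for u
  proof -
    have "(\<Prod>j\<in>UNIV. \<integral>\<^sup>+t. f j u t \<partial>lborel)
      = (\<Prod>j\<in>UNIV. if j = i then ennreal ((c + v * u + w * m j u)\<^sup>2 + w\<^sup>2 * (\<sigma> j)\<^sup>2) else 1)"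
      unfolding f_def using pos
      by (intro prod.cong)
        (auto simp: nn_integral_normal_density nn_integral_normal_density_affine_square)
    also have "\<dots> = ennreal ((c + v * u + w * m i u)\<^sup>2 + w\<^sup>2 * (\<sigma> i)\<^sup>2)" by (simp add: prod.delta)
    finally show ?thesis .
  qed
  have "ennreal (hier_density e0 \<tau> m \<sigma> \<xi> * (c + v * (\<xi> $ None) + w * (\<xi> $ Some i))\<^sup>2)
    = ennreal (normal_density e0 \<tau> (\<xi> $ None)) * (\<Prod>j\<in>UNIV. f j (\<xi> $ None) (\<xi> $ Some j))" for \<xi>
  proof -
    have "(\<Prod>j\<in>UNIV. f j (\<xi> $ None) (\<xi> $ Some j))
      = ennreal ((\<Prod>j\<in>UNIV. normal_density (m j (\<xi> $ None)) (\<sigma> j) (\<xi> $ Some j))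
          * (\<Prod>j\<in>UNIV. if j = i then (c + v * \<xi> $ None + w * \<xi> $ Some j)\<^sup>2 else 1))"
      unfolding f_def by (subst prod_ennreal) (auto simp: prod.distrib)
    also have "(\<Prod>j\<in>UNIV. if j = i then (c + v * \<xi> $ None + w * \<xi> $ Some j)\<^sup>2 else 1)
      = (c + v * (\<xi> $ None) + w * (\<xi> $ Some i))\<^sup>2" by (simp add: prod.delta)
    finally show ?thesis
      by (simp add: hier_density_def mult.assoc prod_nonneg flip: ennreal_mult)
  qed
  then have "(\<integral>\<^sup>+\<xi>. ennreal (hier_density e0 \<tau> m \<sigma> \<xi> * (c + v * (\<xi> $ None) + w * (\<xi> $ Some i))\<^sup>2) \<partial>lborel)
    = (\<integral>\<^sup>+u. ennreal (normal_density e0 \<tau> u) * (\<Prod>j\<in>UNIV. \<integral>\<^sup>+t. f j u t \<partial>lborel) \<partial>lborel)"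
    using nn_integral_vec_option[OF _ fm, of "\<lambda>u. ennreal (normal_density e0 \<tau> u)"] by simp
  then show ?thesis by (simp add: inner ennreal_mult')
qed

lemma nn_integral_hier_density:
  fixes \<sigma> :: "'k::finite \<Rightarrow> real"
  assumes "0 < \<tau>" "\<And>i. 0 < \<sigma> i" "\<And>i. m i \<in> borel_measurable borel"
  shows "(\<integral>\<^sup>+\<xi>. ennreal (hier_density e0 \<tau> m \<sigma> \<xi>) \<partial>lborel) = 1"
  using nn_integral_hier_density_coord[of \<tau> \<sigma> m e0 1 0 0] assms
  by (simp add: nn_integral_normal_density)

text \<open>Squared mean plus variance, the latter from \<open>(v + a i) * u\<close> and the leaf
  noise. Both kinds of squares in the drift function have this form: \<open>v = -1\<close>,
  \<open>c = 0\<close> for \<theta> minus \<mu>, and \<open>v = 0\<close> with \<open>c\<close>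
  minus the group mean.\<close>

lemma nn_integral_hier_density_affine_square:
  fixes \<sigma> :: "'k::finite \<Rightarrow> real"
  assumes "0 < \<tau>" "\<And>i. 0 < \<sigma> i"
  shows "(\<integral>\<^sup>+\<xi>. ennreal (hier_density e0 \<tau> (\<lambda>i u. e i + a i * (u - e0)) \<sigma> \<xi>
      * (c + v * (\<xi> $ None) + (\<xi> $ Some i))\<^sup>2) \<partial>lborel)
    = ennreal ((c + v * e0 + e i)\<^sup>2 + (v + a i)\<^sup>2 * \<tau>\<^sup>2 + (\<sigma> i)\<^sup>2)"
proof -
  let ?m = "\<lambda>i u. e i + a i * (u - e0)"
  have "(\<integral>\<^sup>+\<xi>. ennreal (hier_density e0 \<tau> ?m \<sigma> \<xi> * (c + v * (\<xi> $ None) + (\<xi> $ Some i))\<^sup>2) \<partial>lborel)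
    = (\<integral>\<^sup>+u. ennreal (normal_density e0 \<tau> u * ((c + v * u + ?m i u)\<^sup>2 + (\<sigma> i)\<^sup>2)) \<partial>lborel)"
    using nn_integral_hier_density_coord[of \<tau> \<sigma> ?m e0 c v 1 i] assms by simp
  also have "\<dots> = (\<integral>\<^sup>+u. ennreal (normal_density e0 \<tau> u * ((c + e i - a i * e0) + (v + a i) * u)\<^sup>2)
      + ennreal ((\<sigma> i)\<^sup>2) * ennreal (normal_density e0 \<tau> u) \<partial>lborel)"
    by (intro nn_integral_cong) (simp flip: ennreal_mult ennreal_plus, simp add: power2_eq_square algebra_simps)
  also have "\<dots> = ennreal (((c + e i - a i * e0) + (v + a i) * e0)\<^sup>2 + (v + a i)\<^sup>2 * \<tau>\<^sup>2) + ennreal ((\<sigma> i)\<^sup>2) * 1"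
    using assms
    by (subst nn_integral_add)
      (auto simp: nn_integral_cmult nn_integral_normal_density_affine_square nn_integral_normal_density)
  also have "\<dots> = ennreal ((c + v * e0 + e i)\<^sup>2 + (v + a i)\<^sup>2 * \<tau>\<^sup>2 + (\<sigma> i)\<^sup>2)"
    by (simp flip: ennreal_plus, simp add: algebra_simps)
  finally show ?thesis .
qed

section \<open>Covariance matrix and density of the two-level regression\<close>

lemma sum_UNIV_option:
  fixes f :: "'k::finite option \<Rightarrow> 'a::comm_monoid_add"
  shows "(\<Sum>p\<in>UNIV. f p) = f None + (\<Sum>i\<in>UNIV. f (Some i))"
  by (simp add: UNIV_option_conv sum.reindex)

lemma prod_UNIV_option:
  fixes f :: "'k::finite option \<Rightarrow> 'a::comm_monoid_mult"
  shows "(\<Prod>p\<in>UNIV. f p) = f None * (\<Prod>i\<in>UNIV. f (Some i))"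
  by (simp add: UNIV_option_conv prod.reindex)

lemma matrix_inv_left:
  fixes A :: "'a::semiring_1^'n^'n"
  assumes "invertible A" shows "matrix_inv A ** A = mat 1"
  using assms someI_ex[of "\<lambda>B. A ** B = mat 1 \<and> B ** A = mat 1"]
  unfolding invertible_def matrix_inv_def by blast

lemma real_sqrt_prod: "finite A \<Longrightarrow> sqrt (\<Prod>i\<in>A. f i) = (\<Prod>i\<in>A. sqrt (f i))"
  by (induction A rule: finite_induct) (auto simp: real_sqrt_mult)

text \<open>Covariance matrix of \<open>\<mu> \<sim> N(\<cdot>, d0)\<close>, \<open>\<theta>\<^sub>i = w i * \<mu> + noise\<close> with independent noises of
  variance \<open>d i\<close>; its determinant comes from the factorization \<open>L ** D ** transpose L\<close>.\<close>

definition hier_cov :: "real \<Rightarrow> ('k::finite \<Rightarrow> real) \<Rightarrow> ('k \<Rightarrow> real) \<Rightarrow> real^'k option^'k option" where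
  "hier_cov d0 d w = (\<chi> p q. case (p, q) of
       (None, None) \<Rightarrow> d0
     | (Some i, None) \<Rightarrow> w i * d0
     | (None, Some j) \<Rightarrow> w j * d0
     | (Some i, Some j) \<Rightarrow> (if i = j then d i else 0) + w i * w j * d0)"

lemma det_hier_cov:
  fixes d w :: "'k::finite \<Rightarrow> real"
  shows "det (hier_cov d0 d w) = d0 * (\<Prod>i\<in>UNIV. d i)"
proof -
  define L :: "real^'k option^'k option" where
    "L = (\<chi> p q. if p = q then 1 else case (p, q) of (Some i, None) \<Rightarrow> w i | _ \<Rightarrow> 0)"
  define D :: "real^'k option^'k option" where
    "D = (\<chi> p q. if p = q then case p of None \<Rightarrow> d0 | Some i \<Rightarrow> d i else 0)"
  \<comment> \<open>Adding \<open>x\<close> to row \<open>None\<close> of the identity produces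
    \<open>transpose L\<close>, and \<open>x\<close> lies in the span of the other rows. A
    triangular-matrix argument would need an order on the index type.\<close>
  define x :: "real^'k option" where "x = (\<Sum>i\<in>UNIV. w i *s row (Some i) (mat 1))"
  have "x \<in> vec.span {row j (mat 1) |j. j \<noteq> None}"
    unfolding x_def by (intro vec.span_sum vec.span_scale vec.span_base) auto
  then have "det (\<chi> k. if k = None then row None (mat 1) + x else row k (mat 1)) = det (mat 1 :: real^'k option^'k option)"
    by (rule det_row_span)
  also have "(\<chi> k. if k = None then row None (mat 1) + x else row k (mat 1)) = transpose L"
  proof -
    have "x $ q = (case q of None \<Rightarrow> 0 | Some i \<Rightarrow> w i)" for q
      by (cases q) (simp_all add: x_def row_def mat_def mult_delta_right)
    then show ?thesis
      by (auto simp: vec_eq_iff transpose_def L_def row_def mat_def split: option.splits)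
  qed
  finally have detL: "det L = 1" by (simp add: det_transpose)
  have detD: "det D = d0 * (\<Prod>i\<in>UNIV. d i)"
    by (subst det_diagonal) (auto simp: D_def prod_UNIV_option)
  have "hier_cov d0 d w = L ** D ** transpose L"
  proof -
    have LD: "(L ** D) $ p $ q = L $ p $ q * (case q of None \<Rightarrow> d0 | Some i \<Rightarrow> d i)" for p q
      by (simp add: matrix_matrix_mult_def D_def mult_delta_right)
    have L: "L $ None $ None = 1" "L $ None $ Some j = 0" "L $ Some i $ None = w i"
      "L $ Some i $ Some j = (if i = j then 1 else 0)" for i j
      by (auto simp: L_def)
    have LDL: "(L ** D ** transpose L) $ p $ q = L $ p $ None * d0 * L $ q $ None
      + (\<Sum>i\<in>UNIV. L $ p $ Some i * d i * L $ q $ Some i)" for p q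
      unfolding matrix_matrix_mult_def[of "L ** D"] by (simp add: LD transpose_def sum_UNIV_option)
    have "hier_cov d0 d w $ p $ q = (L ** D ** transpose L) $ p $ q" for p q
      unfolding LDL by (cases p; cases q) (simp_all add: L hier_cov_def mult_delta_left mult_delta_right mult_ac)
    then show ?thesis by (simp add: vec_eq_iff)
  qed
  then show ?thesis using detL detD by (simp add: det_mul det_transpose)
qed

lemma mvn_density_hier_cov:
  fixes d w :: "'k::finite \<Rightarrow> real"
  assumes pos: "0 < d0" "\<And>i. 0 < d i"
  shows "mvn_density e (hier_cov d0 d w) \<xi> = hier_density (e $ None) (sqrt d0)
    (\<lambda>i u. e $ Some i + w i * (u - e $ None)) (\<lambda>i. sqrt (d i)) \<xi>"
proof -
  let ?S = "hier_cov d0 d w"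
  define x where "x = \<xi> - e"
  \<comment> \<open>\<open>u\<close> will solve \<open>?S *v u = x\<close>, so no explicit inverse
    is required. It comes from inverting the factors of the covariance: residuals divided by the
    noise variances, then back substitution in the root coordinate.\<close>
  define u0 where "u0 i = (x $ Some i - w i * x $ None) / d i" for i
  define u :: "real^'k option" where
    "u = (\<chi> p. case p of None \<Rightarrow> x $ None / d0 - (\<Sum>i\<in>UNIV. w i * u0 i) | Some i \<Rightarrow> u0 i)"
  have dp: "0 < (\<Prod>i\<in>UNIV. d i)" using pos by (intro prod_pos) auto
  have "det ?S \<noteq> 0" using mult_pos_pos[OF pos(1) dp] by (simp only: det_hier_cov)
  then have inv: "invertible ?S" by (simp add: invertible_det_nz)
  have "?S *v u = x"
  proof -
    have "(?S *v u) $ None = x $ None"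
    proof -
      have "(?S *v u) $ None = d0 * (u $ None + (\<Sum>i\<in>UNIV. w i * u0 i))"
        by (simp add: matrix_vector_mult_def sum_UNIV_option hier_cov_def u_def sum_distrib_left algebra_simps)
      then show ?thesis using pos by (simp add: u_def)
    qed
    moreover have "(?S *v u) $ Some i = x $ Some i" for i
    proof -
      have "(?S *v u) $ Some i = w i * (d0 * (u $ None + (\<Sum>j\<in>UNIV. w j * u0 j))) + d i * u0 i"
        by (simp add: matrix_vector_mult_def sum_UNIV_option hier_cov_def u_def sum_distrib_left
            distrib_right sum.distrib mult_delta_left mult_delta_right algebra_simps)
      then show ?thesis using pos(1) pos(2)[of i] by (simp add: u_def u0_def)
    qed
    ultimately show ?thesis by (simp add: vec_eq_iff split_option_all)
  qed
  then have "matrix_inv ?S *v x = u"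
    using matrix_inv_left[OF inv] by (metis matrix_vector_mul_assoc matrix_vector_mul_lid)
  then have "x \<bullet> (matrix_inv ?S *v x) = x $ None * u $ None + (\<Sum>i\<in>UNIV. x $ Some i * u0 i)"
    by (simp add: inner_vec_def sum_UNIV_option u_def)
  also have "\<dots> = (x $ None)\<^sup>2 / d0 + (\<Sum>i\<in>UNIV. (x $ Some i - w i * x $ None) * u0 i)"
    by (simp add: u_def power2_eq_square left_diff_distrib right_diff_distrib sum_subtractf sum_distrib_left mult_ac)
  also have "\<dots> = (x $ None)\<^sup>2 / d0 + (\<Sum>i\<in>UNIV. (x $ Some i - w i * x $ None)\<^sup>2 / d i)"
    by (simp add: u0_def power2_eq_square)
  finally have quad: "x \<bullet> (matrix_inv ?S *v x)
    = (x $ None)\<^sup>2 / d0 + (\<Sum>i\<in>UNIV. (x $ Some i - w i * x $ None)\<^sup>2 / d i)" .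
  have "sqrt ((2 * pi) ^ CARD('k option) * det ?S) = sqrt ((2 * pi * d0) * (\<Prod>i\<in>UNIV. 2 * pi * d i))"
    by (simp add: det_hier_cov prod.distrib card_UNIV_option algebra_simps)
  also have "\<dots> = sqrt (2 * pi * d0) * (\<Prod>i\<in>UNIV. sqrt (2 * pi * d i))"
    by (simp only: real_sqrt_mult[of "2 * pi * d0"] real_sqrt_prod finite)
  finally have norm: "sqrt ((2 * pi) ^ CARD('k option) * det ?S) = sqrt (2 * pi * d0) * (\<Prod>i\<in>UNIV. sqrt (2 * pi * d i))" .
  have "exp (- (x \<bullet> (matrix_inv ?S *v x)) / 2)
    = exp (- (x $ None)\<^sup>2 / (2 * d0)) * (\<Prod>i\<in>UNIV. exp (- (x $ Some i - w i * x $ None)\<^sup>2 / (2 * d i)))"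
  proof -
    have "- ((x $ None)\<^sup>2 / d0 + (\<Sum>i\<in>UNIV. (x $ Some i - w i * x $ None)\<^sup>2 / d i)) / 2
      = - (x $ None)\<^sup>2 / (2 * d0) + (\<Sum>i\<in>UNIV. - (x $ Some i - w i * x $ None)\<^sup>2 / (2 * d i))"
    proof -
      have "(\<Sum>i\<in>UNIV. (x $ Some i - w i * x $ None)\<^sup>2 / d i) / 2
        = (\<Sum>i\<in>UNIV. (x $ Some i - w i * x $ None)\<^sup>2 / (2 * d i))"
        unfolding sum_divide_distrib by (intro sum.cong) auto
      then show ?thesis by (simp add: sum_negf field_simps)
    qed
    then show ?thesis unfolding quad by (simp only: exp_add exp_sum finite)
  qed
  then have "mvn_density e ?S \<xi> = exp (- (x $ None)\<^sup>2 / (2 * d0)) * (\<Prod>i\<in>UNIV. exp (- (x $ Some i - w i * x $ None)\<^sup>2 / (2 * d i)))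
    / (sqrt (2 * pi * d0) * (\<Prod>i\<in>UNIV. sqrt (2 * pi * d i)))"
    unfolding mvn_density_def norm x_def by simp
  also have "\<dots> = hier_density (e $ None) (sqrt d0) (\<lambda>i u. e $ Some i + w i * (u - e $ None)) (\<lambda>i. sqrt (d i)) \<xi>"
  proof -
    have "x $ None = \<xi> $ None - e $ None" by (simp add: x_def)
    then show ?thesis
      using pos by (simp add: hier_density_def normal_density_def prod_dividef less_imp_le diff_diff_eq x_def)
  qed
  finally show ?thesis .
qed

section \<open>Full conditionals and the joint density\<close>

lemma cond_cov_eq_hier_cov:
  "cond_cov s0 ms s e = hier_cov (1 / (s0 + tsum ms s e))
     (\<lambda>i. 1 / (s + real (ms i) * e)) (\<lambda>i. s / (s + real (ms i) * e))"
proof -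
  \<comment> \<open>Opaque names for the denominators keep simplification from clearing fractions
    whose denominators might vanish.\<close>
  obtain D where D: "\<And>i. s + real (ms i) * e = D i" using that by auto
  obtain T where T: "s0 + tsum ms s e = T" by simp
  have "cond_cov s0 ms s e $ p $ q = hier_cov (1 / T) (\<lambda>i. 1 / D i) (\<lambda>i. s / D i) $ p $ q" for p q
    by (cases p; cases q; (simp add: cond_cov_def hier_cov_def D T)?;
        (simp add: power2_eq_square divide_inverse distrib_left mult_ac)?)
  then show ?thesis by (simp add: vec_eq_iff D T)
qed

text \<open>The regression form of the full conditional of \<open>\<xi>\<close>: \<open>\<mu>\<close> given \<open>\<lambda>\<close>, then the
  \<open>\<theta>\<^sub>i\<close> given \<open>\<mu>\<close> and \<open>\<lambda>\<close>.\<close>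

definition xi_density ::
  "real \<Rightarrow> real \<Rightarrow> ('k::finite \<Rightarrow> nat) \<Rightarrow> ('k \<Rightarrow> nat \<Rightarrow> real) \<Rightarrow> real \<times> real \<Rightarrow> real^'k option \<Rightarrow> real" where
  "xi_density s0 m0 ms y l \<xi> = (let s = fst l; e = snd l in
     hier_density (cond_mean_mu s0 m0 ms y s e) (sqrt (1 / (s0 + tsum ms s e)))
       (\<lambda>i u. cond_mean s0 m0 ms y s e $ Some i
         + s / (s + real (ms i) * e) * (u - cond_mean_mu s0 m0 ms y s e))
       (\<lambda>i. sqrt (1 / (s + real (ms i) * e))) \<xi>)"

lemma tsum_nonneg: "0 < s \<Longrightarrow> 0 < e \<Longrightarrow> 0 \<le> tsum ms s e"
  unfolding tsum_def by (intro sum_nonneg) auto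

lemma precision_pos:
  assumes "0 < s" "0 < e" shows "0 < s + real n * e"
  using assms by (simp add: add_pos_nonneg)

lemma mvn_density_eq_xi_density:
  assumes "0 < s0" "0 < s" "0 < e"
  shows "mvn_density (cond_mean s0 m0 ms y s e) (cond_cov s0 ms s e) \<xi> = xi_density s0 m0 ms y (s, e) \<xi>"
proof -
  have T: "0 < s0 + tsum ms s e" using assms tsum_nonneg[of s e ms] by simp
  have D: "0 < s + real (ms i) * e" for i using assms by (intro precision_pos)
  have e0: "cond_mean s0 m0 ms y s e $ None = cond_mean_mu s0 m0 ms y s e" by (simp add: cond_mean_def)
  have "mvn_density (cond_mean s0 m0 ms y s e) (cond_cov s0 ms s e) \<xi>
    = hier_density (cond_mean s0 m0 ms y s e $ None) (sqrt (1 / (s0 + tsum ms s e)))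
       (\<lambda>i u. cond_mean s0 m0 ms y s e $ Some i
         + s / (s + real (ms i) * e) * (u - cond_mean s0 m0 ms y s e $ None))
       (\<lambda>i. sqrt (1 / (s + real (ms i) * e))) \<xi>"
    unfolding cond_cov_eq_hier_cov
    by (rule mvn_density_hier_cov[where d = "\<lambda>i. 1 / (s + real (ms i) * e)"]) (use T D in auto)
  then show ?thesis by (simp only: xi_density_def Let_def fst_conv snd_conv e0)
qed

lemma xi_density_nonneg: "0 \<le> xi_density s0 m0 ms y l \<xi>"
  by (simp add: xi_density_def Let_def hier_density_nonneg)

lemma vec_nth_measurable [measurable]:
  "f \<in> M \<rightarrow>\<^sub>M borel \<Longrightarrow> (\<lambda>x. (f x :: real^'n::finite) $ i) \<in> borel_measurable M"
  by (rule measurable_compose[OF _ borel_measurable_continuous_onI]) (auto intro: continuous_intros)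

lemma tsum_measurable [measurable]:
  assumes [measurable]: "f \<in> borel_measurable M" "g \<in> borel_measurable M"
  shows "(\<lambda>x. tsum ms (f x) (g x)) \<in> borel_measurable M"
  unfolding tsum_def by measurable

lemma cond_mean_mu_measurable [measurable]:
  assumes [measurable]: "f \<in> borel_measurable M" "g \<in> borel_measurable M"
  shows "(\<lambda>x. cond_mean_mu s0 m0 ms y (f x) (g x)) \<in> borel_measurable M"
  unfolding cond_mean_mu_def by measurable

lemma cond_mean_Some_measurable [measurable]:
  assumes [measurable]: "f \<in> borel_measurable M" "g \<in> borel_measurable M"
  shows "(\<lambda>x. cond_mean s0 m0 ms y (f x) (g x) $ Some i) \<in> borel_measurable M"
proof -
  have "(\<lambda>x. cond_mean s0 m0 ms y (f x) (g x) $ Some i)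
    = (\<lambda>x. (f x * cond_mean_mu s0 m0 ms y (f x) (g x) + real (ms i) * g x * group_mean ms y i)
                 / (f x + real (ms i) * g x))" by (simp add: cond_mean_def fun_eq_iff)
  then show ?thesis by simp
qed

lemma xi_density_pair_measurable:
  assumes [measurable]: "f \<in> borel_measurable M" "g \<in> borel_measurable M" "h \<in> M \<rightarrow>\<^sub>M borel"
  shows "(\<lambda>x. xi_density s0 m0 ms y (f x, g x) (h x)) \<in> borel_measurable M"
  unfolding xi_density_def hier_density_def Let_def fst_conv snd_conv by measurable

lemma nn_integral_xi_density:
  assumes "0 < s0" "0 < fst l" "0 < snd l"
  shows "(\<integral>\<^sup>+\<xi>. ennreal (xi_density s0 m0 ms y l \<xi>) \<partial>lborel) = 1"
  unfolding xi_density_def Let_def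
  using assms tsum_nonneg[of "fst l" "snd l" ms]
  by (intro nn_integral_hier_density) (auto simp: precision_pos)

section \<open>Conjugacy and completing the square\<close>

lemma gamma_density_conjugate:
  assumes "0 < a" "0 < b" "0 \<le> v"
  obtains c where "0 \<le> c"
    "\<And>x. sqrt (x / (2 * pi)) ^ N * exp (- (x * v / 2)) * gamma_density a b x
       = c * gamma_density (real N / 2 + a) (v / 2 + b) x"
proof
  let ?A = "real N / 2 + a" and ?B = "v / 2 + b"
  have A: "0 < ?A" and B: "0 < ?B" using assms by (auto simp: add_nonneg_pos)
  \<comment> \<open>Quotient of the normalizing constants before and after the update. It may depend
    on \<open>v\<close> but not on \<open>x\<close>.\<close>
  define c where "c = b powr a / Gamma a * Gamma ?A / ?B powr ?A / sqrt (2 * pi) ^ N"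
  have GA: "0 < Gamma a" "0 < Gamma ?A" using assms A by (auto simp: Gamma_real_pos)
  show "0 \<le> c" unfolding c_def using GA by (intro divide_nonneg_nonneg mult_nonneg_nonneg) auto
  show "sqrt (x / (2 * pi)) ^ N * exp (- (x * v / 2)) * gamma_density a b x
       = c * gamma_density ?A ?B x" for x
  proof (cases "0 < x")
    case True
    have alg: "X / P * E1 * (p * Y * E2) = p * G / Q / P * (Q / G * (X * Y) * (E1 * E2))"
      if "G \<noteq> 0" "Q \<noteq> 0" for X P E1 p Y E2 G Q :: real
      using that by (simp add: field_simps)
    have 1: "sqrt (x / (2 * pi)) ^ N = x powr (real N / 2) / sqrt (2 * pi) ^ N"
      using True by (simp add: real_sqrt_divide power_divide powr_half_sqrt[symmetric] powr_realpow[symmetric] powr_powr)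
    have 2: "x powr (?A - 1) = x powr (real N / 2) * x powr (a - 1)"
      by (simp add: add_diff_eq flip: powr_add)
    have 3: "exp (- x * ?B) = exp (- (x * v / 2)) * exp (- x * b)"
      by (simp add: algebra_simps flip: exp_add)
    have "Gamma ?A \<noteq> 0" "?B powr ?A \<noteq> 0" using GA B by auto
    then show ?thesis
      unfolding gamma_density_def c_def if_P[OF True] 1 2 3 by (rule alg)
  qed (simp add: gamma_density_def)
qed

lemma normal_density_precision:
  "0 < e \<Longrightarrow> normal_density \<mu> (1 / sqrt e) x = sqrt (e / (2 * pi)) * exp (- (e * (x - \<mu>)\<^sup>2) / 2)"
  by (simp add: normal_density_def power_divide real_sqrt_divide field_simps)

lemma prod_normal_density_precision:
  "0 < e \<Longrightarrow> finite A \<Longrightarrow> (\<Prod>i\<in>A. normal_density (\<mu> i) (1 / sqrt e) (x i))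
    = sqrt (e / (2 * pi)) ^ card A * exp (- (e * (\<Sum>i\<in>A. (x i - \<mu> i)\<^sup>2)) / 2)"
  unfolding sum_distrib_left sum_negf[symmetric] sum_divide_distrib
  by (simp add: normal_density_precision prod.distrib exp_sum)

lemma within_group_sum:
  assumes "0 < ms i"
  shows "(\<Sum>j\<in>{1..ms i}. (y i j - t)\<^sup>2)
    = (\<Sum>j\<in>{1..ms i}. (y i j - group_mean ms y i)\<^sup>2) + real (ms i) * (t - group_mean ms y i)\<^sup>2"
proof -
  let ?g = "group_mean ms y i"
  have g: "(\<Sum>j\<in>{1..ms i}. y i j) = real (ms i) * ?g" using assms by (simp add: group_mean_def)
  have "(\<Sum>j\<in>{1..ms i}. (y i j - t)\<^sup>2)
    = (\<Sum>j\<in>{1..ms i}. (y i j - ?g)\<^sup>2 + (2 * (?g - t) * y i j + (t\<^sup>2 - ?g\<^sup>2)))"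
    by (intro sum.cong) (auto simp: power2_eq_square algebra_simps)
  also have "\<dots> = (\<Sum>j\<in>{1..ms i}. (y i j - ?g)\<^sup>2) + (2 * (?g - t) * (\<Sum>j\<in>{1..ms i}. y i j) + real (ms i) * (t\<^sup>2 - ?g\<^sup>2))"
    by (simp add: sum.distrib sum_distrib_left)
  finally show ?thesis unfolding g by (simp add: power2_eq_square algebra_simps)
qed

text \<open>The data enter through \<open>v2\<close> and \<open>SSE\<close> alone. Each precision is
  grouped with its exponential and its prior, so that conjugacy applies to the two
  separately.\<close>

lemma joint_density_explicit:
  assumes "0 < s0" "0 < s" "0 < e" "\<And>i. 0 < ms i"
  shows "joint_density a1 b1 a2 b2 s0 m0 ms y ((s, e), \<xi>)
    = sqrt (e / (2 * pi)) ^ obs_total ms * exp (- (e * (v2 ms y (theta_of \<xi>) + SSE ms y) / 2)) * gamma_density a2 b2 e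
    * (sqrt (s / (2 * pi)) ^ CARD('k) * exp (- (s * v1 (theta_of \<xi>) (mu_of \<xi>) / 2)) * gamma_density a1 b1 s)
    * normal_density m0 (1 / sqrt s0) (mu_of (\<xi> :: real^'k::finite option))"
proof -
  have "(\<Prod>i\<in>UNIV. \<Prod>j\<in>{1..ms i}. normal_density (theta_of \<xi> $ i) (1 / sqrt e) (y i j))
    = (\<Prod>i\<in>UNIV. sqrt (e / (2 * pi)) ^ ms i * exp (- (e * (\<Sum>j\<in>{1..ms i}. (y i j - theta_of \<xi> $ i)\<^sup>2)) / 2))"
    using assms by (simp add: prod_normal_density_precision)
  also have "\<dots> = sqrt (e / (2 * pi)) ^ obs_total ms
    * exp (\<Sum>i\<in>UNIV. - (e * (\<Sum>j\<in>{1..ms i}. (y i j - theta_of \<xi> $ i)\<^sup>2)) / 2)"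
    by (simp add: prod.distrib exp_sum obs_total_def power_sum)
  also have "(\<Sum>i\<in>UNIV. - (e * (\<Sum>j\<in>{1..ms i}. (y i j - theta_of \<xi> $ i)\<^sup>2)) / 2)
    = - (e * (\<Sum>i\<in>UNIV. \<Sum>j\<in>{1..ms i}. (y i j - theta_of \<xi> $ i)\<^sup>2) / 2)"
    by (simp add: sum_negf sum_divide_distrib sum_distrib_left)
  also have "(\<Sum>i\<in>UNIV. \<Sum>j\<in>{1..ms i}. (y i j - theta_of \<xi> $ i)\<^sup>2) = v2 ms y (theta_of \<xi>) + SSE ms y"
    unfolding v2_def SSE_def sum.distrib[symmetric]
    by (intro sum.cong refl, subst add.commute, rule within_group_sum, rule assms)
  finally show ?thesis
    using assms by (simp add: joint_density_def prod_normal_density_precision v1_def)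
qed

lemma joint_density_nonneg:
  "0 < a1 \<Longrightarrow> 0 < a2 \<Longrightarrow> 0 \<le> joint_density a1 b1 a2 b2 s0 m0 ms y z"
  unfolding joint_density_def case_prod_beta
  by (intro mult_nonneg_nonneg prod_nonneg) (auto simp: gamma_density_nonneg)

definition lambda_density ::
  "real \<Rightarrow> real \<Rightarrow> real \<Rightarrow> real \<Rightarrow> ('k::finite \<Rightarrow> nat) \<Rightarrow> ('k \<Rightarrow> nat \<Rightarrow> real)
     \<Rightarrow> real^'k option \<Rightarrow> real \<times> real \<Rightarrow> real" where
  "lambda_density a1 b1 a2 b2 ms y \<xi> l =
     gamma_density (real CARD('k) / 2 + a1) (v1 (theta_of \<xi>) (mu_of \<xi>) / 2 + b1) (fst l)
     * gamma_density (real (obs_total ms) / 2 + a2) ((v2 ms y (theta_of \<xi>) + SSE ms y) / 2 + b2) (snd l)"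

lemma v1_nonneg: "0 \<le> v1 \<theta> \<mu>" unfolding v1_def by (intro sum_nonneg) auto
lemma v2_nonneg: "0 \<le> v2 ms y \<theta>" unfolding v2_def by (intro sum_nonneg) auto
lemma SSE_nonneg: "0 \<le> SSE ms y" unfolding SSE_def by (intro sum_nonneg) auto

lemma joint_density_lambda_factor:
  fixes \<xi> :: "real^'k::finite option"
  assumes "0 < a1" "0 < b1" "0 < a2" "0 < b2" "0 < s0" "\<And>i. 0 < ms i"
  obtains c where "0 \<le> c" "\<And>s e. 0 < s \<Longrightarrow> 0 < e \<Longrightarrow>
    joint_density a1 b1 a2 b2 s0 m0 ms y ((s, e), \<xi>) = c * lambda_density a1 b1 a2 b2 ms y \<xi> (s, e)"
proof -
  obtain c1 where c1: "0 \<le> c1" "\<And>x. sqrt (x / (2 * pi)) ^ CARD('k) * exp (- (x * v1 (theta_of \<xi>) (mu_of \<xi>) / 2)) * gamma_density a1 b1 x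
       = c1 * gamma_density (real CARD('k) / 2 + a1) (v1 (theta_of \<xi>) (mu_of \<xi>) / 2 + b1) x"
    using gamma_density_conjugate[OF assms(1,2) v1_nonneg] by metis
  obtain c2 where c2: "0 \<le> c2" "\<And>x. sqrt (x / (2 * pi)) ^ obs_total ms * exp (- (x * (v2 ms y (theta_of \<xi>) + SSE ms y) / 2)) * gamma_density a2 b2 x
       = c2 * gamma_density (real (obs_total ms) / 2 + a2) ((v2 ms y (theta_of \<xi>) + SSE ms y) / 2 + b2) x"
    using gamma_density_conjugate[OF assms(3,4) add_nonneg_nonneg[OF v2_nonneg SSE_nonneg]] by metis
  show thesis
  proof (rule that[of "c1 * c2 * normal_density m0 (1 / sqrt s0) (mu_of \<xi>)"])
    show "0 \<le> c1 * c2 * normal_density m0 (1 / sqrt s0) (mu_of \<xi>)" using c1 c2 by simp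
    show "joint_density a1 b1 a2 b2 s0 m0 ms y ((s, e), \<xi>)
      = c1 * c2 * normal_density m0 (1 / sqrt s0) (mu_of \<xi>) * lambda_density a1 b1 a2 b2 ms y \<xi> (s, e)"
      if "0 < s" "0 < e" for s e
      unfolding joint_density_explicit[OF assms(5) that assms(6)] lambda_density_def fst_conv snd_conv c1(2) c2(2)
      by (simp only: mult_ac)
  qed
qed

text \<open>Completing the square in \<open>u\<close>: \<open>E\<close> is the precision-weighted
  average of \<open>m0\<close> and the centers, and the remainder is free of
  \<open>u\<close>.\<close>

lemma sum_affine_square:
  fixes t c :: "'i \<Rightarrow> real" and s0 m0 u :: real
  assumes "0 < s0 + sum t A"
  defines "E \<equiv> (s0 * m0 + (\<Sum>i\<in>A. t i * c i)) / (s0 + sum t A)"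
  shows "s0 * (u - m0)\<^sup>2 + (\<Sum>i\<in>A. t i * (u - c i)\<^sup>2)
    = (s0 + sum t A) * (u - E)\<^sup>2 + (s0 * m0\<^sup>2 + (\<Sum>i\<in>A. t i * (c i)\<^sup>2) - (s0 + sum t A) * E\<^sup>2)"
proof -
  have E: "(s0 + sum t A) * E = s0 * m0 + (\<Sum>i\<in>A. t i * c i)" using assms by simp
  have "(\<Sum>i\<in>A. t i * (u - c i)\<^sup>2) = (\<Sum>i\<in>A. t i * u\<^sup>2 - 2 * u * (t i * c i) + t i * (c i)\<^sup>2)"
    by (intro sum.cong) (auto simp: power2_eq_square algebra_simps)
  also have "\<dots> = sum t A * u\<^sup>2 - 2 * u * (\<Sum>i\<in>A. t i * c i) + (\<Sum>i\<in>A. t i * (c i)\<^sup>2)"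
    by (simp add: sum.distrib sum_subtractf sum_distrib_left sum_distrib_right)
  also have "(\<Sum>i\<in>A. t i * c i) = (s0 + sum t A) * E - s0 * m0" using E by simp
  finally show ?thesis by (simp add: power2_eq_square algebra_simps)
qed

text \<open>Completing the square in \<open>x\<close>. The leftover coefficient is the precision
  with which \<open>u\<close> stays tied to \<open>g\<close> once \<open>x\<close> is eliminated;
  summed over groups it becomes \<open>tsum\<close>. The case \<open>s = \<phi>\<close>,
  \<open>e = 1\<close> serves to minimize the drift function.\<close>

lemma square_sum_split:
  fixes s e :: real
  assumes "0 < s + e"
  shows "s * (x - u)\<^sup>2 + e * (x - g)\<^sup>2
    = (s + e) * (x - (s * u + e * g) / (s + e))\<^sup>2 + s * e / (s + e) * (u - g)\<^sup>2"
proof -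
  have "(s + e) * (s * (x - u)\<^sup>2 + e * (x - g)\<^sup>2) = ((s + e) * x - (s * u + e * g))\<^sup>2 + s * e * (u - g)\<^sup>2"
    by (simp add: power2_eq_square algebra_simps)
  moreover have "(s + e) * x - (s * u + e * g) = (s + e) * (x - (s * u + e * g) / (s + e))"
    using assms by (simp add: field_simps)
  ultimately have "(s + e) * (s * (x - u)\<^sup>2 + e * (x - g)\<^sup>2)
    = (s + e) * ((s + e) * (x - (s * u + e * g) / (s + e))\<^sup>2 + s * e / (s + e) * (u - g)\<^sup>2)"
    using assms by (simp add: power_mult_distrib power2_eq_square distrib_left)
  then show ?thesis using assms by simp
qed

lemma cond_mean_mu_weighted:
  "cond_mean_mu s0 m0 ms y s e = (s0 * m0 + (\<Sum>i\<in>UNIV. (s * (real (ms i) * e) / (s + real (ms i) * e)) * group_mean ms y i))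
    / (s0 + (\<Sum>i\<in>UNIV. s * (real (ms i) * e) / (s + real (ms i) * e)))"
  by (simp add: cond_mean_mu_def tsum_def add_divide_distrib mult_ac)

lemma joint_density_xi_factor:
  fixes ms :: "'k::finite \<Rightarrow> nat"
  assumes pos: "0 < a1" "0 < a2" "0 < s0" "\<And>i. 0 < ms i" "0 < s" "0 < e"
  obtains c where "0 \<le> c" "\<And>\<xi>. joint_density a1 b1 a2 b2 s0 m0 ms y ((s, e), \<xi>)
    = c * xi_density s0 m0 ms y (s, e) \<xi>"
proof -
  let ?D = "\<lambda>i. s + real (ms i) * e"
  let ?t = "\<lambda>i. s * (real (ms i) * e) / ?D i"
  let ?g = "group_mean ms y"
  let ?E = "cond_mean_mu s0 m0 ms y s e"
  let ?T = "s0 + sum ?t UNIV"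
  let ?R = "s0 * m0\<^sup>2 + (\<Sum>i\<in>UNIV. ?t i * (?g i)\<^sup>2) - ?T * ?E\<^sup>2"
  have D: "0 < ?D i" for i using pos by (intro precision_pos)
  have T: "?T = s0 + tsum ms s e" by (simp add: tsum_def mult_ac)
  have Tpos: "0 < ?T" unfolding T using pos tsum_nonneg[of s e ms] by (simp add: add_pos_nonneg)
  \<comment> \<open>\<open>?p\<close> collects the factors free of \<xi>, including the exponential
    of the remainder \<open>?R\<close>; \<open>?q\<close> is the prefactor of the conditional normal
    density.\<close>
  let ?p = "sqrt (e / (2 * pi)) ^ obs_total ms * exp (- (e * SSE ms y / 2)) * gamma_density a2 b2 e
    * (sqrt (s / (2 * pi)) ^ CARD('k) * gamma_density a1 b1 s) * sqrt (s0 / (2 * pi)) * exp (- ?R / 2)"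
  let ?q = "sqrt (?T / (2 * pi)) * (\<Prod>i\<in>UNIV. sqrt (?D i / (2 * pi)))"
  have cancel: "p * r = p / q * x" if "0 < q" "x = q * r" for p q r x :: real using that by simp
  have qpos: "0 < ?q" using D Tpos by (intro mult_pos_pos prod_pos) auto
  show thesis
  proof (rule that[of "?p / ?q"])
    show "0 \<le> ?p / ?q"
      using pos qpos by (intro divide_nonneg_pos mult_nonneg_nonneg) (auto simp: gamma_density_nonneg)
    fix \<xi> :: "real^'k option"
    let ?u = "\<xi> $ None"
    let ?c = "\<lambda>i. (s * ?u + real (ms i) * e * ?g i) / ?D i"
    have mean: "cond_mean s0 m0 ms y s e $ Some i + s / ?D i * (?u - ?E) = ?c i" for i
      by (simp add: cond_mean_def right_diff_distrib add_divide_distrib diff_divide_distrib)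
    \<comment> \<open>The \<theta> coordinates are eliminated first, each leaving a square in
      \<open>?u\<close>; these are then combined with the prior square of \<mu>.\<close>
    have quad: "e * v2 ms y (theta_of \<xi>) + s * v1 (theta_of \<xi>) (mu_of \<xi>) + s0 * (?u - m0)\<^sup>2
      = ?T * (?u - ?E)\<^sup>2 + (\<Sum>i\<in>UNIV. ?D i * (\<xi> $ Some i - ?c i)\<^sup>2) + ?R"
    proof -
      have "e * v2 ms y (theta_of \<xi>) + s * v1 (theta_of \<xi>) (mu_of \<xi>)
        = (\<Sum>i\<in>UNIV. s * (\<xi> $ Some i - ?u)\<^sup>2 + real (ms i) * e * (\<xi> $ Some i - ?g i)\<^sup>2)"
        by (simp add: v1_def v2_def theta_of_def mu_of_def sum_distrib_left sum.distrib mult_ac)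
      also have "\<dots> = (\<Sum>i\<in>UNIV. ?D i * (\<xi> $ Some i - ?c i)\<^sup>2 + ?t i * (?u - ?g i)\<^sup>2)"
        using D by (intro sum.cong square_sum_split) auto
      finally have "e * v2 ms y (theta_of \<xi>) + s * v1 (theta_of \<xi>) (mu_of \<xi>) + s0 * (?u - m0)\<^sup>2
        = (\<Sum>i\<in>UNIV. ?D i * (\<xi> $ Some i - ?c i)\<^sup>2) + (s0 * (?u - m0)\<^sup>2 + (\<Sum>i\<in>UNIV. ?t i * (?u - ?g i)\<^sup>2))"
        by (simp add: sum.distrib)
      also have "s0 * (?u - m0)\<^sup>2 + (\<Sum>i\<in>UNIV. ?t i * (?u - ?g i)\<^sup>2) = ?T * (?u - ?E)\<^sup>2 + ?R"
        using sum_affine_square[OF Tpos, of ?u m0 ?g] unfolding cond_mean_mu_weighted by simp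
      finally show ?thesis by simp
    qed
    have "joint_density a1 b1 a2 b2 s0 m0 ms y ((s, e), \<xi>)
      = sqrt (e / (2 * pi)) ^ obs_total ms * gamma_density a2 b2 e * (sqrt (s / (2 * pi)) ^ CARD('k) * gamma_density a1 b1 s)
        * sqrt (s0 / (2 * pi)) * (exp (- (e * SSE ms y / 2))
        * (exp (- (e * v2 ms y (theta_of \<xi>) / 2)) * exp (- (s * v1 (theta_of \<xi>) (mu_of \<xi>) / 2)) * exp (- (s0 * (?u - m0)\<^sup>2 / 2))))"
    proof -
      have "exp (- (e * (v2 ms y (theta_of \<xi>) + SSE ms y) / 2)) = exp (- (e * SSE ms y / 2)) * exp (- (e * v2 ms y (theta_of \<xi>) / 2))"
        by (simp add: distrib_left add_divide_distrib flip: exp_add)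
      moreover have "normal_density m0 (1 / sqrt s0) (mu_of \<xi>) = sqrt (s0 / (2 * pi)) * exp (- (s0 * (?u - m0)\<^sup>2 / 2))"
        using pos by (simp add: normal_density_precision mu_of_def)
      ultimately show ?thesis
        unfolding joint_density_explicit[OF pos(3,5,6,4)] by (simp only: mult_ac)
    qed
    also have "exp (- (e * v2 ms y (theta_of \<xi>) / 2)) * exp (- (s * v1 (theta_of \<xi>) (mu_of \<xi>) / 2)) * exp (- (s0 * (?u - m0)\<^sup>2 / 2))
      = exp (- (e * v2 ms y (theta_of \<xi>) + s * v1 (theta_of \<xi>) (mu_of \<xi>) + s0 * (?u - m0)\<^sup>2) / 2)"
      by (simp add: add_divide_distrib diff_divide_distrib flip: exp_add)
    also have "\<dots> = exp (- ?R / 2) * (exp (- (?T * (?u - ?E)\<^sup>2) / 2) * (\<Prod>i\<in>UNIV. exp (- (?D i * (\<xi> $ Some i - ?c i)\<^sup>2) / 2)))"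
    proof -
      have "- (?T * (?u - ?E)\<^sup>2 + (\<Sum>i\<in>UNIV. ?D i * (\<xi> $ Some i - ?c i)\<^sup>2) + ?R) / 2
        = - ?R / 2 + (- (?T * (?u - ?E)\<^sup>2) / 2 + (\<Sum>i\<in>UNIV. - (?D i * (\<xi> $ Some i - ?c i)\<^sup>2) / 2))"
        by (simp only: sum_negf sum_divide_distrib[symmetric]) (simp add: add_divide_distrib diff_divide_distrib)
      then show ?thesis unfolding quad by (simp only: exp_add exp_sum finite)
    qed
    finally have joint: "joint_density a1 b1 a2 b2 s0 m0 ms y ((s, e), \<xi>)
      = ?p * (exp (- (?T * (?u - ?E)\<^sup>2) / 2) * (\<Prod>i\<in>UNIV. exp (- (?D i * (\<xi> $ Some i - ?c i)\<^sup>2) / 2)))"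
      by (simp only: mult_ac)
    have "xi_density s0 m0 ms y (s, e) \<xi>
      = normal_density ?E (1 / sqrt ?T) ?u * (\<Prod>i\<in>UNIV. normal_density (?c i) (1 / sqrt (?D i)) (\<xi> $ Some i))"
      unfolding xi_density_def Let_def hier_density_def fst_conv snd_conv mean T by (simp add: real_sqrt_divide)
    also have "\<dots> = ?q * (exp (- (?T * (?u - ?E)\<^sup>2) / 2) * (\<Prod>i\<in>UNIV. exp (- (?D i * (\<xi> $ Some i - ?c i)\<^sup>2) / 2)))"
      unfolding normal_density_precision[OF Tpos] normal_density_precision[OF D] prod.distrib by (simp only: mult_ac)
    finally show "joint_density a1 b1 a2 b2 s0 m0 ms y ((s, e), \<xi>) = ?p / ?q * xi_density s0 m0 ms y (s, e) \<xi>"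
      unfolding joint by (rule cancel[OF qpos])
  qed
qed

section \<open>The Gibbs kernel and its invariant law\<close>

lemma fst_borel_measurable [measurable]:
  "f \<in> M \<rightarrow>\<^sub>M (borel :: ('a::second_countable_topology \<times> 'b::second_countable_topology) measure) \<Longrightarrow> (\<lambda>x. fst (f x)) \<in> M \<rightarrow>\<^sub>M borel"
  by (rule measurable_compose[OF _ borel_measurable_continuous_onI]) (auto intro: continuous_intros)

lemma snd_borel_measurable [measurable]:
  "f \<in> M \<rightarrow>\<^sub>M (borel :: ('a::second_countable_topology \<times> 'b::second_countable_topology) measure) \<Longrightarrow> (\<lambda>x. snd (f x)) \<in> M \<rightarrow>\<^sub>M borel"
  by (rule measurable_compose[OF _ borel_measurable_continuous_onI]) (auto intro: continuous_intros)

abbreviation (input) pos_quadrant :: "(real \<times> real) set" where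
  "pos_quadrant \<equiv> {0<..} \<times> {0<..}"

lemma base_domain_sets: "pos_quadrant \<times> (UNIV :: (real^'k::finite option) set) \<in> sets borel"
  by (intro borel_open open_Times) auto

lemma space_base: "space base = pos_quadrant \<times> UNIV"
  by (simp add: base_def space_restrict_space)

lemma measurable_base: "f \<in> borel \<rightarrow>\<^sub>M N \<Longrightarrow> f \<in> base \<rightarrow>\<^sub>M N"
  unfolding base_def by (intro measurable_restrict_space1) simp

lemma measurable_base_borel: "f \<in> M \<rightarrow>\<^sub>M base \<Longrightarrow> f \<in> M \<rightarrow>\<^sub>M borel"
  using measurable_compose[OF _ measurable_base[of "\<lambda>x. x" borel]] by simp

lemma measurable_base_ident [measurable]: "(\<lambda>x. x) \<in> base \<rightarrow>\<^sub>M borel"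
  by (rule measurable_base) simp

lemma measurable_base_pair [measurable]:
  "fst \<in> base \<Otimes>\<^sub>M base \<rightarrow>\<^sub>M borel" "snd \<in> base \<Otimes>\<^sub>M base \<rightarrow>\<^sub>M borel"
  by (auto intro: measurable_base_borel)

interpretation base: sigma_finite_measure "base :: 'k::finite state measure"
  unfolding base_def
  by (rule sigma_finite_measure_restrict_space[OF lborel.sigma_finite_measure_axioms])
    (simp add: base_domain_sets)

text \<open>For an integrand vanishing off the quadrant the restriction is immaterial, so Fubini for
  full Lebesgue measure is available in both orders: \<lambda> outermost for the kernel, \<xi>
  outermost for invariance.\<close>

lemma nn_integral_base:
  assumes F: "F \<in> borel_measurable borel" and off: "\<And>l \<xi>. l \<notin> pos_quadrant \<Longrightarrow> F (l, \<xi>) = 0"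
  shows "(\<integral>\<^sup>+z. F z \<partial>(base :: 'k::finite state measure)) = (\<integral>\<^sup>+l. \<integral>\<^sup>+\<xi>. F (l, \<xi>) \<partial>lborel \<partial>lborel)" (is ?T1)
    and "(\<integral>\<^sup>+z. F z \<partial>(base :: 'k::finite state measure)) = (\<integral>\<^sup>+\<xi>. \<integral>\<^sup>+l. F (l, \<xi>) \<partial>lborel \<partial>lborel)" (is ?T2)
proof -
  have Fm: "F \<in> borel_measurable (lborel \<Otimes>\<^sub>M lborel)" using F by (simp add: lborel_prod)
  have "(\<integral>\<^sup>+z. F z \<partial>base) = (\<integral>\<^sup>+z. F z * indicator (pos_quadrant \<times> UNIV) z \<partial>lborel)"
    unfolding base_def by (intro nn_integral_restrict_space) (simp add: base_domain_sets)
  also have "\<dots> = (\<integral>\<^sup>+z. F z \<partial>lborel)"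
    using off by (intro nn_integral_cong) (auto simp: indicator_def split: prod.splits)
  finally have *: "(\<integral>\<^sup>+z. F z \<partial>base) = (\<integral>\<^sup>+z. F z \<partial>(lborel \<Otimes>\<^sub>M lborel))" by (simp add: lborel_prod)
  show ?T1 unfolding * by (rule lborel.nn_integral_fst[OF Fm, symmetric])
  show ?T2 unfolding * by (rule lborel_pair.nn_integral_snd[OF Fm, symmetric])
qed

lemma nn_integral_lborel_pair_mult:
  fixes g h :: "real \<Rightarrow> ennreal"
  assumes [measurable]: "g \<in> borel_measurable borel" "h \<in> borel_measurable borel"
  shows "(\<integral>\<^sup>+l. g (fst l) * h (snd l) \<partial>lborel) = (\<integral>\<^sup>+x. g x \<partial>lborel) * (\<integral>\<^sup>+x. h x \<partial>lborel)"
proof -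
  have "(\<integral>\<^sup>+l. g (fst l) * h (snd l) \<partial>lborel) = (\<integral>\<^sup>+l. g (fst l) * h (snd l) \<partial>(lborel \<Otimes>\<^sub>M lborel))"
    by (simp add: lborel_prod)
  also have "\<dots> = (\<integral>\<^sup>+x. \<integral>\<^sup>+y. g x * h y \<partial>lborel \<partial>lborel)"
    by (subst lborel.nn_integral_fst[symmetric]) auto
  finally show ?thesis by (simp add: nn_integral_cmult nn_integral_multc)
qed

lemma lambda_density_nonneg:
  assumes "0 < a1" "0 < a2" shows "0 \<le> lambda_density a1 b1 a2 b2 ms y \<xi> l"
  unfolding lambda_density_def using assms
  by (intro mult_nonneg_nonneg gamma_density_nonneg) (auto simp: add_nonneg_pos)

lemma lambda_density_off: "l \<notin> pos_quadrant \<Longrightarrow> lambda_density a1 b1 a2 b2 ms y \<xi> l = 0"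
  by (cases l) (auto simp: lambda_density_def gamma_density_def)

lemma theta_of_measurable [measurable]:
  "f \<in> M \<rightarrow>\<^sub>M borel \<Longrightarrow> (\<lambda>x. theta_of (f x) $ i) \<in> borel_measurable M"
  unfolding theta_of_def vec_lambda_beta by (rule vec_nth_measurable)

lemma mu_of_measurable [measurable]:
  "f \<in> M \<rightarrow>\<^sub>M borel \<Longrightarrow> (\<lambda>x. mu_of (f x)) \<in> borel_measurable M"
  unfolding mu_of_def by (rule vec_nth_measurable)

lemma v1_measurable [measurable]:
  assumes [measurable]: "f \<in> M \<rightarrow>\<^sub>M borel"
  shows "(\<lambda>x. v1 (theta_of (f x)) (mu_of (f x))) \<in> borel_measurable M"
  unfolding v1_def by measurable

lemma v2_measurable [measurable]:
  assumes [measurable]: "f \<in> M \<rightarrow>\<^sub>M borel"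
  shows "(\<lambda>x. v2 ms y (theta_of (f x))) \<in> borel_measurable M"
  unfolding v2_def by measurable

lemma lambda_density_measurable [measurable]:
  assumes [measurable]: "f \<in> M \<rightarrow>\<^sub>M borel" "g \<in> M \<rightarrow>\<^sub>M borel"
  shows "(\<lambda>x. lambda_density a1 b1 a2 b2 ms y (f x) (g x)) \<in> borel_measurable M"
  unfolding lambda_density_def by measurable

lemma xi_density_measurable [measurable]:
  assumes [measurable]: "f \<in> M \<rightarrow>\<^sub>M borel" "h \<in> M \<rightarrow>\<^sub>M borel"
  shows "(\<lambda>x. xi_density s0 m0 ms y (f x) (h x)) \<in> borel_measurable M"
  using xi_density_pair_measurable[of "\<lambda>x. fst (f x)" M "\<lambda>x. snd (f x)" h] by simp

locale random_effects =
  fixes a1 b1 a2 b2 s0 m0 :: real and ms :: "'k::finite \<Rightarrow> nat" and y :: "'k \<Rightarrow> nat \<Rightarrow> real"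
  assumes pos: "0 < a1" "0 < b1" "0 < a2" "0 < b2" "0 < s0" and ms_pos: "\<And>i. 0 < ms i"
begin

abbreviation "lam \<equiv> lambda_density a1 b1 a2 b2 ms y"
abbreviation "xid \<equiv> xi_density s0 m0 ms y"
abbreviation "joint \<equiv> joint_density a1 b1 a2 b2 s0 m0 ms y"
abbreviation "gibbs \<equiv> gibbs_kernel a1 b1 a2 b2 s0 m0 ms y"
abbreviation "post \<equiv> posterior a1 b1 a2 b2 s0 m0 ms y"

definition trans_density :: "'k state \<Rightarrow> 'k state \<Rightarrow> real" where
  "trans_density z z' = lam (snd z) (fst z') * xid (fst z') (snd z')"

lemma lam_nonneg: "0 \<le> lam \<xi> l" using pos by (intro lambda_density_nonneg)

lemma trans_density_measurable [measurable]:
  assumes [measurable]: "f \<in> M \<rightarrow>\<^sub>M borel" "g \<in> M \<rightarrow>\<^sub>M borel"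
  shows "(\<lambda>x. trans_density (f x) (g x)) \<in> borel_measurable M"
  unfolding trans_density_def
  by (intro borel_measurable_times lambda_density_measurable xi_density_measurable) measurable

lemma gibbs_density_eq:
  assumes "z' \<in> space base"
  shows "gibbs_density a1 b1 a2 b2 s0 m0 ms y z z' = trans_density z z'"
  using assms pos
  by (auto simp: gibbs_density_def trans_density_def lambda_density_def space_base mvn_density_eq_xi_density
      split: prod.splits)

text \<open>The defining density contains a matrix inverse and a determinant. It agrees with the
  regression form on \<open>space base\<close> and inherits measurability from it.\<close>

lemma kernel_eq: "gibbs z = density base (\<lambda>z'. ennreal (trans_density z z'))"
proof -
  have "(\<lambda>z'. ennreal (gibbs_density a1 b1 a2 b2 s0 m0 ms y z z')) \<in> borel_measurable base
    \<longleftrightarrow> (\<lambda>z'. ennreal (trans_density z z')) \<in> borel_measurable base"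
    by (intro measurable_cong) (simp add: gibbs_density_eq)
  then show ?thesis unfolding gibbs_kernel_def
    by (intro density_cong) (auto simp: gibbs_density_eq intro!: measurable_base)
qed

lemma nn_integral_kernel:
  "f \<in> borel_measurable base \<Longrightarrow> (\<integral>\<^sup>+z'. f z' \<partial>gibbs z) = (\<integral>\<^sup>+z'. ennreal (trans_density z z') * f z' \<partial>base)"
  unfolding kernel_eq by (intro nn_integral_density) (auto intro!: measurable_base)

lemma gamma_parameters_pos:
  "0 < real CARD('k) / 2 + a1" "0 < v1 (theta_of \<xi>) (mu_of (\<xi> :: real^'k option)) / 2 + b1"
  "0 < real (obs_total ms) / 2 + a2" "0 < (v2 ms y (theta_of \<xi>) + SSE ms y) / 2 + b2"
  using pos v1_nonneg[of "theta_of \<xi>" "mu_of \<xi>"] v2_nonneg[of ms y "theta_of \<xi>"] SSE_nonneg[of ms y]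
  by (auto intro!: add_nonneg_pos)

lemma nn_integral_lam: "(\<integral>\<^sup>+l. ennreal (lam \<xi> l) \<partial>lborel) = 1"
  unfolding lambda_density_def
  using gamma_parameters_pos
    nn_integral_lborel_pair_mult[of
      "\<lambda>x. ennreal (gamma_density (real CARD('k) / 2 + a1) (v1 (theta_of \<xi>) (mu_of \<xi>) / 2 + b1) x)"
      "\<lambda>x. ennreal (gamma_density (real (obs_total ms) / 2 + a2) ((v2 ms y (theta_of \<xi>) + SSE ms y) / 2 + b2) x)"]
  by (simp add: ennreal_mult gamma_density_nonneg nn_integral_gamma_density)

lemma nn_integral_kernel_iterated:
  assumes f [measurable]: "f \<in> borel_measurable borel"
  shows "(\<integral>\<^sup>+z'. f z' \<partial>gibbs z)
    = (\<integral>\<^sup>+l. ennreal (lam (snd z) l) * (\<integral>\<^sup>+\<xi>. ennreal (xid l \<xi>) * f (l, \<xi>) \<partial>lborel) \<partial>lborel)"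
proof -
  have "(\<integral>\<^sup>+z'. f z' \<partial>gibbs z) = (\<integral>\<^sup>+z'. ennreal (trans_density z z') * f z' \<partial>base)"
    by (intro nn_integral_kernel measurable_base f)
  also have "\<dots> = (\<integral>\<^sup>+l. \<integral>\<^sup>+\<xi>. ennreal (trans_density z (l, \<xi>)) * f (l, \<xi>) \<partial>lborel \<partial>lborel)"
    by (rule nn_integral_base(1), measurable, simp add: trans_density_def lambda_density_off)
  also have "\<dots> = (\<integral>\<^sup>+l. ennreal (lam (snd z) l) * (\<integral>\<^sup>+\<xi>. ennreal (xid l \<xi>) * f (l, \<xi>) \<partial>lborel) \<partial>lborel)"
  proof (rule nn_integral_cong)
    fix l
    have fm [measurable]: "(\<lambda>\<xi>. f (l, \<xi>)) \<in> borel_measurable borel"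
      by (rule measurable_compose[OF _ f]) (auto intro!: borel_measurable_continuous_onI continuous_intros)
    have "(\<integral>\<^sup>+\<xi>. ennreal (trans_density z (l, \<xi>)) * f (l, \<xi>) \<partial>lborel)
      = (\<integral>\<^sup>+\<xi>. ennreal (lam (snd z) l) * (ennreal (xid l \<xi>) * f (l, \<xi>)) \<partial>lborel)"
      by (simp add: trans_density_def ennreal_mult lam_nonneg xi_density_nonneg mult.assoc)
    also have "\<dots> = ennreal (lam (snd z) l) * (\<integral>\<^sup>+\<xi>. ennreal (xid l \<xi>) * f (l, \<xi>) \<partial>lborel)"
      by (rule nn_integral_cmult) measurable
    finally show "(\<integral>\<^sup>+\<xi>. ennreal (trans_density z (l, \<xi>)) * f (l, \<xi>) \<partial>lborel)
      = ennreal (lam (snd z) l) * (\<integral>\<^sup>+\<xi>. ennreal (xid l \<xi>) * f (l, \<xi>) \<partial>lborel)"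
      .
  qed
  finally show ?thesis .
qed

lemma nn_integral_lam_mult_cong:
  assumes "\<And>l. l \<in> pos_quadrant \<Longrightarrow> g l = h l"
  shows "(\<integral>\<^sup>+l. ennreal (lam \<xi> l) * g l \<partial>lborel) = (\<integral>\<^sup>+l. ennreal (lam \<xi> l) * h l \<partial>lborel)"
proof (rule nn_integral_cong)
  fix l show "ennreal (lam \<xi> l) * g l = ennreal (lam \<xi> l) * h l"
    using assms[of l] lambda_density_off[of l a1 b1 a2 b2 ms y \<xi>] by (cases "l \<in> pos_quadrant") auto
qed

lemma kernel_space: "sets (gibbs z) = sets base" "space (gibbs z) = space base"
  by (auto simp: kernel_eq)

lemma prob_space_kernel: "prob_space (gibbs z)"
proof
  have "emeasure (gibbs z) (space (gibbs z)) = (\<integral>\<^sup>+z'. 1 \<partial>gibbs z)" by simp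
  also have "\<dots> = (\<integral>\<^sup>+l. ennreal (lam (snd z) l) * (\<integral>\<^sup>+\<xi>. ennreal (xid l \<xi>) * 1 \<partial>lborel) \<partial>lborel)"
    by (rule nn_integral_kernel_iterated) simp
  also have "\<dots> = (\<integral>\<^sup>+l. ennreal (lam (snd z) l) * 1 \<partial>lborel)"
    using pos by (intro nn_integral_lam_mult_cong) (auto simp: nn_integral_xi_density)
  finally show "emeasure (gibbs z) (space (gibbs z)) = 1" by (simp add: nn_integral_lam)
qed

lemma measurable_kernel: "gibbs \<in> base \<rightarrow>\<^sub>M prob_algebra base"
proof (rule measurable_prob_algebraI[OF prob_space_kernel measurable_subprob_algebra])
  fix A :: "'k state set" assume A: "A \<in> sets base"
  have "emeasure (gibbs z) A = (\<integral>\<^sup>+z'. ennreal (trans_density z z') * indicator A z' \<partial>base)" for z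
    using A by (simp add: kernel_eq emeasure_density measurable_base)
  moreover have "(\<lambda>z. \<integral>\<^sup>+z'. ennreal (trans_density z z') * indicator A z' \<partial>base) \<in> borel_measurable base"
    using A by measurable
  ultimately show "(\<lambda>z. emeasure (gibbs z) A) \<in> borel_measurable base" by simp
qed (auto simp: kernel_space prob_space_imp_subprob_space prob_space_kernel)

section \<open>Invariance and normalization of the posterior\<close>

lemma joint_off: "l \<notin> pos_quadrant \<Longrightarrow> joint (l, \<xi>) = 0"
  by (cases l) (auto simp: joint_density_def gamma_density_def)

lemma joint_nonneg: "0 \<le> joint z" using pos by (simp add: joint_density_nonneg)

lemma joint_measurable [measurable]:
  assumes [measurable]: "f \<in> M \<rightarrow>\<^sub>M borel"
  shows "(\<lambda>x. joint (f x)) \<in> borel_measurable M"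
  unfolding joint_density_def case_prod_beta by measurable

text \<open>The joint density factors both through the conditional of \<open>\<lambda>\<close> and through that of
  \<open>\<xi>\<close>, which is what makes it invariant under the two-block update.\<close>

lemma joint_marginal_lam:
  "ennreal (joint (l, \<xi>)) = (\<integral>\<^sup>+l'. ennreal (joint (l', \<xi>)) \<partial>lborel) * ennreal (lam \<xi> l)"
proof -
  obtain c where c: "0 \<le> c" "\<And>s e. 0 < s \<Longrightarrow> 0 < e \<Longrightarrow> joint ((s, e), \<xi>) = c * lam \<xi> (s, e)"
    
    by (rule joint_density_lambda_factor[where ms=ms and y=y and \<xi>=\<xi> and ?m0.0=m0, OF pos ms_pos]) (rule that)
  have eq: "joint (l, \<xi>) = c * lam \<xi> l" for l
    using c(2)[of "fst l" "snd l"] joint_off[of l \<xi>] lambda_density_off[of l a1 b1 a2 b2 ms y \<xi>]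
    by (cases "l \<in> pos_quadrant") (auto simp: mem_Times_iff)
  have "(\<integral>\<^sup>+l'. ennreal (joint (l', \<xi>)) \<partial>lborel) = ennreal c * (\<integral>\<^sup>+l'. ennreal (lam \<xi> l') \<partial>lborel)"
    unfolding eq using c(1) by (subst nn_integral_cmult[symmetric]) (auto simp: ennreal_mult lam_nonneg)
  then show ?thesis using c(1) by (simp add: eq nn_integral_lam ennreal_mult lam_nonneg)
qed

lemma joint_marginal_xi:
  assumes l: "l \<in> pos_quadrant"
  shows "ennreal (joint (l, \<xi>)) = (\<integral>\<^sup>+\<xi>'. ennreal (joint (l, \<xi>')) \<partial>lborel) * ennreal (xid l \<xi>)"
proof -
  obtain s e where le: "l = (s, e)" "0 < s" "0 < e" using l by auto
  obtain c where c: "0 \<le> c" "\<And>\<xi>. joint (l, \<xi>) = c * xid l \<xi>"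
    by (rule joint_density_xi_factor[where ms=ms and y=y and ?m0.0=m0 and ?b1.0=b1 and ?b2.0=b2, OF pos(1,3,5) ms_pos le(2,3)]) (rule that, assumption, simp only: le(1))
  have "(\<integral>\<^sup>+\<xi>'. ennreal (joint (l, \<xi>')) \<partial>lborel) = ennreal c * (\<integral>\<^sup>+\<xi>'. ennreal (xid l \<xi>') \<partial>lborel)"
    unfolding c(2) using c(1) by (subst nn_integral_cmult[symmetric]) (auto simp: ennreal_mult xi_density_nonneg)
  then show ?thesis using c le pos by (simp add: nn_integral_xi_density ennreal_mult xi_density_nonneg)
qed

text \<open>The transition ignores the old precisions, so they are integrated out first. The
  remaining marginal times \<open>lam\<close> is the joint density at the new precisions and the old
  \<xi>; integrating that \<xi> out and multiplying by \<open>xid\<close> restores the joint density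
  once more.\<close>

lemma joint_invariant:
  assumes z': "z' \<in> space base"
  shows "(\<integral>\<^sup>+z. ennreal (joint z) * ennreal (trans_density z z') \<partial>base) = ennreal (joint z')"
proof -
  obtain l \<xi> where z: "z' = (l, \<xi>)" "l \<in> pos_quadrant" using z' by (cases z') (auto simp: space_base)
  have "(\<integral>\<^sup>+z. ennreal (joint z) * ennreal (trans_density z z') \<partial>base)
    = (\<integral>\<^sup>+\<xi>'. \<integral>\<^sup>+l'. ennreal (joint (l', \<xi>')) * ennreal (trans_density (l', \<xi>') z') \<partial>lborel \<partial>lborel)"
    by (rule nn_integral_base(2), measurable, simp add: joint_off)
  also have "\<dots> = (\<integral>\<^sup>+\<xi>'. ennreal (joint (l, \<xi>')) * ennreal (xid l \<xi>) \<partial>lborel)"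
  proof (rule nn_integral_cong)
    fix \<xi>'
    have "(\<integral>\<^sup>+l'. ennreal (joint (l', \<xi>')) * ennreal (trans_density (l', \<xi>') z') \<partial>lborel)
      = (\<integral>\<^sup>+l'. ennreal (joint (l', \<xi>')) * ennreal (lam \<xi>' l * xid l \<xi>) \<partial>lborel)"
      by (simp add: trans_density_def z)
    also have "\<dots> = (\<integral>\<^sup>+l'. ennreal (joint (l', \<xi>')) \<partial>lborel) * ennreal (lam \<xi>' l * xid l \<xi>)"
      by (rule nn_integral_multc) measurable
    also have "\<dots> = (\<integral>\<^sup>+l'. ennreal (joint (l', \<xi>')) \<partial>lborel) * ennreal (lam \<xi>' l) * ennreal (xid l \<xi>)"
      by (simp only: ennreal_mult[OF lam_nonneg xi_density_nonneg] mult.assoc)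
    also have "\<dots> = ennreal (joint (l, \<xi>')) * ennreal (xid l \<xi>)"
      by (simp only: joint_marginal_lam[of l \<xi>', symmetric])
    finally show "(\<integral>\<^sup>+l'. ennreal (joint (l', \<xi>')) * ennreal (trans_density (l', \<xi>') z') \<partial>lborel)
      = ennreal (joint (l, \<xi>')) * ennreal (xid l \<xi>)" .
  qed
  also have "\<dots> = (\<integral>\<^sup>+\<xi>'. ennreal (joint (l, \<xi>')) \<partial>lborel) * ennreal (xid l \<xi>)"
    by (rule nn_integral_multc) measurable
  also have "\<dots> = ennreal (joint (l, \<xi>))" by (rule joint_marginal_xi[OF z(2), symmetric])
  finally show ?thesis by (simp add: z)
qed

text \<open>The exponential carrying the data is at most one. What is left is the prior times a
  power of \<open>e\<close>, and a Gamma law has finite moments of every positive order.\<close>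

lemma nn_integral_joint_finite: "(\<integral>\<^sup>+z. ennreal (joint z) \<partial>base) < \<infinity>"
proof -
  let ?M = "obs_total ms"
  define C where "C = 1 / sqrt (2 * pi) ^ ?M"
  \<comment> \<open>The prior law of \<xi> given the first precision.\<close>
  define H where "H l = hier_density m0 (1 / sqrt s0) (\<lambda>_ u. u) (\<lambda>_::'k. 1 / sqrt (fst l))" for l :: "real \<times> real"
  define g where "g e = ennreal (C * (e powr (real ?M / 2) * gamma_density a2 b2 e))" for e
  define h where "h s = ennreal (gamma_density a1 b1 s)" for s
  have bound: "ennreal (joint (l, \<xi>)) \<le> h (fst l) * g (snd l) * ennreal (H l \<xi>)" if "l \<in> pos_quadrant" for l \<xi>
  proof -
    obtain s e where l: "l = (s, e)" "0 < s" "0 < e" using \<open>l \<in> pos_quadrant\<close> by (cases l) auto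
    have H: "sqrt (s / (2 * pi)) ^ CARD('k) * exp (- (s * v1 (theta_of \<xi>) (mu_of \<xi>) / 2)) * normal_density m0 (1 / sqrt s0) (mu_of \<xi>)
      = H l \<xi>"
      using l prod_normal_density_precision[of s UNIV "\<lambda>_::'k. mu_of \<xi>" "\<lambda>i. theta_of \<xi> $ i"]
      by (simp add: H_def hier_density_def mu_of_def theta_of_def v1_def)
    have "sqrt (e / (2 * pi)) ^ ?M = C * e powr (real ?M / 2)"
      using l by (simp add: C_def real_sqrt_divide power_divide powr_half_sqrt[symmetric] powr_realpow[symmetric] powr_powr)
    then have "joint (l, \<xi>) = exp (- (e * (v2 ms y (theta_of \<xi>) + SSE ms y) / 2))
      * (gamma_density a1 b1 s * (C * (e powr (real ?M / 2) * gamma_density a2 b2 e)) * H l \<xi>)"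
      unfolding l(1) joint_density_explicit[OF pos(5) l(2,3) ms_pos] H[symmetric, unfolded l(1)] by (simp only: mult_ac)
    also have "\<dots> \<le> 1 * (gamma_density a1 b1 s * (C * (e powr (real ?M / 2) * gamma_density a2 b2 e)) * H l \<xi>)"
      using l pos v2_nonneg[of ms y "theta_of \<xi>"] SSE_nonneg[of ms y]
      by (intro mult_right_mono) (auto simp: C_def H_def hier_density_nonneg gamma_density_nonneg)
    finally have "joint (l, \<xi>) \<le> gamma_density a1 b1 s * (C * (e powr (real ?M / 2) * gamma_density a2 b2 e)) * H l \<xi>" by simp
    then show ?thesis
      using pos by (simp add: l g_def h_def C_def H_def hier_density_nonneg gamma_density_nonneg ennreal_leI flip: ennreal_mult)
  qed
  have "(\<integral>\<^sup>+z. ennreal (joint z) \<partial>base) = (\<integral>\<^sup>+l. \<integral>\<^sup>+\<xi>. ennreal (joint (l, \<xi>)) \<partial>lborel \<partial>lborel)"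
    by (rule nn_integral_base(1), measurable, simp add: joint_off)
  also have "\<dots> \<le> (\<integral>\<^sup>+l. h (fst l) * g (snd l) \<partial>lborel)"
  proof (rule nn_integral_mono)
    fix l
    show "(\<integral>\<^sup>+\<xi>. ennreal (joint (l, \<xi>)) \<partial>lborel) \<le> h (fst l) * g (snd l)"
    proof (cases "l \<in> pos_quadrant")
      case True
      have Hm: "H l \<in> borel_measurable borel" unfolding H_def hier_density_def[abs_def] by measurable
      have "(\<integral>\<^sup>+\<xi>. ennreal (joint (l, \<xi>)) \<partial>lborel) \<le> (\<integral>\<^sup>+\<xi>. h (fst l) * g (snd l) * ennreal (H l \<xi>) \<partial>lborel)"
        by (intro nn_integral_mono bound True)
      also have "\<dots> = h (fst l) * g (snd l) * (\<integral>\<^sup>+\<xi>. ennreal (H l \<xi>) \<partial>lborel)"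
        using Hm by (intro nn_integral_cmult) simp
      also have "(\<integral>\<^sup>+\<xi>. ennreal (H l \<xi>) \<partial>lborel) = 1"
        unfolding H_def using True pos by (intro nn_integral_hier_density) auto
      finally show ?thesis by simp
    qed (simp add: joint_off)
  qed
  also have "\<dots> = (\<integral>\<^sup>+s. h s \<partial>lborel) * (\<integral>\<^sup>+e. g e \<partial>lborel)"
    unfolding h_def g_def by (rule nn_integral_lborel_pair_mult) auto
  also have "(\<integral>\<^sup>+s. h s \<partial>lborel) = 1" unfolding h_def using pos by (simp add: nn_integral_gamma_density)
  also have "(\<integral>\<^sup>+e. g e \<partial>lborel) = ennreal C * ennreal (Gamma (a2 + real ?M / 2) / (Gamma a2 * b2 powr (real ?M / 2)))"
  proof -
    have "(\<integral>\<^sup>+e. g e \<partial>lborel) = (\<integral>\<^sup>+e. ennreal C * ennreal (e powr (real ?M / 2) * gamma_density a2 b2 e) \<partial>lborel)"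
      unfolding g_def using pos by (intro nn_integral_cong ennreal_mult) (auto simp: C_def gamma_density_nonneg)
    then show ?thesis using pos by (simp add: nn_integral_cmult nn_integral_gamma_density_powr)
  qed
  finally show ?thesis by (simp add: ennreal_mult_less_top le_less_trans)
qed

text \<open>The joint density is positive on a nonempty open set, which is not negligible. This
  makes the division in \<open>posterior\<close> a genuine normalization.\<close>

lemma nn_integral_joint_nonzero: "(\<integral>\<^sup>+z. ennreal (joint z) \<partial>base) \<noteq> 0"
proof
  assume "(\<integral>\<^sup>+z. ennreal (joint z) \<partial>base) = 0"
  then have zero: "AE z in base. ennreal (joint z) = 0"
    by (subst (asm) nn_integral_0_iff_AE) (auto intro!: measurable_base)
  have nz: "joint z \<noteq> 0" if "z \<in> space base" for z
  proof -
    obtain s e \<xi> where z: "z = ((s, e), \<xi>)" "0 < s" "0 < e"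
      using \<open>z \<in> space base\<close> by (cases z) (auto simp: space_base)
    have G: "Gamma a1 \<noteq> 0" "Gamma a2 \<noteq> 0"
      using Gamma_real_pos[OF pos(1)] Gamma_real_pos[OF pos(3)] by linarith+
    have "0 < normal_density m0 (1 / sqrt s0) (mu_of \<xi>)" using pos by (intro normal_density_pos) simp
    then show ?thesis
      unfolding z(1) joint_density_explicit[OF pos(5) z(2,3) ms_pos] gamma_density_def using z G pos by simp
  qed
  have "AE z in (base :: 'k state measure). False"
  proof (rule AE_mp[OF zero], rule AE_I2, rule impI)
    fix z :: "'k state" assume "z \<in> space base" "ennreal (joint z) = 0"
    then show False using nz[of z] joint_nonneg[of z] by (simp add: ennreal_eq_0_iff)
  qed
  then have "emeasure base (space (base :: 'k state measure)) = 0" by (simp add: AE_iff_measurable[OF sets.top])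
  then have "emeasure lborel (pos_quadrant \<times> (UNIV :: (real^'k option) set)) = 0"
    unfolding space_base base_def by (subst (asm) emeasure_restrict_space) (auto simp: base_domain_sets)
  then have "pos_quadrant \<times> (UNIV :: (real^'k option) set) \<in> null_sets lborel"
    using base_domain_sets by (auto simp: null_sets_def)
  then have "negligible (pos_quadrant \<times> (UNIV :: (real^'k option) set))"
    by (simp add: negligible_iff_null_sets null_sets_completionI)
  moreover have "\<not> negligible (pos_quadrant \<times> (UNIV :: (real^'k option) set))"
    by (rule open_not_negligible) (auto intro!: open_Times exI[of _ 1])
  ultimately show False by simp
qed

definition norm_const :: real where "norm_const = (\<integral>z. joint z \<partial>base)"

lemma norm_const: "0 < norm_const" "(\<integral>\<^sup>+z. ennreal (joint z) \<partial>base) = ennreal norm_const"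
proof -
  have "integrable base joint"
    using nn_integral_joint_finite joint_nonneg
    by (intro integrableI_nonneg) (auto intro!: measurable_base)
  then show eq: "(\<integral>\<^sup>+z. ennreal (joint z) \<partial>base) = ennreal norm_const"
    unfolding norm_const_def using joint_nonneg by (intro nn_integral_eq_integral) auto
  then show "0 < norm_const" using nn_integral_joint_nonzero by (metis ennreal_eq_0_iff not_less)
qed

lemma post_eq: "post = density base (\<lambda>z. ennreal (1 / norm_const) * ennreal (joint z))"
  unfolding posterior_def norm_const_def[symmetric]
  using norm_const(1) by (simp add: joint_nonneg flip: ennreal_mult)

lemma sets_post: "sets post = sets base" by (simp add: post_eq)

lemma prob_space_post: "prob_space post"
proof
  have "emeasure post (space post) = (\<integral>\<^sup>+z. ennreal (1 / norm_const) * ennreal (joint z) \<partial>base)"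
    unfolding post_eq by (subst emeasure_density) (auto intro!: measurable_base nn_integral_cong)
  also have "\<dots> = 1"
    using norm_const by (subst nn_integral_cmult) (auto intro!: measurable_base simp flip: ennreal_mult)
  finally show "emeasure post (space post) = 1" .
qed

lemma post_stationary: "post \<bind> gibbs = post"
proof (rule measure_eqI)
  have K: "gibbs \<in> post \<rightarrow>\<^sub>M subprob_algebra base"
    using measurable_prob_algebraD[OF measurable_kernel] measurable_cong_sets[OF sets_post refl] by blast
  have ne: "space post \<noteq> {}" using prob_space.not_empty[OF prob_space_post] .
  show sets: "sets (post \<bind> gibbs) = sets post"
    using ne by (simp add: sets_bind[OF kernel_space(1)] sets_post)
  fix A assume "A \<in> sets (post \<bind> gibbs)"
  then have A [measurable]: "A \<in> sets base" using sets sets_post by simp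
  let ?c = "ennreal (1 / norm_const)"
  have jm [measurable]: "(\<lambda>z. ennreal (joint z)) \<in> borel_measurable base" by measurable
  have "emeasure (post \<bind> gibbs) A = (\<integral>\<^sup>+z. emeasure (gibbs z) A \<partial>post)"
    using ne K A by (rule emeasure_bind)
  also have "\<dots> = (\<integral>\<^sup>+z. ?c * ennreal (joint z) * emeasure (gibbs z) A \<partial>base)"
    unfolding post_eq
    using measurable_compose[OF measurable_prob_algebraD[OF measurable_kernel] measurable_emeasure_subprob_algebra[OF A]]
    by (intro nn_integral_density) auto
  also have "\<dots> = (\<integral>\<^sup>+z. \<integral>\<^sup>+z'. ?c * ennreal (joint z) * (ennreal (trans_density z z') * indicator A z') \<partial>base \<partial>base)"
    by (intro nn_integral_cong) (simp add: kernel_eq emeasure_density nn_integral_cmult)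
  \<comment> \<open>The old state is moved to the inner integral, where
    \<open>joint_invariant\<close> applies.\<close>
  also have "\<dots> = (\<integral>\<^sup>+z'. \<integral>\<^sup>+z. ?c * ennreal (joint z) * (ennreal (trans_density z z') * indicator A z') \<partial>base \<partial>base)"
  proof -
    interpret pair_sigma_finite "base :: 'k state measure" "base :: 'k state measure" ..
    show ?thesis by (rule Fubini'[symmetric]) measurable
  qed
  also have "\<dots> = (\<integral>\<^sup>+z'. ?c * ennreal (joint z') * indicator A z' \<partial>base)"
  proof (rule nn_integral_cong)
    fix z' :: "'k state" assume z': "z' \<in> space base"
    have "(\<integral>\<^sup>+z. ?c * ennreal (joint z) * (ennreal (trans_density z z') * indicator A z') \<partial>base)
      = (\<integral>\<^sup>+z. (?c * indicator A z') * (ennreal (joint z) * ennreal (trans_density z z')) \<partial>base)"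
      by (simp only: mult_ac)
    also have "\<dots> = ?c * indicator A z' * (\<integral>\<^sup>+z. ennreal (joint z) * ennreal (trans_density z z') \<partial>base)"
      by (rule nn_integral_cmult) measurable
    also have "\<dots> = ?c * ennreal (joint z') * indicator A z'"
      unfolding joint_invariant[OF z'] by (simp only: mult_ac)
    finally show "(\<integral>\<^sup>+z. ?c * ennreal (joint z) * (ennreal (trans_density z z') * indicator A z') \<partial>base)
      = ?c * ennreal (joint z') * indicator A z'" .
  qed
  also have "\<dots> = emeasure post A" unfolding post_eq by (simp add: emeasure_density)
  finally show "emeasure (post \<bind> gibbs) A = emeasure post A" .
qed

end

section \<open>The balanced case\<close>

text \<open>Pointwise minimum of the gamma densities with rates in \<open>{\<beta>..\<beta> + D}\<close>.\<close>

definition gamma_min :: "real \<Rightarrow> real \<Rightarrow> real \<Rightarrow> real \<Rightarrow> real" where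
  "gamma_min \<alpha> \<beta> D x = (if x < \<alpha> / D * ln (1 + D / \<beta>)
     then gamma_density \<alpha> \<beta> x else gamma_density \<alpha> (\<beta> + D) x)"

lemma gamma_min_le:
  "0 < \<alpha> \<Longrightarrow> 0 < \<beta> \<Longrightarrow> 0 \<le> v \<Longrightarrow> v \<le> D \<Longrightarrow> 0 < D \<Longrightarrow> gamma_min \<alpha> \<beta> D x \<le> gamma_density \<alpha> (\<beta> + v) x"
  unfolding gamma_min_def by (rule gamma_density_endpoint_le)

lemma gamma_min_nonneg: "0 < \<alpha> \<Longrightarrow> 0 \<le> gamma_min \<alpha> \<beta> D x"
  by (simp add: gamma_min_def gamma_density_nonneg)

lemma gamma_min_measurable [measurable]:
  assumes [measurable]: "f \<in> borel_measurable M"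
  shows "(\<lambda>x. gamma_min \<alpha> \<beta> D (f x)) \<in> borel_measurable M"
  unfolding gamma_min_def by measurable

lemma gamma_min_mass:
  assumes "0 < \<alpha>" "0 < \<beta>" "0 < D"
  shows "(\<integral>\<^sup>+x. ennreal (gamma_min \<alpha> \<beta> D x) \<partial>lborel) = ennreal (LINT x:{0<..}|lborel. gamma_min \<alpha> \<beta> D x)"
    and "0 \<le> (LINT x:{0<..}|lborel. gamma_min \<alpha> \<beta> D x)"
    and "(LINT x:{0<..}|lborel. gamma_min \<alpha> \<beta> D x) \<le> 1"
proof -
  have eq: "(LINT x:{0<..}|lborel. gamma_min \<alpha> \<beta> D x) = (\<integral>x. gamma_min \<alpha> \<beta> D x \<partial>lborel)"
    unfolding set_lebesgue_integral_def
    by (intro Bochner_Integration.integral_cong) (auto simp: gamma_min_def gamma_density_def indicator_def)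
  \<comment> \<open>The case \<open>v = 0\<close> of the endpoint bound: the minimum lies below the
    density with rate \<beta>, so its mass is at most one.\<close>
  have "(\<integral>\<^sup>+x. ennreal (gamma_min \<alpha> \<beta> D x) \<partial>lborel) \<le> (\<integral>\<^sup>+x. ennreal (gamma_density \<alpha> \<beta> x) \<partial>lborel)"
    using gamma_min_le[of \<alpha> \<beta> 0 D] assms by (intro nn_integral_mono ennreal_leI) auto
  then have le1: "(\<integral>\<^sup>+x. ennreal (gamma_min \<alpha> \<beta> D x) \<partial>lborel) \<le> 1"
    using assms by (simp add: nn_integral_gamma_density)
  then have "integrable lborel (gamma_min \<alpha> \<beta> D)"
    using assms le_less_trans[OF le1] by (intro integrableI_nonneg AE_I2) (auto simp: gamma_min_nonneg)
  then show int: "(\<integral>\<^sup>+x. ennreal (gamma_min \<alpha> \<beta> D x) \<partial>lborel) = ennreal (LINT x:{0<..}|lborel. gamma_min \<alpha> \<beta> D x)"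
    unfolding eq using assms by (intro nn_integral_eq_integral AE_I2) (auto simp: gamma_min_nonneg)
  show "0 \<le> (LINT x:{0<..}|lborel. gamma_min \<alpha> \<beta> D x)"
    unfolding eq using assms by (intro integral_nonneg_AE AE_I2) (auto simp: gamma_min_nonneg)
  show "(LINT x:{0<..}|lborel. gamma_min \<alpha> \<beta> D x) \<le> 1"
    using le1 unfolding int by simp
qed

section \<open>Elementary inequalities behind the drift constants\<close>

lemma variance_bound:
  fixes s e m K \<phi> s0 :: real
  assumes pos: "0 < s" "0 < e" "0 < m" "0 < K" "0 < \<phi>" "0 < s0"
  shows "K * ((\<phi> * (1 - s / (s + m * e))\<^sup>2 + (s / (s + m * e))\<^sup>2) / (s0 + K * (m * s * e / (s + m * e))) + (\<phi> + 1) / (s + m * e))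
    \<le> \<phi> / s + (\<phi> * K + K + 1) / (m * e)"
proof -
  define x where "x = m * e"
  define D where "D = s + x"
  have x: "0 < x" using pos by (simp add: x_def)
  have D: "0 < D" "x \<le> D" "s \<le> D" using pos x by (auto simp: D_def)
  have w: "1 - s / D = x / D" using D by (simp add: D_def field_simps)
  have q: "0 \<le> \<phi> * (x / D)\<^sup>2 + (s / D)\<^sup>2" using pos by simp
  have t: "0 < K * (s * x / D)" using pos x D by simp
  \<comment> \<open>Dropping \<open>s0\<close> from the precision of \<mu> makes the quotient
    collapse to \<open>\<phi> * (x / D) / s + (s / D) / x\<close>. It yields
    \<open>\<phi> / s\<close> and the \<open>+ 1\<close> in \<open>\<phi> * K + K + 1\<close>; the
    rest of that coefficient is leaf noise.\<close>
  have "K * ((\<phi> * (x / D)\<^sup>2 + (s / D)\<^sup>2) / (s0 + K * (s * x / D))) \<le> K * ((\<phi> * (x / D)\<^sup>2 + (s / D)\<^sup>2) / (K * (s * x / D)))"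
    using pos q t by (intro mult_left_mono divide_left_mono mult_pos_pos[OF add_pos_pos t]) auto
  also have "\<dots> = \<phi> * (x / D) / s + (s / D) / x"
    using pos x D by (simp add: field_simps power2_eq_square)
  also have "\<dots> \<le> \<phi> * 1 / s + 1 / x"
    using pos x D by (intro add_mono divide_right_mono mult_left_mono) auto
  finally have 1: "K * ((\<phi> * (x / D)\<^sup>2 + (s / D)\<^sup>2) / (s0 + K * (s * x / D))) \<le> \<phi> / s + 1 / x" by simp
  have "K * ((\<phi> + 1) / D) \<le> K * ((\<phi> + 1) / x)"
    using pos x D by (intro mult_left_mono divide_left_mono) auto
  then have 2: "K * ((\<phi> + 1) / D) \<le> (\<phi> * K + K) / x" by (simp add: algebra_simps)
  have "m * s * e / (s + m * e) = s * x / D" by (simp add: D_def x_def mult_ac)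
  then have "K * ((\<phi> * (1 - s / (s + m * e))\<^sup>2 + (s / (s + m * e))\<^sup>2) / (s0 + K * (m * s * e / (s + m * e))) + (\<phi> + 1) / (s + m * e))
    = K * ((\<phi> * (x / D)\<^sup>2 + (s / D)\<^sup>2) / (s0 + K * (s * x / D))) + K * ((\<phi> + 1) / D)"
    using w by (simp add: D_def x_def distrib_left)
  also have "\<dots> \<le> \<phi> / s + (\<phi> * K + K + 1) / x" using 1 2 by (simp add: add_divide_distrib)
  finally show ?thesis by (simp add: x_def)
qed

text \<open>Convexity of the square. With weights \<open>tsum\<close> and \<open>s0\<close> the
  average is the conditional mean of \<mu>, between the grand mean and \<open>m0\<close>; hence the
  maxima in \<open>b\<close>.\<close>

lemma weighted_mean_square_le_max:
  fixes p q u v g :: real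
  assumes "0 < p" "0 \<le> q"
  shows "((q * u + p * v) / (p + q) - g)\<^sup>2 \<le> max ((u - g)\<^sup>2) ((v - g)\<^sup>2)"
proof -
  define a where "a = q / (p + q)"
  have a: "0 \<le> a" "a \<le> 1" and a': "1 - a = p / (p + q)" using assms by (auto simp: a_def field_simps)
  have "(q * u + p * v) / (p + q) = a * u + (1 - a) * v"
    unfolding a' by (simp add: a_def add_divide_distrib)
  then have "(q * u + p * v) / (p + q) - g = a * (u - g) + (1 - a) * (v - g)"
    by (simp only:) (simp add: algebra_simps)
  then have "((q * u + p * v) / (p + q) - g)\<^sup>2 = (a * (u - g) + (1 - a) * (v - g))\<^sup>2" by simp
  also have "\<dots> = a * (u - g)\<^sup>2 + (1 - a) * (v - g)\<^sup>2 - a * (1 - a) * ((u - g) - (v - g))\<^sup>2"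
    by (simp add: power2_eq_square algebra_simps)
  also have "\<dots> \<le> a * (u - g)\<^sup>2 + (1 - a) * (v - g)\<^sup>2" using a by simp
  also have "\<dots> \<le> a * max ((u - g)\<^sup>2) ((v - g)\<^sup>2) + (1 - a) * max ((u - g)\<^sup>2) ((v - g)\<^sup>2)"
    using a by (intro add_mono mult_left_mono) auto
  finally show ?thesis by (simp add: algebra_simps)
qed

text \<open>On the unit interval \<open>(1 - w)\<^sup>2 + w\<^sup>2\<close> is at most 1. Shrinkage
  with weight \<open>w\<close> divides the distance between a group mean and the conditional mean of
  \<mu> among the two parts of the drift function; this is the resulting coefficient.\<close>

lemma convex_square_coeff_le_max:
  fixes w \<phi> :: real
  assumes "0 \<le> w" "w \<le> 1" "0 < \<phi>"
  shows "\<phi> * (1 - w)\<^sup>2 + w\<^sup>2 \<le> max \<phi> 1"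
proof -
  have "\<phi> * (1 - w)\<^sup>2 + w\<^sup>2 \<le> max \<phi> 1 * (1 - w)\<^sup>2 + max \<phi> 1 * w\<^sup>2"
    using mult_right_mono[of 1 "max \<phi> 1" "w\<^sup>2"] by (intro add_mono mult_right_mono) auto
  also have "\<dots> = max \<phi> 1 * ((1 - w)\<^sup>2 + w\<^sup>2)" by (simp add: distrib_left)
  also have "\<dots> \<le> max \<phi> 1 * 1"
  proof (rule mult_left_mono)
    have "0 \<le> w * (1 - w)" using assms by simp
    then show "(1 - w)\<^sup>2 + w\<^sup>2 \<le> 1" by (simp add: power2_eq_square algebra_simps)
  qed simp
  finally show ?thesis by simp
qed

locale balanced_random_effects = random_effects a1 b1 a2 b2 s0 m0 ms y
  for a1 b1 a2 b2 s0 m0 :: real and ms :: "'k::finite \<Rightarrow> nat" and y :: "'k \<Rightarrow> nat \<Rightarrow> real" +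
  fixes m :: nat
  assumes balanced: "\<And>i. ms i = m" and m2: "2 \<le> m" and K3: "3 \<le> CARD('k)"
begin

abbreviation "gmean \<equiv> group_mean ms y"
abbreviation "ymean \<equiv> grand_mean ms y"

text \<open>The drift function. It can depend on \<xi> alone because the kernel forgets the old
  precisions.\<close>

definition energy :: "real \<Rightarrow> real^'k option \<Rightarrow> real" where
  "energy \<phi> \<xi> = \<phi> * v1 (theta_of \<xi>) (mu_of \<xi>) + v2 ms y (theta_of \<xi>) / real m"

lemma m_pos: "0 < real m" using m2 by simp

lemma energy_sum:
  "energy \<phi> \<xi> = (\<Sum>i\<in>UNIV. \<phi> * (\<xi> $ Some i - \<xi> $ None)\<^sup>2 + (\<xi> $ Some i - gmean i)\<^sup>2)"
proof -
  have "v2 ms y (theta_of \<xi>) = real m * (\<Sum>i\<in>UNIV. (\<xi> $ Some i - gmean i)\<^sup>2)"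
    by (simp add: v2_def balanced theta_of_def sum_distrib_left)
  then have "v2 ms y (theta_of \<xi>) / real m = (\<Sum>i\<in>UNIV. (\<xi> $ Some i - gmean i)\<^sup>2)"
    using m_pos by simp
  then show ?thesis
    by (simp add: energy_def v1_def theta_of_def mu_of_def sum_distrib_left sum.distrib)
qed

lemma energy_nonneg: "0 < \<phi> \<Longrightarrow> 0 \<le> energy \<phi> \<xi>"
  using m_pos by (simp add: energy_def v1_nonneg v2_nonneg)

lemma energy_measurable [measurable]:
  assumes [measurable]: "f \<in> M \<rightarrow>\<^sub>M borel" shows "(\<lambda>x. energy \<phi> (f x)) \<in> borel_measurable M"
  unfolding energy_def by measurable

lemma sum_gmean: "(\<Sum>i\<in>UNIV. gmean i) = real CARD('k) * ymean"
  by (simp add: grand_mean_def)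

lemma tsum_balanced: "tsum ms s e = real CARD('k) * (real m * s * e / (s + real m * e))"
  by (simp add: tsum_def balanced)

text \<open>Equal group sizes give all groups the same weight, so the group means enter only through
  their plain average. With unequal sizes that average would vary with the precisions.\<close>

lemma cond_mean_mu_balanced:
  "cond_mean_mu s0 m0 ms y s e = (tsum ms s e * ymean + s0 * m0) / (s0 + tsum ms s e)"
proof -
  have "(\<Sum>i\<in>UNIV. real m * s * e * gmean i / (s + real m * e)) = real m * s * e / (s + real m * e) * (\<Sum>i\<in>UNIV. gmean i)"
    by (simp add: sum_distrib_left)
  then show ?thesis unfolding cond_mean_mu_def sum_gmean tsum_balanced
    by (simp add: balanced sum_gmean mult_ac)
qed

definition center_const :: real where
  "center_const = (\<Sum>i\<in>UNIV. max ((ymean - gmean i)\<^sup>2) ((m0 - gmean i)\<^sup>2))"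

lemma center_const_nonneg: "0 \<le> center_const"
  unfolding center_const_def by (intro sum_nonneg) (simp add: max.coboundedI1)

text \<open>Each summand of the energy is a squared affine function of \<xi>, so its conditional
  mean is squared mean plus variance. The squared means are bounded through
  \<open>center_const\<close>, the variances through \<open>variance_bound\<close>.\<close>

lemma conditional_energy_le:
  assumes \<phi>: "0 < \<phi>" and l: "l \<in> pos_quadrant"
  shows "(\<integral>\<^sup>+\<xi>. ennreal (xid l \<xi>) * ennreal (energy \<phi> \<xi>) \<partial>lborel)
    \<le> ennreal (\<phi> / fst l + (\<phi> * real CARD('k) + real CARD('k) + 1) / (real m * snd l) + max \<phi> 1 * center_const)"
proof -
  obtain s e where le: "l = (s, e)" "0 < s" "0 < e" using l by auto
  define D where "D = s + real m * e"
  define w where "w = s / D"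
  define T where "T = s0 + tsum ms s e"
  define E where "E = cond_mean_mu s0 m0 ms y s e"
  define c where "c i = cond_mean s0 m0 ms y s e $ Some i" for i
  have D: "0 < D" using le m_pos by (simp add: D_def add_pos_pos)
  have w: "0 \<le> w" "w \<le> 1" using le D m_pos by (auto simp: w_def D_def)
  have T: "0 < T" unfolding T_def using pos(5) tsum_nonneg[OF le(2,3), of ms] by simp
  \<comment> \<open>The group mean is shrunk towards \<open>E\<close> with weight \<open>w\<close>,
    so \<open>c i\<close> divides the distance between them in the proportions \<open>1 - w\<close>
    and \<open>w\<close>.\<close>
  have c: "c i = E + (1 - w) * (gmean i - E)" for i
  proof -
    have "1 - w = real m * e / D" using D by (simp add: w_def D_def field_simps)
    moreover have "c i = w * E + (real m * e / D) * gmean i"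
      by (simp add: c_def cond_mean_def balanced E_def w_def D_def add_divide_distrib)
    ultimately have "c i = w * E + (1 - w) * gmean i" by (simp only:)
    then show ?thesis by (simp add: algebra_simps)
  qed
  have xid: "xid l \<xi> = hier_density E (sqrt (1 / T)) (\<lambda>i u. c i + w * (u - E)) (\<lambda>i. sqrt (1 / D)) \<xi>" for \<xi>
    by (simp add: xi_density_def Let_def le balanced E_def T_def c_def w_def D_def)
  have xm [measurable]: "(\<lambda>\<xi>. xid l \<xi>) \<in> borel_measurable borel" by measurable
  have sq: "(\<integral>\<^sup>+\<xi>. ennreal (xid l \<xi> * (g + v * (\<xi> $ None) + (\<xi> $ Some i))\<^sup>2) \<partial>lborel)
    = ennreal ((g + v * E + c i)\<^sup>2 + (v + w)\<^sup>2 * (1 / T) + 1 / D)" for g v i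
    unfolding xid using T D
    by (subst nn_integral_hier_density_affine_square) (auto simp: real_sqrt_pow2)
  \<comment> \<open>Coefficients 0 and -1 are written out to match the pattern of
    \<open>sq\<close>.\<close>
  have "(\<integral>\<^sup>+\<xi>. ennreal (xid l \<xi>) * ennreal (energy \<phi> \<xi>) \<partial>lborel)
    = (\<integral>\<^sup>+\<xi>. (\<Sum>i\<in>UNIV. ennreal \<phi> * ennreal (xid l \<xi> * (0 + (-1) * (\<xi> $ None) + (\<xi> $ Some i))\<^sup>2)
        + ennreal (xid l \<xi> * (- gmean i + 0 * (\<xi> $ None) + (\<xi> $ Some i))\<^sup>2)) \<partial>lborel)"
  proof (rule nn_integral_cong)
    fix \<xi>
    have "(\<Sum>i\<in>UNIV. ennreal \<phi> * ennreal (xid l \<xi> * (0 + (-1) * (\<xi> $ None) + (\<xi> $ Some i))\<^sup>2)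
        + ennreal (xid l \<xi> * (- gmean i + 0 * (\<xi> $ None) + (\<xi> $ Some i))\<^sup>2))
      = (\<Sum>i\<in>UNIV. ennreal (xid l \<xi> * (\<phi> * (\<xi> $ Some i - \<xi> $ None)\<^sup>2 + (\<xi> $ Some i - gmean i)\<^sup>2)))"
      using \<phi> by (intro sum.cong refl)
        (simp add: xi_density_nonneg algebra_simps flip: ennreal_mult ennreal_plus)
    also have "\<dots> = ennreal (xid l \<xi> * energy \<phi> \<xi>)"
      unfolding energy_sum sum_distrib_left
      using \<phi> by (intro sum_ennreal) (auto simp: xi_density_nonneg intro!: mult_nonneg_nonneg add_nonneg_nonneg)
    finally show "ennreal (xid l \<xi>) * ennreal (energy \<phi> \<xi>)
      = (\<Sum>i\<in>UNIV. ennreal \<phi> * ennreal (xid l \<xi> * (0 + (-1) * (\<xi> $ None) + (\<xi> $ Some i))\<^sup>2)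
        + ennreal (xid l \<xi> * (- gmean i + 0 * (\<xi> $ None) + (\<xi> $ Some i))\<^sup>2))"
      using \<phi> by (simp add: ennreal_mult xi_density_nonneg energy_nonneg)
  qed
  also have "\<dots> = (\<Sum>i\<in>UNIV. ennreal \<phi> * ennreal ((0 + (-1) * E + c i)\<^sup>2 + (-1 + w)\<^sup>2 * (1 / T) + 1 / D)
      + ennreal ((- gmean i + 0 * E + c i)\<^sup>2 + (0 + w)\<^sup>2 * (1 / T) + 1 / D))"
    unfolding sq[symmetric] by (simp add: nn_integral_sum nn_integral_add nn_integral_cmult)
  also have "\<dots> = (\<Sum>i\<in>UNIV. ennreal ((\<phi> * (1 - w)\<^sup>2 + w\<^sup>2) * (E - gmean i)\<^sup>2
      + ((\<phi> * (1 - w)\<^sup>2 + w\<^sup>2) / T + (\<phi> + 1) / D)))"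
  proof (intro sum.cong refl)
    fix i
    have "\<phi> * ((0 + (-1) * E + c i)\<^sup>2 + (-1 + w)\<^sup>2 * (1 / T) + 1 / D) + ((- gmean i + 0 * E + c i)\<^sup>2 + (0 + w)\<^sup>2 * (1 / T) + 1 / D)
      = (\<phi> * (1 - w)\<^sup>2 + w\<^sup>2) * (E - gmean i)\<^sup>2 + ((\<phi> * (1 - w)\<^sup>2 + w\<^sup>2) / T + (\<phi> + 1) / D)"
      unfolding c by (simp add: power2_eq_square add_divide_distrib diff_divide_distrib algebra_simps)
    then show "ennreal \<phi> * ennreal ((0 + (-1) * E + c i)\<^sup>2 + (-1 + w)\<^sup>2 * (1 / T) + 1 / D)
      + ennreal ((- gmean i + 0 * E + c i)\<^sup>2 + (0 + w)\<^sup>2 * (1 / T) + 1 / D)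
      = ennreal ((\<phi> * (1 - w)\<^sup>2 + w\<^sup>2) * (E - gmean i)\<^sup>2 + ((\<phi> * (1 - w)\<^sup>2 + w\<^sup>2) / T + (\<phi> + 1) / D))"
      using \<phi> T D by (subst ennreal_mult[symmetric] ennreal_plus[symmetric], simp, simp)+ (simp only:)
  qed
  also have "\<dots> = ennreal (\<Sum>i\<in>UNIV. (\<phi> * (1 - w)\<^sup>2 + w\<^sup>2) * (E - gmean i)\<^sup>2
      + ((\<phi> * (1 - w)\<^sup>2 + w\<^sup>2) / T + (\<phi> + 1) / D))"
    using \<phi> T D by (intro sum_ennreal) (auto intro!: add_nonneg_nonneg)
  also have "\<dots> \<le> ennreal (\<phi> / fst l + (\<phi> * real CARD('k) + real CARD('k) + 1) / (real m * snd l) + max \<phi> 1 * center_const)"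
  proof (rule ennreal_leI)
    have "(\<Sum>i\<in>UNIV. (\<phi> * (1 - w)\<^sup>2 + w\<^sup>2) * (E - gmean i)\<^sup>2) \<le> (\<Sum>i\<in>UNIV. max \<phi> 1 * max ((ymean - gmean i)\<^sup>2) ((m0 - gmean i)\<^sup>2))"
    proof (intro sum_mono mult_mono)
      show "\<phi> * (1 - w)\<^sup>2 + w\<^sup>2 \<le> max \<phi> 1" using w \<phi> by (rule convex_square_coeff_le_max)
      show "(E - gmean i)\<^sup>2 \<le> max ((ymean - gmean i)\<^sup>2) ((m0 - gmean i)\<^sup>2)" for i
        unfolding E_def cond_mean_mu_balanced using pos(5) tsum_nonneg[OF le(2,3)]
        by (rule weighted_mean_square_le_max)
    qed (use \<phi> in auto)
    then have 1: "(\<Sum>i\<in>UNIV. (\<phi> * (1 - w)\<^sup>2 + w\<^sup>2) * (E - gmean i)\<^sup>2) \<le> max \<phi> 1 * center_const"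
      by (simp add: center_const_def sum_distrib_left)
    have "real CARD('k) * ((\<phi> * (1 - w)\<^sup>2 + w\<^sup>2) / T + (\<phi> + 1) / D) \<le> \<phi> / s + (\<phi> * real CARD('k) + real CARD('k) + 1) / (real m * e)"
      unfolding w_def T_def D_def tsum_balanced using le m_pos \<phi> pos(5) by (intro variance_bound) auto
    then show "(\<Sum>i\<in>UNIV. (\<phi> * (1 - w)\<^sup>2 + w\<^sup>2) * (E - gmean i)\<^sup>2 + ((\<phi> * (1 - w)\<^sup>2 + w\<^sup>2) / T + (\<phi> + 1) / D))
      \<le> \<phi> / fst l + (\<phi> * real CARD('k) + real CARD('k) + 1) / (real m * snd l) + max \<phi> 1 * center_const"
      using 1 by (simp add: sum.distrib le)
  qed
  finally show ?thesis .
qed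

lemma obs_total_ge_2: "2 \<le> real (obs_total ms)"
proof -
  have "obs_total ms = CARD('k) * m" by (simp add: obs_total_def balanced)
  moreover have "2 * 1 \<le> CARD('k) * m" using K3 m2 by (intro mult_le_mono) auto
  ultimately have "2 \<le> obs_total ms" by simp
  then show ?thesis by simp
qed

text \<open>Three groups and two observations put both shapes above one, where inverse Gamma moments
  are finite. The reciprocals of the denominators are \<open>\<delta>1\<close> and
  \<open>\<delta>2\<close>.\<close>

lemma nn_integral_lam_inverse:
  shows "(\<integral>\<^sup>+l. ennreal (lam \<xi> l) * ennreal (1 / fst l) \<partial>lborel)
      = ennreal ((v1 (theta_of \<xi>) (mu_of \<xi>) + 2 * b1) / (2 * a1 + real CARD('k) - 2))" (is ?T1)
    and "(\<integral>\<^sup>+l. ennreal (lam \<xi> l) * ennreal (1 / snd l) \<partial>lborel)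
      = ennreal ((v2 ms y (theta_of \<xi>) + SSE ms y + 2 * b2) / (2 * a2 + real (obs_total ms) - 2))" (is ?T2)
proof -
  let ?A1 = "real CARD('k) / 2 + a1" and ?B1 = "v1 (theta_of \<xi>) (mu_of \<xi>) / 2 + b1"
  let ?A2 = "real (obs_total ms) / 2 + a2" and ?B2 = "(v2 ms y (theta_of \<xi>) + SSE ms y) / 2 + b2"
  note M = obs_total_ge_2
  have A: "1 < ?A1" "1 < ?A2" using K3 M pos by auto
  note B = gamma_parameters_pos(2,4)[of \<xi>]
  have lam: "lam \<xi> l = gamma_density ?A1 ?B1 (fst l) * gamma_density ?A2 ?B2 (snd l)" for l
    by (simp add: lambda_density_def)
  have g: "0 \<le> gamma_density ?A1 ?B1 x" "0 \<le> gamma_density ?A2 ?B2 x" for x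
    using A by (auto intro!: gamma_density_nonneg)
  have "(\<integral>\<^sup>+l. ennreal (lam \<xi> l) * ennreal (1 / fst l) \<partial>lborel)
    = (\<integral>\<^sup>+l. ennreal (gamma_density ?A1 ?B1 (fst l) * (1 / fst l)) * ennreal (gamma_density ?A2 ?B2 (snd l)) \<partial>lborel)"
  proof (rule nn_integral_cong)
    fix l :: "real \<times> real"
    show "ennreal (lam \<xi> l) * ennreal (1 / fst l)
      = ennreal (gamma_density ?A1 ?B1 (fst l) * (1 / fst l)) * ennreal (gamma_density ?A2 ?B2 (snd l))"
    proof (cases "0 < fst l")
      case True
      then show ?thesis using g(1)[of "fst l"] g(2)[of "snd l"]
        by (simp add: lam mult_ac flip: ennreal_mult)
    qed (simp add: lam gamma_density_def)
  qed
  also have "\<dots> = ennreal (?B1 / (?A1 - 1)) * 1"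
    using A B by (subst nn_integral_lborel_pair_mult[of "\<lambda>x. ennreal (gamma_density ?A1 ?B1 x * (1 / x))" "\<lambda>x. ennreal (gamma_density ?A2 ?B2 x)"])
      (auto simp: nn_integral_gamma_density_inverse[unfolded mult_1_right] nn_integral_gamma_density simp del: times_divide_eq_right)
  also have "?B1 / (?A1 - 1) = (v1 (theta_of \<xi>) (mu_of \<xi>) + 2 * b1) / (2 * a1 + real CARD('k) - 2)"
    using A by (simp add: divide_simps) (simp add: algebra_simps)
  finally show ?T1 by simp
  have "(\<integral>\<^sup>+l. ennreal (lam \<xi> l) * ennreal (1 / snd l) \<partial>lborel)
    = (\<integral>\<^sup>+l. ennreal (gamma_density ?A1 ?B1 (fst l)) * ennreal (gamma_density ?A2 ?B2 (snd l) * (1 / snd l)) \<partial>lborel)"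
  proof (rule nn_integral_cong)
    fix l :: "real \<times> real"
    show "ennreal (lam \<xi> l) * ennreal (1 / snd l)
      = ennreal (gamma_density ?A1 ?B1 (fst l)) * ennreal (gamma_density ?A2 ?B2 (snd l) * (1 / snd l))"
    proof (cases "0 < snd l")
      case True
      then show ?thesis using g(1)[of "fst l"] g(2)[of "snd l"]
        by (simp add: lam mult_ac flip: ennreal_mult)
    qed (simp add: lam gamma_density_def)
  qed
  also have "\<dots> = 1 * ennreal (?B2 / (?A2 - 1))"
    using A B by (subst nn_integral_lborel_pair_mult[of "\<lambda>x. ennreal (gamma_density ?A1 ?B1 x)" "\<lambda>x. ennreal (gamma_density ?A2 ?B2 x * (1 / x))"])
      (auto simp: nn_integral_gamma_density_inverse[unfolded mult_1_right] nn_integral_gamma_density simp del: times_divide_eq_right)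
  also have "?B2 / (?A2 - 1) = (v2 ms y (theta_of \<xi>) + SSE ms y + 2 * b2) / (2 * a2 + real (obs_total ms) - 2)"
    using A by (simp add: divide_simps) (simp add: algebra_simps)
  finally show ?T2 by simp
qed

text \<open>Averaging over the new \<xi> leaves a bound linear in the reciprocal precisions, whose
  means under the Gamma conditionals are affine in \<open>v1\<close> and \<open>v2\<close> of the
  old state.\<close>

lemma kernel_energy_le:
  assumes \<phi>: "0 < \<phi>"
  shows "(\<integral>\<^sup>+z'. ennreal (energy \<phi> (snd z')) \<partial>gibbs z)
    \<le> ennreal (\<phi> * ((v1 (theta_of (snd z)) (mu_of (snd z)) + 2 * b1) / (2 * a1 + real CARD('k) - 2))
      + (\<phi> * real CARD('k) + real CARD('k) + 1) / real m
          * ((v2 ms y (theta_of (snd z)) + SSE ms y + 2 * b2) / (2 * a2 + real (obs_total ms) - 2))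
      + max \<phi> 1 * center_const)"
proof -
  let ?\<xi> = "snd z"
  let ?B = "(\<phi> * real CARD('k) + real CARD('k) + 1) / real m"
  let ?C = "max \<phi> 1 * center_const"
  have B: "0 \<le> ?B" and C: "0 \<le> ?C" using \<phi> center_const_nonneg by auto
  have "(\<integral>\<^sup>+z'. ennreal (energy \<phi> (snd z')) \<partial>gibbs z)
    = (\<integral>\<^sup>+l. ennreal (lam ?\<xi> l) * (\<integral>\<^sup>+\<xi>. ennreal (xid l \<xi>) * ennreal (energy \<phi> (snd (l, \<xi>))) \<partial>lborel) \<partial>lborel)"
    by (rule nn_integral_kernel_iterated) measurable
  also have "\<dots> \<le> (\<integral>\<^sup>+l. ennreal \<phi> * (ennreal (lam ?\<xi> l) * ennreal (1 / fst l))
      + ennreal ?B * (ennreal (lam ?\<xi> l) * ennreal (1 / snd l)) + ennreal ?C * ennreal (lam ?\<xi> l) \<partial>lborel)"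
  proof (rule nn_integral_mono)
    fix l
    show "ennreal (lam ?\<xi> l) * (\<integral>\<^sup>+\<xi>. ennreal (xid l \<xi>) * ennreal (energy \<phi> (snd (l, \<xi>))) \<partial>lborel)
      \<le> ennreal \<phi> * (ennreal (lam ?\<xi> l) * ennreal (1 / fst l))
      + ennreal ?B * (ennreal (lam ?\<xi> l) * ennreal (1 / snd l)) + ennreal ?C * ennreal (lam ?\<xi> l)"
    proof (cases "l \<in> pos_quadrant")
      case True
      then have l: "0 < fst l" "0 < snd l" by auto
      have "(\<integral>\<^sup>+\<xi>. ennreal (xid l \<xi>) * ennreal (energy \<phi> (snd (l, \<xi>))) \<partial>lborel)
        \<le> ennreal (\<phi> / fst l + (\<phi> * real CARD('k) + real CARD('k) + 1) / (real m * snd l) + ?C)"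
        using conditional_energy_le[OF \<phi> True] by simp
      also have "\<phi> / fst l + (\<phi> * real CARD('k) + real CARD('k) + 1) / (real m * snd l) + ?C
        = \<phi> * (1 / fst l) + ?B * (1 / snd l) + ?C" by simp
      also have "ennreal \<dots> = ennreal \<phi> * ennreal (1 / fst l) + ennreal ?B * ennreal (1 / snd l) + ennreal ?C"
        using \<phi> B C l by (simp only: ennreal_plus ennreal_mult add_nonneg_nonneg mult_nonneg_nonneg
            less_imp_le zero_le_divide_1_iff)
      finally have "ennreal (lam ?\<xi> l) * (\<integral>\<^sup>+\<xi>. ennreal (xid l \<xi>) * ennreal (energy \<phi> (snd (l, \<xi>))) \<partial>lborel)
        \<le> ennreal (lam ?\<xi> l) * (ennreal \<phi> * ennreal (1 / fst l) + ennreal ?B * ennreal (1 / snd l) + ennreal ?C)"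
        by (rule mult_left_mono) simp
      also have "\<dots> = ennreal \<phi> * (ennreal (lam ?\<xi> l) * ennreal (1 / fst l))
      + ennreal ?B * (ennreal (lam ?\<xi> l) * ennreal (1 / snd l)) + ennreal ?C * ennreal (lam ?\<xi> l)"
        by (simp only: distrib_left mult_ac)
      finally show ?thesis .
    qed (use lambda_density_off[of l a1 b1 a2 b2 ms y ?\<xi>] in simp)
  qed
  also have "\<dots> = ennreal \<phi> * (\<integral>\<^sup>+l. ennreal (lam ?\<xi> l) * ennreal (1 / fst l) \<partial>lborel)
      + ennreal ?B * (\<integral>\<^sup>+l. ennreal (lam ?\<xi> l) * ennreal (1 / snd l) \<partial>lborel)
      + ennreal ?C * (\<integral>\<^sup>+l. ennreal (lam ?\<xi> l) \<partial>lborel)"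
    by (subst nn_integral_add, measurable)+ (subst nn_integral_cmult, measurable)+
  also have "\<dots> = ennreal (\<phi> * ((v1 (theta_of (snd z)) (mu_of (snd z)) + 2 * b1) / (2 * a1 + real CARD('k) - 2))
      + ?B * ((v2 ms y (theta_of (snd z)) + SSE ms y + 2 * b2) / (2 * a2 + real (obs_total ms) - 2)) + ?C)"
  proof -
    have 1: "0 \<le> (v1 (theta_of (snd z)) (mu_of (snd z)) + 2 * b1) / (2 * a1 + real CARD('k) - 2)"
      using pos K3 v1_nonneg[of "theta_of (snd z)" "mu_of (snd z)"] by (intro divide_nonneg_nonneg) auto
    have 2: "0 \<le> (v2 ms y (theta_of (snd z)) + SSE ms y + 2 * b2) / (2 * a2 + real (obs_total ms) - 2)"
      using pos obs_total_ge_2 v2_nonneg[of ms y "theta_of (snd z)"] SSE_nonneg[of ms y]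
      by (intro divide_nonneg_nonneg) auto
    show ?thesis
      unfolding nn_integral_lam_inverse nn_integral_lam
      using \<phi> B C 1 2 by (simp only: ennreal_plus ennreal_mult add_nonneg_nonneg mult_nonneg_nonneg less_imp_le mult_1_right)
  qed
  finally show ?thesis .
qed

section \<open>Minorization on the small set\<close>

definition minorant :: "real \<Rightarrow> real \<Rightarrow> 'k state measure" where
  "minorant D1 D2 = density base (\<lambda>z. ennreal
     (gamma_min (real CARD('k) / 2 + a1) b1 D1 (fst (fst z))
      * gamma_min (real (obs_total ms) / 2 + a2) (SSE ms y / 2 + b2) D2 (snd (fst z))
      * xid (fst z) (snd z)))"

lemma minorant_rates: "0 < SSE ms y / 2 + b2"
  using SSE_nonneg[of ms y] pos by simp

text \<open>The rates of the two Gamma conditionals exceed \<open>b1\<close> and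
  \<open>SSE ms y / 2 + b2\<close> by \<open>v1 / 2\<close> and \<open>v2 / 2\<close>, so the
  endpoint minima over these ranges lie below them. The factor \<open>xid\<close> is the same for
  every old state.\<close>

lemma minorant_le:
  assumes D: "0 < D1" "0 < D2" and v: "v1 (theta_of (snd z)) (mu_of (snd z)) / 2 \<le> D1"
    "v2 ms y (theta_of (snd z)) / 2 \<le> D2"
  shows "minorant D1 D2 \<le> gibbs z"
proof -
  have le: "ennreal (gamma_min (real CARD('k) / 2 + a1) b1 D1 (fst (fst z'))
      * gamma_min (real (obs_total ms) / 2 + a2) (SSE ms y / 2 + b2) D2 (snd (fst z'))
      * xid (fst z') (snd z')) \<le> ennreal (trans_density z z')" for z'
  proof (rule ennreal_leI)
    have 1: "gamma_min (real CARD('k) / 2 + a1) b1 D1 (fst (fst z'))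
      \<le> gamma_density (real CARD('k) / 2 + a1) (v1 (theta_of (snd z)) (mu_of (snd z)) / 2 + b1) (fst (fst z'))"
      using gamma_min_le[of "real CARD('k) / 2 + a1" b1 "v1 (theta_of (snd z)) (mu_of (snd z)) / 2" D1]
        pos D v v1_nonneg[of "theta_of (snd z)" "mu_of (snd z)"] gamma_parameters_pos(1) by (simp add: add.commute)
    have eq: "(v2 ms y (theta_of (snd z)) + SSE ms y) / 2 + b2 = SSE ms y / 2 + b2 + v2 ms y (theta_of (snd z)) / 2"
      by simp
    have 2: "gamma_min (real (obs_total ms) / 2 + a2) (SSE ms y / 2 + b2) D2 (snd (fst z'))
      \<le> gamma_density (real (obs_total ms) / 2 + a2) ((v2 ms y (theta_of (snd z)) + SSE ms y) / 2 + b2) (snd (fst z'))"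
      unfolding eq
      using gamma_min_le[of "real (obs_total ms) / 2 + a2" "SSE ms y / 2 + b2" "v2 ms y (theta_of (snd z)) / 2" D2]
        D v v2_nonneg[of ms y "theta_of (snd z)"] gamma_parameters_pos(3) minorant_rates by simp
    show "gamma_min (real CARD('k) / 2 + a1) b1 D1 (fst (fst z'))
      * gamma_min (real (obs_total ms) / 2 + a2) (SSE ms y / 2 + b2) D2 (snd (fst z'))
      * xid (fst z') (snd z') \<le> trans_density z z'"
      unfolding trans_density_def lambda_density_def
      using 1 2 gamma_parameters_pos(1,3)
      by (intro mult_right_mono mult_mono) (auto simp: xi_density_nonneg gamma_min_nonneg gamma_density_nonneg)
  qed
  have "emeasure (minorant D1 D2) A \<le> emeasure (gibbs z) A" if "A \<in> sets base" for A
    unfolding minorant_def kernel_eq using that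
    by (subst (1 2) emeasure_density) (auto intro!: nn_integral_mono mult_right_mono le measurable_base)
  then show ?thesis by (subst le_measure) (auto simp: minorant_def kernel_space)
qed

text \<open>For positive precisions \<open>xid\<close> integrates to one, leaving a product of two
  one-dimensional masses.\<close>

lemma minorant_mass:
  assumes D: "0 < D1" "0 < D2"
  shows "emeasure (minorant D1 D2) (space base)
    = ennreal ((LINT x:{0<..}|lborel. gamma_min (real CARD('k) / 2 + a1) b1 D1 x)
      * (LINT x:{0<..}|lborel. gamma_min (real (obs_total ms) / 2 + a2) (SSE ms y / 2 + b2) D2 x))"
proof -
  let ?g = "gamma_min (real CARD('k) / 2 + a1) b1 D1"
  let ?h = "gamma_min (real (obs_total ms) / 2 + a2) (SSE ms y / 2 + b2) D2"
  let ?F = "\<lambda>z. ennreal (?g (fst (fst z)) * ?h (snd (fst z)) * xid (fst z) (snd z))"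
  have g0: "0 \<le> ?g x" and h0: "0 \<le> ?h x" for x
    using gamma_parameters_pos(1,3) by (auto intro!: gamma_min_nonneg)
  have off: "?g (fst l) * ?h (snd l) = 0" if "l \<notin> pos_quadrant" for l
    using that by (cases l) (auto simp: gamma_min_def gamma_density_def)
  have "emeasure (minorant D1 D2) (space base) = (\<integral>\<^sup>+z. ?F z \<partial>base)"
    unfolding minorant_def by (subst emeasure_density) (auto intro!: measurable_base nn_integral_cong)
  also have "\<dots> = (\<integral>\<^sup>+l. \<integral>\<^sup>+\<xi>. ?F (l, \<xi>) \<partial>lborel \<partial>lborel)"
    by (rule nn_integral_base(1), measurable, simp add: off)
  also have "\<dots> = (\<integral>\<^sup>+l. ennreal (?g (fst l)) * ennreal (?h (snd l)) \<partial>lborel)"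
  proof (rule nn_integral_cong)
    fix l
    have "(\<integral>\<^sup>+\<xi>. ?F (l, \<xi>) \<partial>lborel) = (\<integral>\<^sup>+\<xi>. ennreal (?g (fst l) * ?h (snd l)) * ennreal (xid l \<xi>) \<partial>lborel)"
      by (simp add: ennreal_mult xi_density_nonneg g0 h0)
    also have "\<dots> = ennreal (?g (fst l) * ?h (snd l)) * (\<integral>\<^sup>+\<xi>. ennreal (xid l \<xi>) \<partial>lborel)"
      by (rule nn_integral_cmult) measurable
    also have "\<dots> = ennreal (?g (fst l) * ?h (snd l))"
    proof (cases "l \<in> pos_quadrant")
      case True
      then show ?thesis using pos by (auto simp: nn_integral_xi_density)
    next
      case False
      show ?thesis by (simp only: off[OF False] ennreal_0 mult_zero_left)
    qed
    finally show "(\<integral>\<^sup>+\<xi>. ?F (l, \<xi>) \<partial>lborel) = ennreal (?g (fst l)) * ennreal (?h (snd l))"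
      by (simp add: ennreal_mult g0 h0)
  qed
  also have "\<dots> = (\<integral>\<^sup>+x. ennreal (?g x) \<partial>lborel) * (\<integral>\<^sup>+x. ennreal (?h x) \<partial>lborel)"
    by (rule nn_integral_lborel_pair_mult) auto
  also have "\<dots> = ennreal ((LINT x:{0<..}|lborel. ?g x) * (LINT x:{0<..}|lborel. ?h x))"
    using gamma_parameters_pos(1,3) D pos minorant_rates
    by (simp add: gamma_min_mass(1) ennreal_mult gamma_min_mass(2))
  finally show ?thesis .
qed

section \<open>The minimizer of the drift function\<close>

lemma energy_decomposition:
  assumes "0 < \<phi>"
  shows "energy \<phi> \<xi> = (\<phi> + 1) * (\<Sum>i\<in>UNIV. (\<xi> $ Some i - (\<phi> * \<xi> $ None + gmean i) / (\<phi> + 1))\<^sup>2)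
    + \<phi> / (\<phi> + 1) * (real CARD('k) * (\<xi> $ None - ymean)\<^sup>2) + \<phi> / (1 + \<phi>) * (\<Sum>i\<in>UNIV. (gmean i - ymean)\<^sup>2)"
proof -
  let ?u = "\<xi> $ None"
  \<comment> \<open>Square completion in each leaf leaves a multiple of the squared distance from
    \<open>?u\<close> to the group mean; splitting these about the grand mean isolates
    \<open>?u\<close>. All variable terms are then squares, so minimizer, uniqueness and minimum can
    be read off.\<close>
  have "energy \<phi> \<xi> = (\<Sum>i\<in>UNIV. (\<phi> + 1) * (\<xi> $ Some i - (\<phi> * ?u + gmean i) / (\<phi> + 1))\<^sup>2 + \<phi> / (\<phi> + 1) * (?u - gmean i)\<^sup>2)"
    unfolding energy_sum using assms square_sum_split[of \<phi> 1] by (intro sum.cong) auto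
  also have "\<dots> = (\<phi> + 1) * (\<Sum>i\<in>UNIV. (\<xi> $ Some i - (\<phi> * ?u + gmean i) / (\<phi> + 1))\<^sup>2) + \<phi> / (\<phi> + 1) * (\<Sum>i\<in>UNIV. (?u - gmean i)\<^sup>2)"
    by (simp only: sum.distrib sum_distrib_left)
  also have "(\<Sum>i\<in>UNIV. (?u - gmean i)\<^sup>2) = real CARD('k) * (?u - ymean)\<^sup>2 + (\<Sum>i\<in>UNIV. (gmean i - ymean)\<^sup>2)"
  proof -
    have "(\<Sum>i\<in>UNIV. (?u - gmean i)\<^sup>2) = (\<Sum>i\<in>UNIV. (?u - ymean)\<^sup>2 + (gmean i - ymean)\<^sup>2 + 2 * (?u - ymean) * (ymean - gmean i))"
      by (intro sum.cong) (auto simp: power2_eq_square algebra_simps)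
    also have "\<dots> = real CARD('k) * (?u - ymean)\<^sup>2 + (\<Sum>i\<in>UNIV. (gmean i - ymean)\<^sup>2) + 2 * (?u - ymean) * (\<Sum>i\<in>UNIV. ymean - gmean i)"
      by (simp add: sum.distrib sum_distrib_left)
    also have "(\<Sum>i\<in>UNIV. ymean - gmean i) = 0" by (simp add: sum_subtractf sum_gmean)
    finally show ?thesis by simp
  qed
  finally show ?thesis by (simp add: distrib_left add.commute[of 1 \<phi>])
qed

definition energy_argmin :: "real \<Rightarrow> real^'k option" where
  "energy_argmin \<phi> = (\<chi> p. case p of None \<Rightarrow> ymean | Some i \<Rightarrow> (\<phi> * ymean + gmean i) / (\<phi> + 1))"

lemma energy_argmin_value:
  "0 < \<phi> \<Longrightarrow> energy \<phi> (energy_argmin \<phi>) = \<phi> / (1 + \<phi>) * (\<Sum>i\<in>UNIV. (gmean i - ymean)\<^sup>2)"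
  by (simp add: energy_decomposition energy_argmin_def)

lemma energy_argmin_less:
  assumes \<phi>: "0 < \<phi>" and ne: "\<xi> \<noteq> energy_argmin \<phi>"
  shows "energy \<phi> (energy_argmin \<phi>) < energy \<phi> \<xi>"
proof -
  let ?A = "\<Sum>i\<in>UNIV. (\<xi> $ Some i - (\<phi> * \<xi> $ None + gmean i) / (\<phi> + 1))\<^sup>2"
  have A0: "0 \<le> ?A" by (intro sum_nonneg) auto
  have K: "0 < real CARD('k)" using K3 by simp
  have nz: "?A \<noteq> 0 \<or> \<xi> $ None \<noteq> ymean"
  proof (rule ccontr)
    assume "\<not> ?thesis"
    then have "\<xi> $ None = ymean" "\<xi> $ Some i = (\<phi> * \<xi> $ None + gmean i) / (\<phi> + 1)" for i
      by (auto simp: sum_nonneg_eq_0_iff)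
    then have "\<xi> = energy_argmin \<phi>"
      by (simp add: vec_eq_iff energy_argmin_def split: option.split)
    then show False using ne by simp
  qed
  have "0 < (\<phi> + 1) * ?A + \<phi> / (\<phi> + 1) * (real CARD('k) * (\<xi> $ None - ymean)\<^sup>2)"
  proof (cases "?A = 0")
    case True
    then show ?thesis using nz \<phi> K by simp
  next
    case False
    then show ?thesis using A0 \<phi> K by (intro add_pos_nonneg mult_pos_pos) auto
  qed
  then show ?thesis unfolding energy_argmin_value[OF \<phi>] energy_decomposition[OF \<phi>, of \<xi>] by simp
qed

lemma is_arg_min_energy_iff:
  "0 < \<phi> \<Longrightarrow> is_arg_min (energy \<phi>) (\<lambda>_. True) \<xi> \<longleftrightarrow> \<xi> = energy_argmin \<phi>"
  using energy_argmin_less[of \<phi>] unfolding is_arg_min_def by (metis less_asym)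

end


section \<open>The stated constants fitted to the drift and minorization scheme\<close>

theorem mainTheorem7:
  fixes a1 b1 a2 b2 s0 m0 :: real
    and ms :: "'k::finite \<Rightarrow> nat" and m :: nat
    and y :: "'k \<Rightarrow> nat \<Rightarrow> real"
    and \<delta>1 \<delta>2 \<delta>3 \<delta>5 \<delta> c1 c2 \<gamma> \<phi> b dR :: real
    and l\<theta>s les :: real and h1 h2 :: "real \<Rightarrow> real"
    and \<epsilon>B \<alpha> U r :: real and n :: nat
    and l0 :: "real \<times> real" and \<xi>0 :: "real ^ 'k option"
  assumes pos: "a1 > 0" "b1 > 0" "a2 > 0" "b2 > 0" "s0 > 0"
    and K3: "CARD('k) \<ge> 3"
    and balanced: "\<And>i. ms i = m" and m2: "m \<ge> 2"
    and d1: "\<delta>1 = 1 / (2 * a1 + real CARD('k) - 2)"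
    and d2: "\<delta>2 = 1 / (2 * a2 + real (obs_total ms) - 2)"
    and d3: "\<delta>3 = (real CARD('k) + 1) * \<delta>2"
    and d5: "\<delta>5 = real CARD('k) * \<delta>2"
    and d: "\<delta> = max \<delta>1 \<delta>3"
    and c1: "c1 = 2 * b1 * \<delta>1"
    and c2: "c2 = (2 * b2 + SSE ms y) * \<delta>2"
    and gam: "\<delta> < \<gamma>" "\<gamma> < 1"
    and phi: "\<phi> > 0" "\<phi> * \<delta>5 + \<delta> < \<gamma>"
    and b: "b = \<phi> * c1 + (\<phi> * real CARD('k) + real CARD('k) + 1) / real m * c2
              + max \<phi> 1 * (\<Sum>i\<in>UNIV. max ((grand_mean ms y - group_mean ms y i)\<^sup>2)
                                            ((m0 - group_mean ms y i)\<^sup>2))"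
    and dR: "dR > 2 * b / (1 - \<gamma>)"
    and l\<theta>s: "l\<theta>s = \<phi> * (real CARD('k) + 2 * a1) / dR * ln (1 + dR / (2 * b1 * \<phi>))"
    and h1: "\<And>x. h1 x = (if x < l\<theta>s
                then gamma_density (real CARD('k) / 2 + a1) b1 x
                else gamma_density (real CARD('k) / 2 + a1) (dR / (2 * \<phi>) + b1) x)"
    and les: "les = (real (obs_total ms) + 2 * a2) / (real m * dR)
                      * ln (1 + real m * dR / (2 * b2 + SSE ms y))"
    and h2: "\<And>x. h2 x = (if x < les
                then gamma_density (real (obs_total ms) / 2 + a2) (SSE ms y / 2 + b2) x
                else gamma_density (real (obs_total ms) / 2 + a2)
                       ((SSE ms y + real m * dR) / 2 + b2) x)"
    and eB: "\<epsilon>B = (LINT x:{0<..}|lborel. h1 x) * (LINT x:{0<..}|lborel. h2 x)"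
    and al: "\<alpha> = (1 + dR) / (1 + 2 * b + \<gamma> * dR)"
    and U: "U = 1 + 2 * (\<gamma> * dR + b)"
    and start: "l0 \<in> {0<..} \<times> {0<..}"
    and r: "0 < r" "r < 1" and n: "n \<ge> 1"
  shows
    "tv_dist (gibbs_nstep a1 b1 a2 b2 s0 m0 ms y n (l0, \<xi>0)) (posterior a1 b1 a2 b2 s0 m0 ms y)
       \<le> (1 - \<epsilon>B) powr (r * real n)
         + (U powr r / \<alpha> powr (1 - r)) ^ n
           * (1 + b / (1 - \<gamma>) + \<phi> * v1 (theta_of \<xi>0) (mu_of \<xi>0) + v2 ms y (theta_of \<xi>0) / real m)
     \<and> (\<exists>!\<xi>. is_arg_min (\<lambda>\<xi>. \<phi> * v1 (theta_of \<xi>) (mu_of \<xi>) + v2 ms y (theta_of \<xi>) / real m)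
                 (\<lambda>_. True) \<xi>)
     \<and> (\<forall>\<xi>opt. is_arg_min (\<lambda>\<xi>. \<phi> * v1 (theta_of \<xi>) (mu_of \<xi>) + v2 ms y (theta_of \<xi>) / real m)
                 (\<lambda>_. True) \<xi>opt \<longrightarrow>
          tv_dist (gibbs_nstep a1 b1 a2 b2 s0 m0 ms y n (l0, \<xi>opt))
              (posterior a1 b1 a2 b2 s0 m0 ms y)
            \<le> (1 - \<epsilon>B) powr (r * real n)
              + (U powr r / \<alpha> powr (1 - r)) ^ n
                * (1 + b / (1 - \<gamma>)
                   + \<phi> / (1 + \<phi>) * (\<Sum>i\<in>UNIV. (group_mean ms y i - grand_mean ms y)\<^sup>2)))"
proof -
  interpret balanced_random_effects a1 b1 a2 b2 s0 m0 ms y m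
    using pos K3 balanced m2 by unfold_locales auto
  let ?K = "real CARD('k)" and ?M = "real (obs_total ms)"
  note M = obs_total_ge_2
  have K: "3 \<le> ?K" using K3 by simp
  have \<delta>pos: "0 < \<delta>1" "0 < \<delta>2" using pos K M by (auto simp: d1 d2)
  have \<delta>: "\<delta>1 \<le> \<delta>" "(?K + 1) * \<delta>2 \<le> \<delta>" "0 < \<delta>" using \<delta>pos by (simp_all add: d d3 less_max_iff_disj)
  have \<gamma>0: "0 \<le> \<gamma>" using gam \<delta> by simp
  have c0: "0 \<le> c1" "0 \<le> c2" using pos \<delta>pos SSE_nonneg[of ms y] by (auto simp: c1 c2)
  have b_eq: "b = \<phi> * c1 + (\<phi> * ?K + ?K + 1) / real m * c2 + max \<phi> 1 * center_const"
    by (simp add: b center_const_def)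
  have b0: "0 \<le> b"
    unfolding b_eq using c0 phi(1) center_const_nonneg by (intro add_nonneg_nonneg mult_nonneg_nonneg) auto
  have dR0: "0 < dR"
  proof -
    have "0 \<le> 2 * b / (1 - \<gamma>)" using b0 gam by simp
    then show ?thesis using dR by simp
  qed
  \<comment> \<open>An energy of at most \<open>dR\<close> bounds \<open>\<phi> * v1\<close> and
    \<open>v2 / m\<close> separately by \<open>dR\<close>. \<open>D1\<close> and \<open>D2\<close>
    are the resulting bounds on the rate increments \<open>v1 / 2\<close> and
    \<open>v2 / 2\<close>.\<close>
  define D1 where "D1 = dR / (2 * \<phi>)"
  define D2 where "D2 = real m * dR / 2"
  have D: "0 < D1" "0 < D2" using dR0 phi m_pos by (auto simp: D1_def D2_def)
  let ?V = "\<lambda>z :: 'k state. energy \<phi> (snd z)"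
  \<comment> \<open>The stated thresholds are the crossing points in \<open>gamma_min\<close> for
    widths \<open>D1\<close> and \<open>D2\<close>, up to rescaling of the fractions.\<close>
  have h1_eq: "h1 = gamma_min (?K / 2 + a1) b1 D1"
  proof
    fix x
    have "l\<theta>s = (?K / 2 + a1) / D1 * ln (1 + D1 / b1)"
      using phi dR0 pos by (simp add: l\<theta>s D1_def field_simps)
    then show "h1 x = gamma_min (?K / 2 + a1) b1 D1 x"
      by (simp add: h1 gamma_min_def D1_def add.commute)
  qed
  have h2_eq: "h2 = gamma_min (?M / 2 + a2) (SSE ms y / 2 + b2) D2"
  proof
    fix x
    have "D2 / (SSE ms y / 2 + b2) = real m * dR / (2 * b2 + SSE ms y)"
      using minorant_rates by (simp add: D2_def field_simps)
    moreover have "(?M / 2 + a2) / D2 = (?M + 2 * a2) / (real m * dR)"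
      using D m_pos dR0 by (simp add: D2_def field_simps)
    ultimately have "les = (?M / 2 + a2) / D2 * ln (1 + D2 / (SSE ms y / 2 + b2))"
      by (simp add: les)
    moreover have "SSE ms y / 2 + b2 + D2 = (SSE ms y + real m * dR) / 2 + b2"
      by (simp add: D2_def)
    ultimately show "h2 x = gamma_min (?M / 2 + a2) (SSE ms y / 2 + b2) D2 x"
      by (simp only: h2 gamma_min_def)
  qed
  have mass: "0 \<le> (LINT x:{0<..}|lborel. h1 x)" "(LINT x:{0<..}|lborel. h1 x) \<le> 1"
    "0 \<le> (LINT x:{0<..}|lborel. h2 x)" "(LINT x:{0<..}|lborel. h2 x) \<le> 1"
    unfolding h1_eq h2_eq using gamma_parameters_pos(1,3) pos D minorant_rates
    by (auto intro!: gamma_min_mass)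
  interpret chain: stationary_drift_minorization base gibbs ?V "minorant D1 D2" \<gamma> b dR \<epsilon>B post
  proof (intro stationary_drift_minorization.intro drift_minorization.intro
      stationary_drift_minorization_axioms.intro)
    show "gibbs \<in> base \<rightarrow>\<^sub>M prob_algebra base" by (rule measurable_kernel)
    show "?V \<in> borel_measurable base" by (intro measurable_base) measurable
    show "0 \<le> ?V z" for z by (rule energy_nonneg[OF phi(1)])
    show "(\<integral>\<^sup>+z'. ennreal (?V z') \<partial>gibbs z) \<le> ennreal (\<gamma> * ?V z + b)" for z
    proof (rule order_trans[OF kernel_energy_le[OF phi(1)] ennreal_leI])
      let ?v1 = "v1 (theta_of (snd z)) (mu_of (snd z))" and ?v2 = "v2 ms y (theta_of (snd z))"
      \<comment> \<open>The old state enters through \<open>\<phi> * ?v1\<close> with factor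
        \<open>\<delta>1\<close> and through \<open>?v2 / real m\<close> with factor
        \<open>\<phi> * \<delta>5 + \<delta>3\<close>; both factors are below \<gamma> by the choice
        of \<gamma> and \<phi>. The terms free of the old state add up to \<open>b\<close>.\<close>
      have "\<phi> * ((?v1 + 2 * b1) / (2 * a1 + ?K - 2)) + (\<phi> * ?K + ?K + 1) / real m * ((?v2 + SSE ms y + 2 * b2) / (2 * a2 + ?M - 2))
          + max \<phi> 1 * center_const
        = \<delta>1 * (\<phi> * ?v1) + (\<phi> * \<delta>5 + (?K + 1) * \<delta>2) * (?v2 / real m) + b"
        unfolding b_eq c1 c2 d5
        using m_pos \<delta>pos by (simp add: d1 d2 add_divide_distrib algebra_simps)
      also have "\<dots> \<le> \<gamma> * (\<phi> * ?v1) + \<gamma> * (?v2 / real m) + b"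
        using \<delta> gam phi d5 \<delta>pos v1_nonneg[of "theta_of (snd z)" "mu_of (snd z)"] v2_nonneg[of ms y "theta_of (snd z)"] m_pos
        by (intro add_mono mult_right_mono) auto
      finally show "\<phi> * ((?v1 + 2 * b1) / (2 * a1 + ?K - 2)) + (\<phi> * ?K + ?K + 1) / real m * ((?v2 + SSE ms y + 2 * b2) / (2 * a2 + ?M - 2))
          + max \<phi> 1 * center_const \<le> \<gamma> * ?V z + b"
        by (simp add: energy_def distrib_left)
    qed
    show "sets (minorant D1 D2) = sets base" by (simp add: minorant_def)
    show "minorant D1 D2 \<le> gibbs z" if "?V z \<le> dR" for z
    proof (rule minorant_le[OF D])
      let ?v1 = "v1 (theta_of (snd z)) (mu_of (snd z))" and ?v2 = "v2 ms y (theta_of (snd z))"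
      have "0 \<le> \<phi> * ?v1" "0 \<le> ?v2 / real m" using phi m_pos by (auto simp: v1_nonneg v2_nonneg)
      then have "\<phi> * ?v1 \<le> dR" "?v2 / real m \<le> dR" using that by (auto simp: energy_def)
      then show "?v1 / 2 \<le> D1" "?v2 / 2 \<le> D2"
        using phi m_pos by (auto simp: D1_def D2_def field_simps)
    qed
    show "emeasure (minorant D1 D2) (space base) = ennreal \<epsilon>B"
      unfolding minorant_mass[OF D] eB h1_eq h2_eq ..
    show "0 \<le> \<epsilon>B" "\<epsilon>B \<le> 1" using mass by (auto simp: eB mult_le_one)
    show "2 * b / (1 - \<gamma>) < dR" by (rule dR)
    show "prob_space post" by (rule prob_space_post)
    show "sets post = sets base" by (rule sets_post)
    show "post \<bind> gibbs = post" by (rule post_stationary)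
  qed (use \<gamma>0 gam b0 in auto)
  have \<alpha>: "\<alpha> = chain.rate" and U': "U = chain.growth" by (simp_all add: al U chain.rate_def chain.growth_def)
  have bound: "tv_dist (gibbs_nstep a1 b1 a2 b2 s0 m0 ms y n (l0, \<xi>)) post
    \<le> (1 - \<epsilon>B) powr (r * real n) + (U powr r / \<alpha> powr (1 - r)) ^ n * (1 + b / (1 - \<gamma>) + energy \<phi> \<xi>)" for \<xi>
    unfolding \<alpha> U'
    using chain.tv_convergence[of "gibbs_nstep a1 b1 a2 b2 s0 m0 ms y" "(l0, \<xi>)" r n] start r n
    by (simp add: space_base)
  have energy: "(\<lambda>\<xi>. \<phi> * v1 (theta_of \<xi>) (mu_of \<xi>) + v2 ms y (theta_of \<xi>) / real m) = energy \<phi>"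
    by (simp add: fun_eq_iff energy_def)
  show ?thesis
    unfolding energy is_arg_min_energy_iff[OF phi(1)]
    using bound[of \<xi>0] bound[of "energy_argmin \<phi>"]
    by (simp add: energy_argmin_value[OF phi(1)] energy_def[of \<phi> \<xi>0] add.assoc)
qed

end
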